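(* Let $P$ be a plain operad and let $A$ be a weak $P$-category, with structure map $h:\mathrm{Wk}(P)\circ A\to A$. Then $A$ is equivalent to its strictification $\mathbf{st}(A)$ in the 2-category $\mathbf{Wk}\text{-}P\text{-}\mathbf{Cat}$ of weak $P$-categories, weak $P$-functors and $P$-transformations.
   Context: Plain operads: a plain operad $P$ consists of sets $P_n$ ($n\ge 0$), compositions $P_n\times P_{k_1}\times\dots\times P_{k_n}\to P_{k_1+\dots+k_n}$, written $p\circ(p_1,\dots,p_n)$, which are associative, and a two-sided unit $1_P\in P_1$. A plain $\mathbf{Cat}$-operad $Q$ is the same with categories $Q_n$ and composition functors, satisfying the same axioms strictly. Objects and morphisms of the $Q_n$ are called 1-cells and 2-cells. An algebra for $Q$ is a category $A$ with functors $h_n:Q_n\times A^n\to A$ (collectively $h:Q\circ A\to A$, where $Q\circ A=\coprod_n Q_n\times A^n$) such that $h(q\circ(q_1,\dots,q_n),-)=h(q,h(q_1,-),\dots,h(q_n,-))$ and $h(1,-)=1_A$, strictly. $D_*P$ is the $\mathbf{Cat}$-operad with $(D_*P)_n$ the discrete category on $P_n$. Unbiased weakening: $U^{\rm pl}:\mathbf{Operad}\to\mathbf{Set}^{\mathbb N}$ is the forgetful functor, $F_{\rm pl}$ its left adjoint, with counit $\epsilon$. Elements of $(F_{\rm pl}\Phi)_n$ are $n$-ary trees: $|$ is the unary unit tree, and $\phi\circ(\tau_1,\dots,\tau_m)$ is a tree for $\phi\in\Phi_m$ and trees $\tau_i$. $\mathrm{Wk}(P)$ is the plain $\mathbf{Cat}$-operad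 whose operad of 1-cells is $F_{\rm pl}U^{\rm pl}P$ and which has exactly one 2-cell $s\to t$ for $n$-ary 1-cells $s,t$ if $\epsilon_P(s)=\epsilon_P(t)$, and none otherwise; compositions of 2-cells are forced. An element $p\in P_n$ is regarded as the 1-cell $p\circ(|,\dots,|)$ of $\mathrm{Wk}(P)$. There is an evident map $\mathrm{Wk}(P)\to D_*P$ extending $\epsilon_P$. A weak $P$-category is an algebra for $\mathrm{Wk}(P)$; a strict $P$-category is an algebra for $D_*P$, regarded as a weak $P$-category via $\mathrm{Wk}(P)\to D_*P$. A weak $P$-functor $(A,h)\to(B,h')$ is a functor $G:A\to B$ with isomorphisms $\psi_{q,a_\bullet}:h'(q,Ga_1,\dots,Ga_n)\to Gh(q,a_1,\dots,a_n)$, natural in $q\in\mathrm{Wk}(P)_n$ and in the $a_i$, such that $\psi_{1}$ is the identity and $\psi_{q\circ(q_1,\dots,q_n)}=\psi_q\cdot h'(q,\psi_{q_1},\dots,\psi_{q_n})$. A $P$-transformation $(F,\phi)\to(G,\psi)$ is a natural transformation $\sigma:F\to G$ with $\sigma_{h(q,a_\bullet)}\cdot\phi_{q,a_\bullet}=\psi_{q,a_\bullet}\cdot h'(q,\sigma_{a_1},\dots,\sigma_{a_n})$ for all $q,a_\bullet$. Strictification: for a weak $P$-category $(A,h)$, the objects of $\mathbf{st}(A)$ are tuples $(p,a_1,\dots,a_n)$ with $n\in\mathbb N$, $p\in P_n$, $a_i\in A$; an arrow $(p,a_\bullet)\to(p',a'_\bullet)$ is an arrow $h(p,a_\bullet)\to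 h(p',a'_\bullet)$ in $A$, with composition and identities as in $A$. The strict $P$-category structure $h'$ on $\mathbf{st}(A)$ is: on objects, for $q\in P_n$, $h'(q,(p_1,a^1_\bullet),\dots,(p_n,a^n_\bullet))=(q\circ(p_1,\dots,p_n),a^1_\bullet,\dots,a^n_\bullet)$ (composition in $P$); on arrows $f_i:(p_i,a^i_\bullet)\to(p'_i,b^i_\bullet)$, $h'(q,f_1,\dots,f_n)$ is the composite $\delta'\cdot h(q,f_1,\dots,f_n)\cdot\delta^{-1}$, where $\delta:h(q,h(p_1,a^1_\bullet),\dots,h(p_n,a^n_\bullet))\to h(q\circ(p_1,\dots,p_n),a^\bullet_\bullet)$ is the image under $h$ of the unique 2-cell of $\mathrm{Wk}(P)$ from the formal (tree) composite of $q$ with the $p_i$ to the composite in $P$, and $\delta'$ is the corresponding isomorphism for the $p'_i$ and $b^i_\bullet$. *)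

theory Defs
  imports Main
begin

section \<open>Categories, functors, natural transformations\<close>

text \<open>
  \<open>Cmp C g f\<close> is the composite \<open>g \<cdot> f\<close>. Nothing is assumed about the values of these
  operations outside the carriers \<open>Obj C\<close> and \<open>Arr C\<close>.
\<close>

record ('o, 'm) cat_data =
  Obj :: "'o set"
  Arr :: "'m set"
  Dom :: "'m \<Rightarrow> 'o"
  Cod :: "'m \<Rightarrow> 'o"
  Idn :: "'o \<Rightarrow> 'm"
  Cmp :: "'m \<Rightarrow> 'm \<Rightarrow> 'm"

definition Hom :: "('o, 'm) cat_data \<Rightarrow> 'o \<Rightarrow> 'o \<Rightarrow> 'm set" where
  "Hom C x y = {f \<in> Arr C. Dom C f = x \<and> Cod C f = y}"

locale category =
  fixes C :: "('o, 'm) cat_data"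
  assumes Dom_Obj: "f \<in> Arr C \<Longrightarrow> Dom C f \<in> Obj C"
    and Cod_Obj: "f \<in> Arr C \<Longrightarrow> Cod C f \<in> Obj C"
    and Idn_Hom: "x \<in> Obj C \<Longrightarrow> Idn C x \<in> Hom C x x"
    and Cmp_Hom: "f \<in> Hom C x y \<Longrightarrow> g \<in> Hom C y z \<Longrightarrow> Cmp C g f \<in> Hom C x z"
    and Cmp_Idn_right: "f \<in> Hom C x y \<Longrightarrow> Cmp C f (Idn C x) = f"
    and Cmp_Idn_left: "f \<in> Hom C x y \<Longrightarrow> Cmp C (Idn C y) f = f"
    and Cmp_assoc: "f \<in> Hom C w x \<Longrightarrow> g \<in> Hom C x y \<Longrightarrow> k \<in> Hom C y z \<Longrightarrow>
      Cmp C k (Cmp C g f) = Cmp C (Cmp C k g) f"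

definition inverse_arrows :: "('o, 'm) cat_data \<Rightarrow> 'm \<Rightarrow> 'm \<Rightarrow> bool" where
  "inverse_arrows C f g \<longleftrightarrow>
     f \<in> Arr C \<and> g \<in> Hom C (Cod C f) (Dom C f) \<and>
     Cmp C g f = Idn C (Dom C f) \<and> Cmp C f g = Idn C (Cod C f)"

definition is_iso :: "('o, 'm) cat_data \<Rightarrow> 'm \<Rightarrow> bool" where
  "is_iso C f \<longleftrightarrow> (\<exists>g. inverse_arrows C f g)"

definition inv_arr :: "('o, 'm) cat_data \<Rightarrow> 'm \<Rightarrow> 'm" where
  "inv_arr C f = (THE g. inverse_arrows C f g)"

definition discrete_cat :: "'o set \<Rightarrow> ('o, 'o) cat_data" where
  "discrete_cat S = \<lparr>Obj = S, Arr = S, Dom = (\<lambda>x. x), Cod = (\<lambda>x. x), Idn = (\<lambda>x. x),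
     Cmp = (\<lambda>g f. f)\<rparr>"

definition prod_cat ::
  "('o, 'm) cat_data \<Rightarrow> ('o2, 'm2) cat_data \<Rightarrow> ('o \<times> 'o2, 'm \<times> 'm2) cat_data" where
  "prod_cat C D = \<lparr>Obj = Obj C \<times> Obj D, Arr = Arr C \<times> Arr D,
     Dom = map_prod (Dom C) (Dom D), Cod = map_prod (Cod C) (Cod D),
     Idn = map_prod (Idn C) (Idn D),
     Cmp = (\<lambda>(g, g') (f, f'). (Cmp C g f, Cmp D g' f'))\<rparr>"

text \<open>The product \<open>C\<^sub>1 \<times> \<dots> \<times> C\<^sub>n\<close>, with tuples as lists, and the power \<open>C\<^sup>n\<close>.\<close>

definition list_cat :: "('o, 'm) cat_data list \<Rightarrow> ('o list, 'm list) cat_data" where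
  "list_cat Cs = \<lparr>
     Obj = {xs. list_all2 (\<lambda>C x. x \<in> Obj C) Cs xs},
     Arr = {fs. list_all2 (\<lambda>C f. f \<in> Arr C) Cs fs},
     Dom = map2 Dom Cs, Cod = map2 Cod Cs, Idn = map2 Idn Cs,
     Cmp = (\<lambda>gs fs. map2 (\<lambda>C (g, f). Cmp C g f) Cs (zip gs fs))\<rparr>"

definition pow_cat :: "('o, 'm) cat_data \<Rightarrow> nat \<Rightarrow> ('o list, 'm list) cat_data" where
  "pow_cat C n = list_cat (replicate n C)"

record ('o, 'm, 'o2, 'm2) fun_data =
  ob :: "'o \<Rightarrow> 'o2"
  ar :: "'m \<Rightarrow> 'm2"

locale cat_functor = A: category A + B: category B
  for A :: "('o, 'm) cat_data" and B :: "('o2, 'm2) cat_data" +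
  fixes F :: "('o, 'm, 'o2, 'm2) fun_data"
  assumes ob_Obj: "x \<in> Obj A \<Longrightarrow> ob F x \<in> Obj B"
    and ar_Hom: "f \<in> Hom A x y \<Longrightarrow> ar F f \<in> Hom B (ob F x) (ob F y)"
    and ar_Idn: "x \<in> Obj A \<Longrightarrow> ar F (Idn A x) = Idn B (ob F x)"
    and ar_Cmp: "f \<in> Hom A x y \<Longrightarrow> g \<in> Hom A y z \<Longrightarrow> ar F (Cmp A g f) = Cmp B (ar F g) (ar F f)"

definition id_fun :: "('o, 'm, 'o, 'm) fun_data" where
  "id_fun = \<lparr>ob = (\<lambda>x. x), ar = (\<lambda>f. f)\<rparr>"

definition comp_fun ::
  "('o2, 'm2, 'o3, 'm3) fun_data \<Rightarrow> ('o, 'm, 'o2, 'm2) fun_data \<Rightarrow> ('o, 'm, 'o3, 'm3) fun_data" where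
  "comp_fun G F = \<lparr>ob = ob G \<circ> ob F, ar = ar G \<circ> ar F\<rparr>"

text \<open>\<open>id \<times> F\<^sup>n\<close>, simultaneously for all \<open>n\<close>.\<close>

definition id_times_pow :: "('o, 'm, 'o2, 'm2) fun_data \<Rightarrow>
    ('q \<times> 'o list, 'c \<times> 'm list, 'q \<times> 'o2 list, 'c \<times> 'm2 list) fun_data" where
  "id_times_pow F = \<lparr>ob = map_prod id (map (ob F)), ar = map_prod id (map (ar F))\<rparr>"

locale nat_trans = F: cat_functor A B F + G: cat_functor A B G
  for A :: "('o, 'm) cat_data" and B :: "('o2, 'm2) cat_data"
    and F :: "('o, 'm, 'o2, 'm2) fun_data" and G :: "('o, 'm, 'o2, 'm2) fun_data" +
  fixes \<tau> :: "'o \<Rightarrow> 'm2"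
  assumes component: "x \<in> Obj A \<Longrightarrow> \<tau> x \<in> Hom B (ob F x) (ob G x)"
    and natural: "f \<in> Hom A x y \<Longrightarrow> Cmp B (\<tau> y) (ar F f) = Cmp B (ar G f) (\<tau> x)"

locale nat_iso = nat_trans +
  assumes component_iso: "x \<in> Obj A \<Longrightarrow> is_iso B (\<tau> x)"


section \<open>Plain operads and plain Cat-operads\<close>

text \<open>
  The sets \<open>P\<^sub>n = ops P n\<close> need not be disjoint, so composition takes the arities
  \<open>ks = [k\<^sub>1, \<dots>, k\<^sub>n]\<close> of the inner operations as an argument:
  \<open>opc P ks q [p\<^sub>1, \<dots>, p\<^sub>n]\<close> is \<open>q \<circ> (p\<^sub>1, \<dots>, p\<^sub>n)\<close>
  for \<open>q \<in> P\<^sub>n\<close> and \<open>p\<^sub>i \<in> P\<^bsub>k\<^sub>i\<^esub>\<close>.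
\<close>

record 'p operad_data =
  ops :: "nat \<Rightarrow> 'p set"
  opc :: "nat list \<Rightarrow> 'p \<Rightarrow> 'p list \<Rightarrow> 'p"
  opu :: 'p

locale plain_operad =
  fixes P :: "'p operad_data"
  assumes opu_ops: "opu P \<in> ops P 1"
    and opc_ops: "q \<in> ops P (length ks) \<Longrightarrow> list_all2 (\<lambda>k p. p \<in> ops P k) ks ps \<Longrightarrow>
      opc P ks q ps \<in> ops P (sum_list ks)"
    and opc_assoc: "q \<in> ops P (length kss) \<Longrightarrow>
      list_all2 (\<lambda>ks p. p \<in> ops P (length ks)) kss ps \<Longrightarrow>
      list_all2 (list_all2 (\<lambda>k r. r \<in> ops P k)) kss rss \<Longrightarrow>
      opc P (map sum_list kss) q (map2 (\<lambda>ks (p, rs). opc P ks p rs) kss (zip ps rss)) =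
      opc P (concat kss) (opc P (map length kss) q ps) (concat rss)"
    and opc_opu_left: "p \<in> ops P n \<Longrightarrow> opc P [n] (opu P) [p] = p"
    and opc_opu_right: "p \<in> ops P n \<Longrightarrow> opc P (replicate n 1) p (replicate n (opu P)) = p"

text \<open>
  For a Cat-operad, \<open>cells Q n\<close> is the category \<open>Q\<^sub>n\<close>, and \<open>gam Q ks\<close> is the composition functor
  \<open>Q\<^sub>n \<times> (Q\<^bsub>k\<^sub>1\<^esub> \<times> \<dots> \<times> Q\<^bsub>k\<^sub>n\<^esub>) \<rightarrow> Q\<^bsub>k\<^sub>1+\<dots>+k\<^sub>n\<^esub>\<close>.
  The operad axioms hold for 1-cells and for 2-cells; the unit among
  2-cells is the identity of the unit 1-cell.
\<close>

record ('q, 'c) cat_operad_data =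
  cells :: "nat \<Rightarrow> ('q, 'c) cat_data"
  gam :: "nat list \<Rightarrow> ('q \<times> 'q list, 'c \<times> 'c list, 'q, 'c) fun_data"
  unt :: 'q

definition operad_of_1_cells :: "('q, 'c) cat_operad_data \<Rightarrow> 'q operad_data" where
  "operad_of_1_cells Q = \<lparr>ops = (\<lambda>n. Obj (cells Q n)),
     opc = (\<lambda>ks q qs. ob (gam Q ks) (q, qs)), opu = unt Q\<rparr>"

definition operad_of_2_cells :: "('q, 'c) cat_operad_data \<Rightarrow> 'c operad_data" where
  "operad_of_2_cells Q = \<lparr>ops = (\<lambda>n. Arr (cells Q n)),
     opc = (\<lambda>ks \<alpha> \<alpha>s. ar (gam Q ks) (\<alpha>, \<alpha>s)), opu = Idn (cells Q 1) (unt Q)\<rparr>"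

locale plain_cat_operad =
  fixes Q :: "('q, 'c) cat_operad_data"
  assumes category_cells: "category (cells Q n)"
    and functor_gam: "cat_functor (prod_cat (cells Q (length ks)) (list_cat (map (cells Q) ks)))
      (cells Q (sum_list ks)) (gam Q ks)"
    and operad_1_cells: "plain_operad (operad_of_1_cells Q)"
    and operad_2_cells: "plain_operad (operad_of_2_cells Q)"


section \<open>Algebras, weak morphisms and transformations\<close>

text \<open>
  \<open>ob (act X) (q, [a\<^sub>1, \<dots>, a\<^sub>n])\<close> is \<open>h(q, a\<^sub>1, \<dots>, a\<^sub>n)\<close>, and similarly for arrows. The family
  \<open>(h\<^sub>n)\<close> is a single pair of functions, \<open>n\<close> being the length of the list.
\<close>

record ('q, 'c, 'o, 'm) alg_data =
  base :: "('o, 'm) cat_data"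
  act :: "('q \<times> 'o list, 'c \<times> 'm list, 'o, 'm) fun_data"

locale cat_algebra = plain_cat_operad Q + base: category "base X"
  for Q :: "('q, 'c) cat_operad_data" and X :: "('q, 'c, 'o, 'm) alg_data" +
  assumes functor_act: "cat_functor (prod_cat (cells Q n) (pow_cat (base X) n)) (base X) (act X)"
    and act_gam_ob: "q \<in> Obj (cells Q (length ks)) \<Longrightarrow>
      list_all2 (\<lambda>k r. r \<in> Obj (cells Q k)) ks rs \<Longrightarrow>
      list_all2 (\<lambda>k as. as \<in> Obj (pow_cat (base X) k)) ks ass \<Longrightarrow>
      ob (act X) (ob (gam Q ks) (q, rs), concat ass) =
      ob (act X) (q, map (ob (act X)) (zip rs ass))"
    and act_gam_ar: "\<alpha> \<in> Arr (cells Q (length ks)) \<Longrightarrow>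
      list_all2 (\<lambda>k \<beta>. \<beta> \<in> Arr (cells Q k)) ks \<beta>s \<Longrightarrow>
      list_all2 (\<lambda>k fs. fs \<in> Arr (pow_cat (base X) k)) ks fss \<Longrightarrow>
      ar (act X) (ar (gam Q ks) (\<alpha>, \<beta>s), concat fss) =
      ar (act X) (\<alpha>, map (ar (act X)) (zip \<beta>s fss))"
    and act_unt_ob: "a \<in> Obj (base X) \<Longrightarrow> ob (act X) (unt Q, [a]) = a"
    and act_unt_ar: "f \<in> Arr (base X) \<Longrightarrow> ar (act X) (Idn (cells Q 1) (unt Q), [f]) = f"

text \<open>
  The coherence constraint \<open>constr G q as\<close> is \<open>\<psi>\<^bsub>q,as\<^esub>\<close>.
\<close>

record ('q, 'o, 'm, 'o2, 'm2) weak_data =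
  und :: "('o, 'm, 'o2, 'm2) fun_data"
  constr :: "'q \<Rightarrow> 'o list \<Rightarrow> 'm2"

locale weak_morphism =
  X: cat_algebra Q X + Y: cat_algebra Q Y + und: cat_functor "base X" "base Y" "und G"
  for Q :: "('q, 'c) cat_operad_data"
    and X :: "('q, 'c, 'o, 'm) alg_data" and Y :: "('q, 'c, 'o2, 'm2) alg_data"
    and G :: "('q, 'o, 'm, 'o2, 'm2) weak_data" +
  assumes constr_iso: "nat_iso (prod_cat (cells Q n) (pow_cat (base X) n)) (base Y)
      (comp_fun (act Y) (id_times_pow (und G))) (comp_fun (und G) (act X))
      (\<lambda>(q, as). constr G q as)"
    and constr_unt: "a \<in> Obj (base X) \<Longrightarrow> constr G (unt Q) [a] = Idn (base Y) (ob (und G) a)"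
    and constr_gam: "q \<in> Obj (cells Q (length ks)) \<Longrightarrow>
      list_all2 (\<lambda>k r. r \<in> Obj (cells Q k)) ks rs \<Longrightarrow>
      list_all2 (\<lambda>k as. as \<in> Obj (pow_cat (base X) k)) ks ass \<Longrightarrow>
      constr G (ob (gam Q ks) (q, rs)) (concat ass) =
      Cmp (base Y) (constr G q (map (ob (act X)) (zip rs ass)))
        (ar (act Y) (Idn (cells Q (length ks)) q, map2 (constr G) rs ass))"

definition id_weak :: "('q, 'c, 'o, 'm) alg_data \<Rightarrow> ('q, 'o, 'm, 'o, 'm) weak_data" where
  "id_weak X = \<lparr>und = id_fun, constr = (\<lambda>q as. Idn (base X) (ob (act X) (q, as)))\<rparr>"

text \<open>
  The composite of \<open>(F, \<phi>) : X \<rightarrow> Y\<close> and \<open>(G, \<psi>) : Y \<rightarrow> Z\<close> has the constraint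
  \<open>h(q, GFa\<^sub>1, \<dots>) \<rightarrow> G h(q, Fa\<^sub>1, \<dots>) \<rightarrow> GF h(q, a\<^sub>1, \<dots>)\<close>.
\<close>

definition comp_weak :: "('q, 'c, 'o3, 'm3) alg_data \<Rightarrow>
    ('q, 'o2, 'm2, 'o3, 'm3) weak_data \<Rightarrow> ('q, 'o, 'm, 'o2, 'm2) weak_data \<Rightarrow>
    ('q, 'o, 'm, 'o3, 'm3) weak_data" where
  "comp_weak Z G F = \<lparr>und = comp_fun (und G) (und F),
     constr = (\<lambda>q as. Cmp (base Z) (ar (und G) (constr F q as))
                        (constr G q (map (ob (und F)) as)))\<rparr>"

locale alg_transformation =
  F: weak_morphism Q X Y F + G: weak_morphism Q X Y G +
  nat_trans "base X" "base Y" "und F" "und G" \<sigma>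
  for Q :: "('q, 'c) cat_operad_data"
    and X :: "('q, 'c, 'o, 'm) alg_data" and Y :: "('q, 'c, 'o2, 'm2) alg_data"
    and F :: "('q, 'o, 'm, 'o2, 'm2) weak_data" and G :: "('q, 'o, 'm, 'o2, 'm2) weak_data"
    and \<sigma> :: "'o \<Rightarrow> 'm2" +
  assumes coherent: "q \<in> Obj (cells Q n) \<Longrightarrow> as \<in> Obj (pow_cat (base X) n) \<Longrightarrow>
      Cmp (base Y) (\<sigma> (ob (act X) (q, as))) (constr F q as) =
      Cmp (base Y) (constr G q as) (ar (act Y) (Idn (cells Q n) q, map \<sigma> as))"

text \<open>
  Isomorphic 1-cells, and equivalent objects, of the 2-category of \<open>Q\<close>-algebras, weak morphisms
  and transformations; vertical composition of 2-cells is componentwise.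
\<close>

definition isomorphic_weak :: "('q, 'c) cat_operad_data \<Rightarrow>
    ('q, 'c, 'o, 'm) alg_data \<Rightarrow> ('q, 'c, 'o2, 'm2) alg_data \<Rightarrow>
    ('q, 'o, 'm, 'o2, 'm2) weak_data \<Rightarrow> ('q, 'o, 'm, 'o2, 'm2) weak_data \<Rightarrow> bool" where
  "isomorphic_weak Q X Y F G \<longleftrightarrow>
     (\<exists>\<sigma> \<sigma>'. alg_transformation Q X Y F G \<sigma> \<and> alg_transformation Q X Y G F \<sigma>' \<and>
        (\<forall>a \<in> Obj (base X).
           Cmp (base Y) (\<sigma>' a) (\<sigma> a) = Idn (base Y) (ob (und F) a) \<and>
           Cmp (base Y) (\<sigma> a) (\<sigma>' a) = Idn (base Y) (ob (und G) a)))"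

definition equivalent_algebras :: "('q, 'c) cat_operad_data \<Rightarrow>
    ('q, 'c, 'o, 'm) alg_data \<Rightarrow> ('q, 'c, 'o2, 'm2) alg_data \<Rightarrow> bool" where
  "equivalent_algebras Q X Y \<longleftrightarrow>
     cat_algebra Q X \<and> cat_algebra Q Y \<and>
     (\<exists>F G. weak_morphism Q X Y F \<and> weak_morphism Q Y X G \<and>
        isomorphic_weak Q X X (id_weak X) (comp_weak X G F) \<and>
        isomorphic_weak Q Y Y (comp_weak Y F G) (id_weak Y))"


section \<open>Free plain operads\<close>

text \<open>\<open>Leaf\<close> is the unit tree, and \<open>Node \<phi> [\<tau>\<^sub>1, \<dots>, \<tau>\<^sub>m]\<close> is \<open>\<phi> \<circ> (\<tau>\<^sub>1, \<dots>, \<tau>\<^sub>m)\<close>.\<close>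

datatype 'p tree = Leaf | Node 'p "'p tree list"

primrec arity :: "'p tree \<Rightarrow> nat" where
  "arity Leaf = 1"
| "arity (Node \<phi> ts) = sum_list (map arity ts)"

inductive well_labelled :: "(nat \<Rightarrow> 'p set) \<Rightarrow> 'p tree \<Rightarrow> bool" for \<Phi> where
  "well_labelled \<Phi> Leaf"
| "\<phi> \<in> \<Phi> (length ts) \<Longrightarrow> (\<And>t. t \<in> set ts \<Longrightarrow> well_labelled \<Phi> t) \<Longrightarrow> well_labelled \<Phi> (Node \<phi> ts)"

text \<open>Cut a list into consecutive blocks of prescribed lengths.\<close>

fun blocks :: "nat list \<Rightarrow> 'a list \<Rightarrow> 'a list list" where
  "blocks [] xs = []"
| "blocks (k # ks) xs = take k xs # blocks ks (drop k xs)"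

text \<open>\<open>graft t ss\<close> replaces the leaves of \<open>t\<close>, from left to right, by the trees \<open>ss\<close>.\<close>

primrec graft :: "'p tree \<Rightarrow> 'p tree list \<Rightarrow> 'p tree" where
  "graft Leaf = hd"
| "graft (Node \<phi> ts) =
     (\<lambda>ss. Node \<phi> (map2 (\<lambda>g us. g us) (map graft ts) (blocks (map arity ts) ss)))"

definition free_operad :: "(nat \<Rightarrow> 'p set) \<Rightarrow> 'p tree operad_data" where
  "free_operad \<Phi> = \<lparr>ops = (\<lambda>n. {t. well_labelled \<Phi> t \<and> arity t = n}),
     opc = (\<lambda>ks. graft), opu = Leaf\<rparr>"

text \<open>The counit \<open>\<epsilon>\<^sub>P\<close> of the free-forgetful adjunction.\<close>

primrec eps :: "'p operad_data \<Rightarrow> 'p tree \<Rightarrow> 'p" where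
  "eps P Leaf = opu P"
| "eps P (Node \<phi> ts) = opc P (map arity ts) \<phi> (map (eps P) ts)"

text \<open>\<open>p \<in> P\<^sub>n\<close> regarded as the tree \<open>p \<circ> (|, \<dots>, |)\<close>.\<close>

definition corolla :: "nat \<Rightarrow> 'p \<Rightarrow> 'p tree" where
  "corolla n p = Node p (replicate n Leaf)"


section \<open>Weak and strict \<open>P\<close>-categories\<close>

text \<open>The unique 2-cell \<open>s \<rightarrow> t\<close> of \<open>Wk P\<close>, when \<open>\<epsilon>\<^sub>P(s) = \<epsilon>\<^sub>P(t)\<close>, is the pair \<open>(s, t)\<close>.\<close>

definition Wk :: "'p operad_data \<Rightarrow> ('p tree, 'p tree \<times> 'p tree) cat_operad_data" where
  "Wk P = (let T = free_operad (ops P) in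
     \<lparr>cells = (\<lambda>n. \<lparr>Obj = ops T n,
                    Arr = {(s, t). s \<in> ops T n \<and> t \<in> ops T n \<and> eps P s = eps P t},
                    Dom = fst, Cod = snd, Idn = (\<lambda>t. (t, t)),
                    Cmp = (\<lambda>(t', u) (s, t). (s, u))\<rparr>),
      gam = (\<lambda>ks. \<lparr>ob = (\<lambda>(t, ts). opc T ks t ts),
                   ar = (\<lambda>(c, cs). (opc T ks (fst c) (map fst cs), opc T ks (snd c) (map snd cs)))\<rparr>),
      unt = opu T\<rparr>)"

definition D_star :: "'p operad_data \<Rightarrow> ('p, 'p) cat_operad_data" where
  "D_star P = \<lparr>cells = (\<lambda>n. discrete_cat (ops P n)),
     gam = (\<lambda>ks. \<lparr>ob = (\<lambda>(p, ps). opc P ks p ps), ar = (\<lambda>(p, ps). opc P ks p ps)\<rparr>),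
     unt = opu P\<rparr>"

abbreviation weak_P_category ::
  "'p operad_data \<Rightarrow> ('p tree, 'p tree \<times> 'p tree, 'o, 'm) alg_data \<Rightarrow> bool" where
  "weak_P_category P \<equiv> cat_algebra (Wk P)"

abbreviation strict_P_category :: "'p operad_data \<Rightarrow> ('p, 'p, 'o, 'm) alg_data \<Rightarrow> bool" where
  "strict_P_category P \<equiv> cat_algebra (D_star P)"

text \<open>
  A strict \<open>P\<close>-category regarded as a weak one, along the map \<open>Wk P \<rightarrow> D_star P\<close> that is
  \<open>\<epsilon>\<^sub>P\<close> on 1-cells and sends the 2-cell \<open>s \<rightarrow> t\<close> to the identity of \<open>\<epsilon>\<^sub>P(s) = \<epsilon>\<^sub>P(t)\<close>.
\<close>

definition Wk_to_D_star :: "'p operad_data \<Rightarrow> ('p tree, 'p tree \<times> 'p tree, 'p, 'p) fun_data" where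
  "Wk_to_D_star P = \<lparr>ob = eps P, ar = (\<lambda>(s, t). eps P s)\<rparr>"

definition strict_as_weak :: "'p operad_data \<Rightarrow> ('p, 'p, 'o, 'm) alg_data \<Rightarrow>
    ('p tree, 'p tree \<times> 'p tree, 'o, 'm) alg_data" where
  "strict_as_weak P X = \<lparr>base = base X,
     act = \<lparr>ob = (\<lambda>(t, as). ob (act X) (ob (Wk_to_D_star P) t, as)),
            ar = (\<lambda>(c, fs). ar (act X) (ar (Wk_to_D_star P) c, fs))\<rparr>\<rparr>"

abbreviation equivalent_in_Wk_P_Cat :: "'p operad_data \<Rightarrow>
    ('p tree, 'p tree \<times> 'p tree, 'o, 'm) alg_data \<Rightarrow>
    ('p tree, 'p tree \<times> 'p tree, 'o2, 'm2) alg_data \<Rightarrow> bool" where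
  "equivalent_in_Wk_P_Cat P \<equiv> equivalent_algebras (Wk P)"


section \<open>Strictification\<close>

text \<open>\<open>h(p, a\<^sub>1, \<dots>, a\<^sub>n)\<close> for \<open>p \<in> P\<^sub>n\<close>.\<close>

definition st_val :: "('p tree, 'p tree \<times> 'p tree, 'o, 'm) alg_data \<Rightarrow> 'p \<times> 'o list \<Rightarrow> 'o" where
  "st_val A x = ob (act A) (corolla (length (snd x)) (fst x), snd x)"

text \<open>An arrow \<open>x \<rightarrow> y\<close> is a triple \<open>(x, y, f)\<close>, so that it determines its source and target.\<close>

definition st_cat :: "'p operad_data \<Rightarrow> ('p tree, 'p tree \<times> 'p tree, 'o, 'm) alg_data \<Rightarrow>
    ('p \<times> 'o list, ('p \<times> 'o list) \<times> ('p \<times> 'o list) \<times> 'm) cat_data" where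
  "st_cat P A = (let Ob = {(p, as). p \<in> ops P (length as) \<and> set as \<subseteq> Obj (base A)} in
     \<lparr>Obj = Ob,
      Arr = {(x, y, f). x \<in> Ob \<and> y \<in> Ob \<and> f \<in> Hom (base A) (st_val A x) (st_val A y)},
      Dom = (\<lambda>(x, y, f). x), Cod = (\<lambda>(x, y, f). y),
      Idn = (\<lambda>x. (x, x, Idn (base A) (st_val A x))),
      Cmp = (\<lambda>(y', z, g) (x, y, f). (x, z, Cmp (base A) g f))\<rparr>)"

definition st_act_ob :: "'p operad_data \<Rightarrow> 'p \<Rightarrow> ('p \<times> 'o list) list \<Rightarrow> 'p \<times> 'o list" where
  "st_act_ob P q xs =
     (opc P (map (\<lambda>(p, as). length as) xs) q (map fst xs), concat (map snd xs))"

text \<open>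
  The isomorphism \<open>\<delta>\<close>: the image, at the identities of the \<open>a\<^sup>i\<^sub>j\<close>, of the 2-cell from the formal
  composite of \<open>q\<close> with the \<open>p\<^sub>i\<close> to their composite in \<open>P\<close>.
\<close>

definition st_delta :: "'p operad_data \<Rightarrow> ('p tree, 'p tree \<times> 'p tree, 'o, 'm) alg_data \<Rightarrow>
    'p \<Rightarrow> ('p \<times> 'o list) list \<Rightarrow> 'm" where
  "st_delta P A q xs =
     (let ks = map (\<lambda>(p, as). length as) xs;
          s = ob (gam (Wk P) ks) (corolla (length xs) q, map (\<lambda>(p, as). corolla (length as) p) xs);
          t = corolla (sum_list ks) (opc P ks q (map fst xs))
      in ar (act A) ((s, t), map (Idn (base A)) (concat (map snd xs))))"

definition st_act_ar :: "'p operad_data \<Rightarrow> ('p tree, 'p tree \<times> 'p tree, 'o, 'm) alg_data \<Rightarrow>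
    'p \<Rightarrow> (('p \<times> 'o list) \<times> ('p \<times> 'o list) \<times> 'm) list \<Rightarrow>
    ('p \<times> 'o list) \<times> ('p \<times> 'o list) \<times> 'm" where
  "st_act_ar P A q fs =
     (let xs = map (\<lambda>(x, y, f). x) fs; ys = map (\<lambda>(x, y, f). y) fs;
          q' = corolla (length fs) q
      in (st_act_ob P q xs, st_act_ob P q ys,
          Cmp (base A) (st_delta P A q ys)
            (Cmp (base A)
              (ar (act A) (Idn (cells (Wk P) (length fs)) q', map (\<lambda>(x, y, f). f) fs))
              (inv_arr (base A) (st_delta P A q xs)))))"

definition strictification :: "'p operad_data \<Rightarrow> ('p tree, 'p tree \<times> 'p tree, 'o, 'm) alg_data \<Rightarrow>
    ('p, 'p, 'p \<times> 'o list, ('p \<times> 'o list) \<times> ('p \<times> 'o list) \<times> 'm) alg_data" where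
  "strictification P A = \<lparr>base = st_cat P A,
     act = \<lparr>ob = (\<lambda>(q, xs). st_act_ob P q xs), ar = (\<lambda>(q, fs). st_act_ar P A q fs)\<rparr>\<rparr>"


section \<open>\<open>Wk P\<close> and \<open>D_star P\<close> are Cat-operads\<close>

text \<open>
  By \<open>plain_operad.plain_cat_operad_Wk\<close> and \<open>plain_operad.plain_cat_operad_D_star\<close>, the condition
  \<open>plain_cat_operad Q\<close> built into \<open>cat_algebra Q\<close> is automatic for weak and strict \<open>P\<close>-categories.
\<close>

lemma category_discrete_cat: "category (discrete_cat S)"
  by unfold_locales (auto simp: discrete_cat_def Hom_def)

lemma category_prod_cat:
  assumes "category C" "category D" shows "category (prod_cat C D)"
proof -
  interpret C: category C by fact
  interpret D: category D by fact
  have H: "f \<in> Hom (prod_cat C D) x y \<longleftrightarrow> fst f \<in> Hom C (fst x) (fst y) \<and> snd f \<in> Hom D (snd x) (snd y)" for f x y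
    by (cases f; cases x; cases y) (auto simp: Hom_def prod_cat_def)
  show ?thesis
    apply unfold_locales
    unfolding H
    by (auto simp: prod_cat_def C.Dom_Obj C.Cod_Obj D.Dom_Obj D.Cod_Obj C.Idn_Hom D.Idn_Hom
       C.Cmp_Hom D.Cmp_Hom C.Cmp_Idn_left D.Cmp_Idn_left C.Cmp_Idn_right D.Cmp_Idn_right split_beta
       intro: C.Cmp_assoc D.Cmp_assoc)
qed

lemma Hom_list_cat:
  "fs \<in> Hom (list_cat Cs) xs ys \<Longrightarrow>
     length fs = length Cs \<and> length xs = length Cs \<and> length ys = length Cs \<and>
     (\<forall>i < length Cs. fs ! i \<in> Hom (Cs ! i) (xs ! i) (ys ! i))"
  by (auto simp: Hom_def list_cat_def list_all2_conv_all_nth)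

lemma Hom_list_catI:
  "length fs = length Cs \<Longrightarrow> length xs = length Cs \<Longrightarrow> length ys = length Cs \<Longrightarrow>
     (\<And>i. i < length Cs \<Longrightarrow> fs ! i \<in> Hom (Cs ! i) (xs ! i) (ys ! i)) \<Longrightarrow>
   fs \<in> Hom (list_cat Cs) xs ys"
  by (auto simp: Hom_def list_cat_def list_all2_conv_all_nth intro!: nth_equalityI)

lemma category_list_cat:
  assumes "\<forall>C \<in> set Cs. category C"
  shows "category (list_cat Cs)"
proof -
  have c: "category (Cs ! i)" if "i < length Cs" for i using assms that by auto
  show ?thesis
  proof
    fix f assume "f \<in> Arr (list_cat Cs)"
    then show "Dom (list_cat Cs) f \<in> Obj (list_cat Cs)" "Cod (list_cat Cs) f \<in> Obj (list_cat Cs)"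
      by (auto simp: list_cat_def list_all2_conv_all_nth c category.Dom_Obj category.Cod_Obj)
  next
    fix x assume "x \<in> Obj (list_cat Cs)"
    then show "Idn (list_cat Cs) x \<in> Hom (list_cat Cs) x x"
      by (intro Hom_list_catI) (auto simp: list_cat_def list_all2_conv_all_nth c category.Idn_Hom)
  next
    fix f x y g z
    assume "f \<in> Hom (list_cat Cs) x y" "g \<in> Hom (list_cat Cs) y z"
    from this[THEN Hom_list_cat]
    show "Cmp (list_cat Cs) g f \<in> Hom (list_cat Cs) x z"
      by (intro Hom_list_catI) (auto simp: list_cat_def intro!: category.Cmp_Hom[OF c])
  next
    fix f x y
    assume "f \<in> Hom (list_cat Cs) x y"
    from this[THEN Hom_list_cat]
    show "Cmp (list_cat Cs) f (Idn (list_cat Cs) x) = f" "Cmp (list_cat Cs) (Idn (list_cat Cs) y) f = f"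
      by (auto simp: list_cat_def intro!: nth_equalityI category.Cmp_Idn_left[OF c] category.Cmp_Idn_right[OF c])
  next
    fix f w x g y k z
    assume "f \<in> Hom (list_cat Cs) w x" "g \<in> Hom (list_cat Cs) x y" "k \<in> Hom (list_cat Cs) y z"
    from this[THEN Hom_list_cat]
    show "Cmp (list_cat Cs) k (Cmp (list_cat Cs) g f) = Cmp (list_cat Cs) (Cmp (list_cat Cs) k g) f"
      by (auto simp: list_cat_def intro!: nth_equalityI category.Cmp_assoc[OF c])
  qed
qed

lemma length_blocks [simp]: "length (blocks ks xs) = length ks"
  by (induction ks xs rule: blocks.induct) auto

lemma concat_blocks: "length xs = sum_list ks \<Longrightarrow> concat (blocks ks xs) = xs"
  by (induction ks xs rule: blocks.induct) auto

lemma map_length_blocks: "length xs = sum_list ks \<Longrightarrow> map length (blocks ks xs) = ks"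
  by (induction ks xs rule: blocks.induct) auto

lemma blocks_concat: "blocks (map length xss) (concat xss) = xss"
  by (induction xss) auto

lemma blocks_map: "blocks ks (map f xs) = map (map f) (blocks ks xs)"
  by (induction ks xs rule: blocks.induct) (auto simp: take_map drop_map)

lemma blocks_append: "length xs = sum_list ks \<Longrightarrow>
   blocks (ks @ ls) (xs @ ys) = blocks ks xs @ blocks ls ys"
  by (induction ks xs rule: blocks.induct) auto

lemma set_blocks: "b \<in> set (blocks ks xs) \<Longrightarrow> set b \<subseteq> set xs"
  by (induction ks xs rule: blocks.induct) (auto dest: in_set_takeD in_set_dropD)

lemma graft_Node: "graft (Node \<phi> ts) ss = Node \<phi> (map2 graft ts (blocks (map arity ts) ss))"
  by (auto simp: zip_map1 intro!: map_cong)

lemma sum_list_map_concat: "sum_list (map f (concat xss)) = sum_list (map (\<lambda>xs. sum_list (map f xs)) xss)"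
  by (induction xss) auto

lemma arity_graft: "length ss = arity t \<Longrightarrow> arity (graft t ss) = sum_list (map arity ss)"
proof (induction t arbitrary: ss)
  case Leaf
  then show ?case by (cases ss) auto
next
  case (Node \<phi> ts)
  have "length ss = sum_list (map arity ts) \<Longrightarrow>
    map arity (map2 graft ts (blocks (map arity ts) ss)) = map (\<lambda>b. sum_list (map arity b)) (blocks (map arity ts) ss)"
    using Node.IH
    by (induction ts arbitrary: ss) auto
  then show ?case using Node.prems
    using sum_list_map_concat[of arity "blocks (map arity ts) ss"]
    by (simp add: graft_Node concat_blocks del: graft.simps)
qed

lemma graft_assoc:
  "length ss = arity t \<Longrightarrow> length us = sum_list (map arity ss) \<Longrightarrow>
   graft t (map2 graft ss (blocks (map arity ss) us)) = graft (graft t ss) us"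
proof (induction t arbitrary: ss us)
  case Leaf
  then show ?case by (cases ss) auto
next
  case (Node \<phi> ts)
  have "length ss = sum_list (map arity ts) \<Longrightarrow> length us = sum_list (map arity ss) \<Longrightarrow>
    map2 graft ts (blocks (map arity ts) (map2 graft ss (blocks (map arity ss) us))) =
    map2 graft (map2 graft ts (blocks (map arity ts) ss))
      (blocks (map arity (map2 graft ts (blocks (map arity ts) ss))) us)"
    using Node.IH
  proof (induction ts arbitrary: ss us)
    case Nil
    then show ?case by simp
  next
    case (Cons t ts)
    define s1 where "s1 = take (arity t) ss"
    define s2 where "s2 = drop (arity t) ss"
    define u1 where "u1 = take (sum_list (map arity s1)) us"
    define u2 where "u2 = drop (sum_list (map arity s1)) us"
    have ss: "ss = s1 @ s2" "length s1 = arity t" "length s2 = sum_list (map arity ts)"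
      using Cons.prems(1) by (auto simp: s1_def s2_def)
    have us: "us = u1 @ u2" "length u1 = sum_list (map arity s1)" "length u2 = sum_list (map arity s2)"
      using Cons.prems(2) ss(1) by (auto simp: u1_def u2_def)
    have 1: "graft t (map2 graft s1 (blocks (map arity s1) u1)) = graft (graft t s1) u1"
      using Cons.prems(3) ss us by simp
    have 2: "map2 graft ts (blocks (map arity ts) (map2 graft s2 (blocks (map arity s2) u2))) =
      map2 graft (map2 graft ts (blocks (map arity ts) s2))
      (blocks (map arity (map2 graft ts (blocks (map arity ts) s2))) u2)"
      using Cons.prems(3) ss us by (intro Cons.IH) auto
    have 3: "arity (graft t s1) = length u1" using ss us by (simp add: arity_graft)
    show ?case using ss us 1 2 3 by (simp add: blocks_append)
  qed
  then show ?case using Node.prems by (simp add: graft_Node del: graft.simps(2))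
qed

lemma well_labelled_Node [simp]:
  "well_labelled \<Phi> (Node \<phi> ts) \<longleftrightarrow> \<phi> \<in> \<Phi> (length ts) \<and> (\<forall>t \<in> set ts. well_labelled \<Phi> t)"
  by (auto intro: well_labelled.intros elim: well_labelled.cases)

lemma well_labelled_graft:
  "well_labelled \<Phi> t \<Longrightarrow> length ss = arity t \<Longrightarrow> (\<And>s. s \<in> set ss \<Longrightarrow> well_labelled \<Phi> s) \<Longrightarrow>
   well_labelled \<Phi> (graft t ss)"
proof (induction t arbitrary: ss)
  case Leaf
  then show ?case by (cases ss) auto
next
  case (Node \<phi> ts)
  have "well_labelled \<Phi> (graft t b)" if "(t, b) \<in> set (zip ts (blocks (map arity ts) ss))" for t b
  proof -
    from that have t: "t \<in> set ts" and b: "b \<in> set (blocks (map arity ts) ss)"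
      by (auto dest: set_zip_leftD set_zip_rightD)
    from that obtain i where i: "i < length ts" "t = ts ! i" "b = blocks (map arity ts) ss ! i"
      by (auto simp: set_zip)
    have "map length (blocks (map arity ts) ss) = map arity ts"
      using Node.prems by (intro map_length_blocks) simp
    then have "map length (blocks (map arity ts) ss) ! i = map arity ts ! i" by simp
    then have "length b = arity t" using i by simp
    then show ?thesis using Node.IH[OF t] Node.prems set_blocks[OF b] t by auto
  qed
  then show ?case using Node.prems by (auto simp: graft_Node simp del: graft.simps)
qed

lemma graft_Leaves: "graft t (replicate (arity t) Leaf) = t"
proof (induction t)
  case (Node \<phi> ts)
  have "map2 graft ts (blocks (map arity ts) (replicate (sum_list (map arity ts)) Leaf)) = ts"
    using Node.IH by (induction ts) auto
  then show ?case by (simp add: graft_Node del: graft.simps)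
qed auto

lemma plain_operad_free_operad: "plain_operad (free_operad \<Phi>)"
proof
  show "opu (free_operad \<Phi>) \<in> ops (free_operad \<Phi>) 1"
    by (auto simp: free_operad_def intro: well_labelled.intros)
next
  fix q ks ps
  assume q: "q \<in> ops (free_operad \<Phi>) (length ks)"
    and ps: "list_all2 (\<lambda>k p. p \<in> ops (free_operad \<Phi>) k) ks ps"
  from ps have "map arity ps = ks" "\<forall>p\<in>set ps. well_labelled \<Phi> p"
    by (induction ps) (auto simp: free_operad_def)
  with q show "opc (free_operad \<Phi>) ks q ps \<in> ops (free_operad \<Phi>) (sum_list ks)"
    by (auto simp: free_operad_def arity_graft intro: well_labelled_graft)
next
  fix q kss ps rss
  assume q: "q \<in> ops (free_operad \<Phi>) (length kss)"
    and ps: "list_all2 (\<lambda>ks p. p \<in> ops (free_operad \<Phi>) (length ks)) kss ps"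
    and rss: "list_all2 (list_all2 (\<lambda>k r. r \<in> ops (free_operad \<Phi>) k)) kss rss"
  have p: "map arity ps = map length kss" using ps
    by (induction) (auto simp: free_operad_def)
  have r: "map length rss = map length kss" using rss
    by (induction) (auto dest: list_all2_lengthD)
  have l: "length ps = length kss" "length rss = length kss"
    using ps rss by (auto dest: list_all2_lengthD)
  have *: "map2 (\<lambda>ks (p, rs). graft p rs) kss (zip ps rss) = map2 graft ps rss"
    using l by (auto intro!: nth_equalityI)
  have b: "blocks (map arity ps) (concat rss) = rss" using p r blocks_concat by metis
  have "graft q (map2 graft ps (blocks (map arity ps) (concat rss))) = graft (graft q ps) (concat rss)"
    using q l p r by (intro graft_assoc) (auto simp: free_operad_def length_concat)
  then show "opc (free_operad \<Phi>) (map sum_list kss) q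
      (map2 (\<lambda>ks (p, rs). opc (free_operad \<Phi>) ks p rs) kss (zip ps rss)) =
    opc (free_operad \<Phi>) (concat kss) (opc (free_operad \<Phi>) (map length kss) q ps) (concat rss)"
    by (simp add: free_operad_def * b)
next
  fix p n assume "p \<in> ops (free_operad \<Phi>) n"
  then show "opc (free_operad \<Phi>) [n] (opu (free_operad \<Phi>)) [p] = p"
    "opc (free_operad \<Phi>) (replicate n 1) p (replicate n (opu (free_operad \<Phi>))) = p"
    by (auto simp: free_operad_def graft_Leaves)
qed

context plain_operad begin

lemma eps_ops: "well_labelled (ops P) t \<Longrightarrow> eps P t \<in> ops P (arity t)"
proof (induction rule: well_labelled.induct)
  case 1
  then show ?case using opu_ops by simp
next
  case (2 \<phi> ts)
  then show ?case
    by (auto intro!: opc_ops simp: list_all2_conv_all_nth)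
qed

lemma eps_graft:
  "well_labelled (ops P) t \<Longrightarrow> length ss = arity t \<Longrightarrow> (\<And>s. s \<in> set ss \<Longrightarrow> well_labelled (ops P) s) \<Longrightarrow>
   eps P (graft t ss) = opc P (map arity ss) (eps P t) (map (eps P) ss)"
proof (induction t arbitrary: ss)
  case Leaf
  then obtain s where "ss = [s]" by (cases ss) auto
  then show ?case using Leaf opc_opu_left[OF eps_ops] by simp
next
  case (Node \<phi> ts)
  define bs where "bs = blocks (map arity ts) ss"
  have lb: "length bs = length ts" by (simp add: bs_def)
  have cb: "concat bs = ss" using Node.prems by (simp add: bs_def concat_blocks)
  have mb: "map length bs = map arity ts"
    using Node.prems unfolding bs_def by (intro map_length_blocks) simp
  have nb: "length (bs ! i) = arity (ts ! i)" if "i < length ts" for i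
    using arg_cong[OF mb, of "\<lambda>x. x ! i"] that lb by simp
  have wb: "well_labelled (ops P) s" if "i < length ts" "s \<in> set (bs ! i)" for i s
    using that lb cb Node.prems(3) by (metis UN_I nth_mem set_concat)
  have e: "eps P (graft (ts ! i) (bs ! i)) = opc P (map arity (bs ! i)) (eps P (ts ! i)) (map (eps P) (bs ! i))"
    if "i < length ts" for i
    using Node.prems(1) that wb[OF that] by (intro Node.IH nb) auto
  have a: "arity (graft (ts ! i) (bs ! i)) = sum_list (map arity (bs ! i))" if "i < length ts" for i
    using nb that by (simp add: arity_graft)
  let ?k = "map (map arity) bs"
  have "opc P (map sum_list ?k) \<phi> (map2 (\<lambda>ks (p, rs). opc P ks p rs) ?k (zip (map (eps P) ts) (map (map (eps P)) bs)))
     = opc P (concat ?k) (opc P (map length ?k) \<phi> (map (eps P) ts)) (concat (map (map (eps P)) bs))"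
  proof (rule opc_assoc)
    show "\<phi> \<in> ops P (length ?k)" using Node.prems lb by simp
    show "list_all2 (\<lambda>ks p. p \<in> ops P (length ks)) ?k (map (eps P) ts)"
      using Node.prems lb nb by (auto simp: list_all2_conv_all_nth eps_ops)
    show "list_all2 (list_all2 (\<lambda>k r. r \<in> ops P k)) ?k (map (map (eps P)) bs)"
      using wb lb by (auto simp: list_all2_conv_all_nth intro!: eps_ops)
  qed
  moreover have "map2 (\<lambda>ks (p, rs). opc P ks p rs) ?k (zip (map (eps P) ts) (map (map (eps P)) bs)) =
     map (eps P) (map2 graft ts bs)"
    using lb e by (auto intro!: nth_equalityI)
  moreover have "map sum_list ?k = map arity (map2 graft ts bs)"
    using lb a by (auto intro!: nth_equalityI)
  moreover have "map length ?k = map arity ts" using mb by (simp add: comp_def)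
  moreover have "concat ?k = map arity ss" "concat (map (map (eps P)) bs) = map (eps P) ss"
    using cb by (auto simp flip: map_concat)
  ultimately show ?case by (simp add: graft_Node bs_def del: graft.simps)
qed

lemma category_Wk: "category (cells (Wk P) n)"
  by unfold_locales (auto simp: Wk_def Let_def Hom_def)

lemma plain_cat_operad_D_star: "plain_cat_operad (D_star P)"
proof -
  have 1: "Obj (list_cat (map (\<lambda>n. discrete_cat (ops P n)) ks)) = {ps. list_all2 (\<lambda>k p. p \<in> ops P k) ks ps}"
    "Arr (list_cat (map (\<lambda>n. discrete_cat (ops P n)) ks)) = {ps. list_all2 (\<lambda>k p. p \<in> ops P k) ks ps}" for ks
    by (auto simp: list_cat_def discrete_cat_def list_all2_conv_all_nth)
  have 2: "f = x \<and> f = y \<and> list_all2 (\<lambda>k p. p \<in> ops P k) ks f"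
    if "f \<in> Hom (list_cat (map (\<lambda>n. discrete_cat (ops P n)) ks)) x y" for f x y ks
    using Hom_list_cat[OF that] by (auto intro!: nth_equalityI simp: Hom_def discrete_cat_def list_all2_conv_all_nth)
  have 3: "map2 (\<lambda>C. Idn C) (map (\<lambda>n. discrete_cat (ops P n)) ks) xs = xs" if "length xs = length ks" for ks xs
    using that by (auto intro!: nth_equalityI simp: discrete_cat_def)
  have 4: "map2 (\<lambda>C. \<lambda>(g,f). Cmp C g f) (map (\<lambda>n. discrete_cat (ops P n)) ks) (zip xs xs) = xs" if "length xs = length ks" for ks xs
    using that by (auto intro!: nth_equalityI simp: discrete_cat_def)
  have H: "fst f = fst x \<and> fst f = fst y \<and> fst f \<in> ops P (length ks) \<and> snd f = snd x \<and> snd f = snd y \<and> list_all2 (\<lambda>k p. p \<in> ops P k) ks (snd f)"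
    if "f \<in> Hom (prod_cat (discrete_cat (ops P (length ks))) (list_cat (map (\<lambda>n. discrete_cat (ops P n)) ks))) x y" for f x y ks
  proof -
    have "fst f \<in> Hom (discrete_cat (ops P (length ks))) (fst x) (fst y)"
      "snd f \<in> Hom (list_cat (map (\<lambda>n. discrete_cat (ops P n)) ks)) (snd x) (snd y)"
      using that by (auto simp: Hom_def prod_cat_def)
    from this(1) 2[OF this(2)] show ?thesis by (auto simp: Hom_def discrete_cat_def)
  qed
  show ?thesis
  proof (rule plain_cat_operad.intro)
    fix n show "category (cells (D_star P) n)" by (simp add: D_star_def category_discrete_cat)
  next
    fix ks
    show "cat_functor (prod_cat (cells (D_star P) (length ks)) (list_cat (map (cells (D_star P)) ks)))
      (cells (D_star P) (sum_list ks)) (gam (D_star P) ks)"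
    proof (intro cat_functor.intro cat_functor_axioms.intro)
      show "category (prod_cat (cells (D_star P) (length ks)) (list_cat (map (cells (D_star P)) ks)))"
        "category (cells (D_star P) (sum_list ks))"
        by (auto simp: D_star_def intro!: category_prod_cat category_list_cat category_discrete_cat)
    next
      fix x assume x: "x \<in> Obj (prod_cat (cells (D_star P) (length ks)) (list_cat (map (cells (D_star P)) ks)))"
      then have *: "list_all2 (\<lambda>k p. p \<in> ops P k) ks (snd x)" "fst x \<in> ops P (length ks)"
        by (auto simp: D_star_def prod_cat_def 1) (auto simp: discrete_cat_def)
      show "ob (gam (D_star P) ks) x \<in> Obj (cells (D_star P) (sum_list ks))"
        using opc_ops[OF *(2,1)] by (auto simp: D_star_def discrete_cat_def split_beta)
      show "ar (gam (D_star P) ks) (Idn (prod_cat (cells (D_star P) (length ks)) (list_cat (map (cells (D_star P)) ks))) x) =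
         Idn (cells (D_star P) (sum_list ks)) (ob (gam (D_star P) ks) x)"
        using list_all2_lengthD[OF *(1)] 3[where xs = "snd x" and ks = ks]
        by (auto simp: D_star_def prod_cat_def list_cat_def split_beta) (auto simp: discrete_cat_def)
    next
      fix f x y assume "f \<in> Hom (prod_cat (cells (D_star P) (length ks)) (list_cat (map (cells (D_star P)) ks))) x y"
      from H[where f = f and ks = ks and x = x and y = y] this have "f = x" "f = y" and *: "fst f \<in> ops P (length ks)" "list_all2 (\<lambda>k p. p \<in> ops P k) ks (snd f)"
        by (auto simp: D_star_def prod_eq_iff)
      then show "ar (gam (D_star P) ks) f \<in> Hom (cells (D_star P) (sum_list ks)) (ob (gam (D_star P) ks) x) (ob (gam (D_star P) ks) y)"
        using opc_ops[OF *] by (auto simp: D_star_def Hom_def discrete_cat_def split_beta)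
    next
      fix f x y g z assume "f \<in> Hom (prod_cat (cells (D_star P) (length ks)) (list_cat (map (cells (D_star P)) ks))) x y"
        "g \<in> Hom (prod_cat (cells (D_star P) (length ks)) (list_cat (map (cells (D_star P)) ks))) y z"
      with H[where f = f and ks = ks and x = x and y = y] H[where f = g and ks = ks and x = y and y = z] have "f = g" and *: "length (snd g) = length ks"
        by (auto simp: D_star_def prod_eq_iff dest: list_all2_lengthD)
      then show "ar (gam (D_star P) ks) (Cmp (prod_cat (cells (D_star P) (length ks)) (list_cat (map (cells (D_star P)) ks))) g f) =
       Cmp (cells (D_star P) (sum_list ks)) (ar (gam (D_star P) ks) g) (ar (gam (D_star P) ks) f)"
        using 4[OF *]
        by (auto simp: D_star_def prod_cat_def list_cat_def split_beta) (auto simp: discrete_cat_def)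
    qed
  next
    have "operad_of_1_cells (D_star P) = \<lparr>ops = ops P, opc = opc P, opu = opu P\<rparr>"
      "operad_of_2_cells (D_star P) = \<lparr>ops = ops P, opc = opc P, opu = opu P\<rparr>"
      by (auto simp: operad_of_1_cells_def operad_of_2_cells_def D_star_def discrete_cat_def)
    then show "plain_operad (operad_of_1_cells (D_star P))" "plain_operad (operad_of_2_cells (D_star P))"
      using plain_operad_axioms by (auto simp: plain_operad_def)
  qed
qed

abbreviation (input) "T \<equiv> free_operad (ops P)"

lemma Wk_simps:
  "Obj (cells (Wk P) n) = ops T n"
  "Arr (cells (Wk P) n) = {(s, t). s \<in> ops T n \<and> t \<in> ops T n \<and> eps P s = eps P t}"
  "Dom (cells (Wk P) n) = fst" "Cod (cells (Wk P) n) = snd" "Idn (cells (Wk P) n) = (\<lambda>t. (t, t))"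
  "Cmp (cells (Wk P) n) g f = (fst f, snd g)"
  "ob (gam (Wk P) ks) (t, ts) = opc T ks t ts"
  "ar (gam (Wk P) ks) (c, cs) = (opc T ks (fst c) (map fst cs), opc T ks (snd c) (map snd cs))"
  "unt (Wk P) = opu T"
  by (auto simp: Wk_def Let_def split_beta)

lemma Wk_ar: 
  assumes "c \<in> Arr (cells (Wk P) (length ks))" "list_all2 (\<lambda>k c. c \<in> Arr (cells (Wk P) k)) ks cs"
  shows "ar (gam (Wk P) ks) (c, cs) \<in> Arr (cells (Wk P) (sum_list ks))"
proof -
  interpret T: plain_operad T by (rule plain_operad_free_operad)
  have c: "fst c \<in> ops T (length ks)" "snd c \<in> ops T (length ks)" "eps P (fst c) = eps P (snd c)"
    using assms(1) by (auto simp: Wk_simps)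
  have cs: "list_all2 (\<lambda>k c. c \<in> ops T k) ks (map fst cs)" "list_all2 (\<lambda>k c. c \<in> ops T k) ks (map snd cs)"
    "map (eps P) (map fst cs) = map (eps P) (map snd cs)"
    using assms(2) by (auto simp: Wk_simps list_all2_conv_all_nth split_beta simp del: map_map intro!: nth_equalityI)
  have e: "eps P (graft t ts) = opc P ks (eps P t) (map (eps P) ts)" if "t \<in> ops T (length ks)" "list_all2 (\<lambda>k c. c \<in> ops T k) ks ts" for t ts
  proof -
    have "map arity ts = ks" using that(2) by induction (auto simp: free_operad_def)
    moreover have "well_labelled (ops P) s" if "s \<in> set ts" for s
      using that \<open>list_all2 _ ks ts\<close> by (auto simp: list_all2_conv_all_nth in_set_conv_nth free_operad_def)
    ultimately show ?thesis using eps_graft[of t ts] that by (auto simp: free_operad_def)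
  qed
  have "eps P (graft (fst c) (map fst cs)) = eps P (graft (snd c) (map snd cs))"
    unfolding e[OF c(1) cs(1)] e[OF c(2) cs(2)] c(3) cs(3) by (rule refl)
  moreover have "opc T ks = graft" by (simp add: free_operad_def)
  ultimately show ?thesis using T.opc_ops[OF c(1) cs(1)] T.opc_ops[OF c(2) cs(2)] by (simp add: Wk_simps)
qed

lemma plain_cat_operad_Wk: "plain_cat_operad (Wk P)"
proof -
  interpret T: plain_operad T by (rule plain_operad_free_operad)
  show ?thesis
  proof (rule plain_cat_operad.intro)
    fix n show "category (cells (Wk P) n)" by (rule category_Wk)
  next
    have "operad_of_1_cells (Wk P) = free_operad (ops P)"
      by (simp add: operad_of_1_cells_def Wk_simps)
    then show "plain_operad (operad_of_1_cells (Wk P))" by (simp add: plain_operad_free_operad)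
  next
    fix ks
    let ?D = "prod_cat (cells (Wk P) (length ks)) (list_cat (map (cells (Wk P)) ks))"
    have H: "fst (fst f) = fst x \<and> map fst (snd f) = snd x \<and> snd (fst f) = fst y \<and> map snd (snd f) = snd y
      \<and> length (snd f) = length ks
      \<and> fst f \<in> Arr (cells (Wk P) (length ks)) \<and> list_all2 (\<lambda>k c. c \<in> Arr (cells (Wk P) k)) ks (snd f)"
      if "f \<in> Hom ?D x y" for f x y
    proof -
      have 1: "fst f \<in> Hom (cells (Wk P) (length ks)) (fst x) (fst y)"
        "snd f \<in> Hom (list_cat (map (cells (Wk P)) ks)) (snd x) (snd y)"
        using that by (auto simp: Hom_def prod_cat_def)
      from Hom_list_cat[OF 1(2)]
      have "map fst (snd f) = snd x" "map snd (snd f) = snd y" "length (snd f) = length ks"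
        by (auto intro!: nth_equalityI simp: Hom_def Wk_simps)
      moreover from Hom_list_cat[OF 1(2)] have "list_all2 (\<lambda>k c. c \<in> Arr (cells (Wk P) k)) ks (snd f)"
        by (auto simp: list_all2_conv_all_nth Hom_def)
      ultimately show ?thesis using 1(1) by (auto simp: Hom_def Wk_simps)
    qed
    show "cat_functor ?D (cells (Wk P) (sum_list ks)) (gam (Wk P) ks)"
    proof (intro cat_functor.intro cat_functor_axioms.intro)
      show "category ?D" "category (cells (Wk P) (sum_list ks))"
        by (auto intro!: category_prod_cat category_list_cat category_Wk)
    next
      fix x assume x: "x \<in> Obj ?D"
      then have *: "list_all2 (\<lambda>k p. p \<in> ops T k) ks (snd x)" "fst x \<in> ops T (length ks)"
        by (auto simp: prod_cat_def list_cat_def list_all2_conv_all_nth Wk_simps)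
      show "ob (gam (Wk P) ks) x \<in> Obj (cells (Wk P) (sum_list ks))"
        using T.opc_ops[OF *(2,1)] by (cases x) (simp add: Wk_simps)
      have "map fst (map2 Idn (map (cells (Wk P)) ks) (snd x)) = snd x"
        "map snd (map2 Idn (map (cells (Wk P)) ks) (snd x)) = snd x"
        using list_all2_lengthD[OF *(1)] by (auto intro!: nth_equalityI simp: Wk_simps)
      then show "ar (gam (Wk P) ks) (Idn ?D x) = Idn (cells (Wk P) (sum_list ks)) (ob (gam (Wk P) ks) x)"
        by (cases x) (simp add: Wk_simps prod_cat_def list_cat_def)
    next
      fix f x y assume "f \<in> Hom ?D x y"
      from H[OF this] Wk_ar[of "fst f" ks "snd f"]
      show "ar (gam (Wk P) ks) f \<in> Hom (cells (Wk P) (sum_list ks)) (ob (gam (Wk P) ks) x) (ob (gam (Wk P) ks) y)"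
        by (cases x; cases y; cases f) (auto simp: Hom_def Wk_simps)
    next
      fix f x y g z assume "f \<in> Hom ?D x y" "g \<in> Hom ?D y z"
      from this[THEN H] have l: "length (snd f) = length ks" "length (snd g) = length ks" by auto
      then have "map fst (map2 (\<lambda>C (g, f). Cmp C g f) (map (cells (Wk P)) ks) (zip (snd g) (snd f))) = map fst (snd f)"
        "map snd (map2 (\<lambda>C (g, f). Cmp C g f) (map (cells (Wk P)) ks) (zip (snd g) (snd f))) = map snd (snd g)"
        by (auto intro!: nth_equalityI simp: Wk_simps)
      then show "ar (gam (Wk P) ks) (Cmp ?D g f) =
          Cmp (cells (Wk P) (sum_list ks)) (ar (gam (Wk P) ks) g) (ar (gam (Wk P) ks) f)"
        by (cases f; cases g) (simp add: Wk_simps prod_cat_def list_cat_def split_beta)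
    qed
  next
    show "plain_operad (operad_of_2_cells (Wk P))"
    proof
      show "opu (operad_of_2_cells (Wk P)) \<in> ops (operad_of_2_cells (Wk P)) 1"
        using T.opu_ops by (simp add: operad_of_2_cells_def Wk_simps)
    next
      fix q ks ps assume "q \<in> ops (operad_of_2_cells (Wk P)) (length ks)"
        "list_all2 (\<lambda>k p. p \<in> ops (operad_of_2_cells (Wk P)) k) ks ps"
      then show "opc (operad_of_2_cells (Wk P)) ks q ps \<in> ops (operad_of_2_cells (Wk P)) (sum_list ks)"
        using Wk_ar[of q ks ps] by (simp add: operad_of_2_cells_def)
    next
      fix p n assume "p \<in> ops (operad_of_2_cells (Wk P)) n"
      then have "fst p \<in> ops T n" "snd p \<in> ops T n" by (auto simp: operad_of_2_cells_def Wk_simps)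
      then show "opc (operad_of_2_cells (Wk P)) [n] (opu (operad_of_2_cells (Wk P))) [p] = p"
        "opc (operad_of_2_cells (Wk P)) (replicate n 1) p (replicate n (opu (operad_of_2_cells (Wk P)))) = p"
        using T.opc_opu_left T.opc_opu_right[of "fst p" n] T.opc_opu_right[of "snd p" n]
        by (auto simp: operad_of_2_cells_def Wk_simps)
    next
      fix q kss ps rss
      let ?O = "operad_of_2_cells (Wk P)"
      assume q: "q \<in> ops ?O (length kss)"
        and ps: "list_all2 (\<lambda>ks p. p \<in> ops ?O (length ks)) kss ps"
        and rss: "list_all2 (list_all2 (\<lambda>k r. r \<in> ops ?O k)) kss rss"
      have l: "length ps = length kss" "length rss = length kss"
        using ps rss by (auto dest: list_all2_lengthD)
      have o: "opc ?O ks c cs = (opc T ks (fst c) (map fst cs), opc T ks (snd c) (map snd cs))" for ks c cs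
        by (simp add: operad_of_2_cells_def Wk_simps)
      have o': "opc ?O = (\<lambda>ks c cs. (opc T ks (fst c) (map fst cs), opc T ks (snd c) (map snd cs)))"
        by (intro ext o)
      have 1: "opc T (map sum_list kss) (\<pi> q) (map2 (\<lambda>ks (p, rs). opc T ks p rs) kss (zip (map \<pi> ps) (map (map \<pi>) rss))) =
         opc T (concat kss) (opc T (map length kss) (\<pi> q) (map \<pi> ps)) (concat (map (map \<pi>) rss))"
        if "\<pi> = fst \<or> \<pi> = snd" for \<pi>
        by (rule T.opc_assoc)
          (use that q ps rss in \<open>auto simp: operad_of_2_cells_def Wk_simps list_all2_conv_all_nth split_beta\<close>)
      have 2: "map2 (\<lambda>ks (p, rs). opc T ks p rs) kss (zip (map fst ps) (map (map fst) rss)) =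
          map fst (map2 (\<lambda>ks (p, rs). opc ?O ks p rs) kss (zip ps rss))"
        "map2 (\<lambda>ks (p, rs). opc T ks p rs) kss (zip (map snd ps) (map (map snd) rss)) =
          map snd (map2 (\<lambda>ks (p, rs). opc ?O ks p rs) kss (zip ps rss))"
        using l by (auto intro!: nth_equalityI simp: o)
      show "opc ?O (map sum_list kss) q (map2 (\<lambda>ks (p, rs). opc ?O ks p rs) kss (zip ps rss)) =
        opc ?O (concat kss) (opc ?O (map length kss) q ps) (concat rss)"
        using 1[of fst] 1[of snd] unfolding 2 by (simp add: o' map_concat del: map_map)
    qed
  qed
qed

end

end

theory Submission
  imports Defs
begin

text \<open>
  Let \<open>v\<close> send an object \<open>(p, a\<^sub>1, \<dots>, a\<^sub>n)\<close> of the strictification to \<open>h(p, a\<^sub>1, \<dots>, a\<^sub>n)\<close>, and an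
  arrow to the arrow of \<open>A\<close> that it consists of. By construction \<open>v\<close> is fully faithful, and it is
  essentially surjective because the 2-cell from the corolla of the operadic unit to the unit tree
  gives an isomorphism from \<open>v(1, a)\<close> to \<open>a\<close>. So \<open>v\<close> is an equivalence of categories, and two
  things remain: it must carry the structure of a weak \<open>P\<close>-functor, and a weak \<open>P\<close>-functor that is
  an equivalence of categories must be an equivalence in the 2-category.

  The constraint of \<open>v\<close> at a tree \<open>t\<close> and objects \<open>x\<^sub>i = (p\<^sub>i, a\<^sup>i)\<close> is the isomorphism
  \<open>\<theta>\<^sub>t : h(t, v x\<^sub>1, \<dots>, v x\<^sub>n) \<rightarrow> v(\<epsilon>(t) \<cdot> (x\<^sub>1, \<dots>, x\<^sub>n))\<close> (\<open>st_coh\<close>): the image of the 2-cell from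
  \<open>t\<close> with the corollas of the \<open>p\<^sub>i\<close> grafted onto it to the corolla of the composite in \<open>P\<close>. The
  arrows \<open>\<delta>\<close> in the definition of the strictification are the \<open>\<theta>\<^sub>t\<close> for corollas \<open>t\<close>. Parallel 2-cells of
  \<open>Wk P\<close> are equal, and \<open>h\<close> preserves vertical and operadic composition of 2-cells, hence \<open>\<theta>\<close> satisfies
  \<open>\<theta>\<^sub>t \<cdot> h(s \<rightarrow> t) = \<theta>\<^sub>s\<close> whenever \<open>\<epsilon>(s) = \<epsilon>(t)\<close> (\<open>st_coh_coh\<close>), and \<open>\<theta>\<close> of a grafted tree is the composite of
  \<open>\<theta>\<^sub>t\<close> with \<open>h(t, \<theta>, \<dots>, \<theta>)\<close> (\<open>st_coh_graft\<close>). These identities do all the work. By the first, the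
  action \<open>g\<close> of \<open>\<epsilon>(s)\<close> on arrows \<open>f\<^sub>i\<close> of the strictification satisfies
  \<open>g \<cdot> \<theta>\<^sub>s = \<theta>\<^sub>t \<cdot> h(s \<rightarrow> t, f\<^sub>1, \<dots>, f\<^sub>n)\<close> (\<open>st_ar_natural\<close>), which is the naturality of the constraint; since \<open>\<theta>\<^sub>s\<close> is
  invertible, the equation determines \<open>g\<close> (\<open>st_ar_unique\<close>), and the strict algebra axioms on arrows are
  checked by showing that both sides solve the same equation. On objects they are the axioms of \<open>P\<close>.

  For the second point (\<open>weak_equivalence\<close>), let \<open>(F, \<phi>) : X \<rightarrow> Y\<close> be fully faithful with isomorphisms
  \<open>e\<^sub>y : F (R y) \<rightarrow> y\<close>. Full faithfulness leaves exactly one way to make \<open>R\<close> a functor with constraint \<open>\<psi>\<close> such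
  that \<open>e\<close> is a transformation. Any equation required of \<open>R\<close> and \<open>\<psi>\<close> may be checked after
  applying \<open>F\<close>, precomposing with \<open>\<phi>\<close> and postcomposing with \<open>e\<close>, where it becomes an instance of the
  corresponding equation for \<open>\<phi>\<close>.
\<close>


section \<open>Categories and functors\<close>

text \<open>
  The rules below speak of \<open>Arr\<close>, \<open>Dom\<close> and \<open>Cod\<close> instead of \<open>Hom\<close>: their side conditions do not
  mention objects that the simplifier would have to guess, so composites are reassociated to
  the right and identities are removed automatically.
\<close>

context category begin

lemma Idn_Arr [simp]: "x \<in> Obj C \<Longrightarrow> Idn C x \<in> Arr C"
  and Dom_Idn [simp]: "x \<in> Obj C \<Longrightarrow> Dom C (Idn C x) = x"
  and Cod_Idn [simp]: "x \<in> Obj C \<Longrightarrow> Cod C (Idn C x) = x"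
  using Idn_Hom[of x] by (auto simp: Hom_def)

lemma Cmp_Arr [simp]: "f \<in> Arr C \<Longrightarrow> g \<in> Arr C \<Longrightarrow> Dom C g = Cod C f \<Longrightarrow> Cmp C g f \<in> Arr C"
  and Dom_Cmp [simp]: "f \<in> Arr C \<Longrightarrow> g \<in> Arr C \<Longrightarrow> Dom C g = Cod C f \<Longrightarrow> Dom C (Cmp C g f) = Dom C f"
  and Cod_Cmp [simp]: "f \<in> Arr C \<Longrightarrow> g \<in> Arr C \<Longrightarrow> Dom C g = Cod C f \<Longrightarrow> Cod C (Cmp C g f) = Cod C g"
  using Cmp_Hom[of f "Dom C f" "Cod C f" g "Cod C g"] by (auto simp: Hom_def)

lemma Cmp_Cmp [simp]:
  "f \<in> Arr C \<Longrightarrow> g \<in> Arr C \<Longrightarrow> k \<in> Arr C \<Longrightarrow> Dom C g = Cod C f \<Longrightarrow> Dom C k = Cod C g \<Longrightarrow>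
     Cmp C (Cmp C k g) f = Cmp C k (Cmp C g f)"
  using Cmp_assoc[of f "Dom C f" "Cod C f" g "Cod C g" k "Cod C k"] by (simp add: Hom_def)

lemma Cmp_Idn_Dom [simp]: "f \<in> Arr C \<Longrightarrow> Dom C f = x \<Longrightarrow> Cmp C f (Idn C x) = f"
  and Cmp_Idn_Cod [simp]: "f \<in> Arr C \<Longrightarrow> Cod C f = y \<Longrightarrow> Cmp C (Idn C y) f = f"
  using Cmp_Idn_right[of f "Dom C f" "Cod C f"] Cmp_Idn_left[of f "Dom C f" "Cod C f"]
  by (auto simp: Hom_def)

lemma inverse_arrows_sym: "inverse_arrows C f g \<Longrightarrow> inverse_arrows C g f"
  by (auto simp: inverse_arrows_def Hom_def)

lemma inverse_arrows_unique:
  assumes "inverse_arrows C f g" "inverse_arrows C f g'" shows "g = g'"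
proof -
  have "Cmp C (Cmp C g f) g' = Cmp C g (Cmp C f g')"
    using assms by (intro Cmp_Cmp) (auto simp: inverse_arrows_def Hom_def)
  then show ?thesis using assms by (auto simp: inverse_arrows_def Hom_def)
qed

lemma inv_arr_eqI: "inverse_arrows C f g \<Longrightarrow> inv_arr C f = g"
  unfolding inv_arr_def by (blast intro: inverse_arrows_unique the_equality)

lemma inverse_arrows_inv_arr: "is_iso C f \<Longrightarrow> inverse_arrows C f (inv_arr C f)"
  by (metis is_iso_def inv_arr_eqI)

lemma iso_Arr: "is_iso C f \<Longrightarrow> f \<in> Arr C"
  by (auto simp: is_iso_def inverse_arrows_def)

lemma inv_arr_simps [simp]:
  assumes "is_iso C f"
  shows "inv_arr C f \<in> Arr C" "Dom C (inv_arr C f) = Cod C f" "Cod C (inv_arr C f) = Dom C f"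
    "Cmp C (inv_arr C f) f = Idn C (Dom C f)" "Cmp C f (inv_arr C f) = Idn C (Cod C f)"
  using inverse_arrows_inv_arr[OF assms] by (auto simp: inverse_arrows_def Hom_def)

text \<open>Proofs that two arrows are equal usually end here, with \<open>k\<close> a coherence isomorphism.\<close>

lemma iso_cancel_right:
  assumes k: "is_iso C k" and f: "f \<in> Arr C" "Dom C f = Cod C k" and g: "g \<in> Arr C" "Dom C g = Cod C k"
    and eq: "Cmp C f k = Cmp C g k"
  shows "f = g"
proof -
  have "Cmp C (Cmp C f k) (inv_arr C k) = Cmp C (Cmp C g k) (inv_arr C k)" by (simp add: eq)
  then show ?thesis using f g k iso_Arr[OF k] by simp
qed

lemma is_iso_inv_arr: "is_iso C f \<Longrightarrow> is_iso C (inv_arr C f)"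
  using inverse_arrows_sym[OF inverse_arrows_inv_arr] by (auto simp: is_iso_def)

lemma is_iso_Idn: "x \<in> Obj C \<Longrightarrow> is_iso C (Idn C x)"
  unfolding is_iso_def inverse_arrows_def by (rule exI[of _ "Idn C x"]) (auto simp: Hom_def)

lemma is_iso_Cmp:
  assumes "is_iso C f" "is_iso C g" "Dom C g = Cod C f" shows "is_iso C (Cmp C g f)"
proof -
  note [simp] = iso_Arr[OF assms(1)] iso_Arr[OF assms(2)] assms Dom_Obj Cod_Obj
  have 1: "Cmp C (inv_arr C g) (Cmp C g f) = f" "Cmp C f (Cmp C (inv_arr C f) (inv_arr C g)) = inv_arr C g"
    by (simp_all flip: Cmp_Cmp)
  have "inverse_arrows C (Cmp C g f) (Cmp C (inv_arr C f) (inv_arr C g))"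
    by (simp add: inverse_arrows_def Hom_def 1)
  then show ?thesis by (auto simp: is_iso_def)
qed

end

context cat_functor begin

lemma ar_Arr [simp]: "f \<in> Arr A \<Longrightarrow> ar F f \<in> Arr B"
  and Dom_ar [simp]: "f \<in> Arr A \<Longrightarrow> Dom B (ar F f) = ob F (Dom A f)"
  and Cod_ar [simp]: "f \<in> Arr A \<Longrightarrow> Cod B (ar F f) = ob F (Cod A f)"
  using ar_Hom[of f "Dom A f" "Cod A f"] by (auto simp: Hom_def)

lemma ar_Cmp': "f \<in> Arr A \<Longrightarrow> g \<in> Arr A \<Longrightarrow> Dom A g = Cod A f \<Longrightarrow>
    ar F (Cmp A g f) = Cmp B (ar F g) (ar F f)"
  using ar_Cmp[of f "Dom A f" "Cod A f" g "Cod A g"] by (auto simp: Hom_def)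

lemma map_ar:
  assumes "set fs \<subseteq> Arr A"
  shows "set (map (ar F) fs) \<subseteq> Arr B" "map (Dom B) (map (ar F) fs) = map (ob F) (map (Dom A) fs)"
    "map (Cod B) (map (ar F) fs) = map (ob F) (map (Cod A) fs)"
  using assms by auto

lemma is_iso_ar: "is_iso A f \<Longrightarrow> is_iso B (ar F f)"
proof -
  assume f: "is_iso A f"
  note [simp] = A.iso_Arr[OF f] A.Dom_Obj A.Cod_Obj
  have "inverse_arrows B (ar F f) (ar F (inv_arr A f))"
    using f by (simp add: inverse_arrows_def Hom_def ar_Cmp'[symmetric] ar_Idn)
  then show ?thesis by (auto simp: is_iso_def)
qed

end

lemma cat_functorI:
  assumes "category A" "category B"
    and "\<And>x. x \<in> Obj A \<Longrightarrow> ob F x \<in> Obj B"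
    and "\<And>f. f \<in> Arr A \<Longrightarrow> ar F f \<in> Hom B (ob F (Dom A f)) (ob F (Cod A f))"
    and "\<And>x. x \<in> Obj A \<Longrightarrow> ar F (Idn A x) = Idn B (ob F x)"
    and "\<And>f g. f \<in> Arr A \<Longrightarrow> g \<in> Arr A \<Longrightarrow> Dom A g = Cod A f \<Longrightarrow>
      ar F (Cmp A g f) = Cmp B (ar F g) (ar F f)"
  shows "cat_functor A B F"
  using assms by (auto simp: cat_functor_def cat_functor_axioms_def Hom_def)

lemma cat_functor_id: "category C \<Longrightarrow> cat_functor C C id_fun"
  by (intro cat_functorI) (auto simp: id_fun_def Hom_def)

lemma cat_functor_comp:
  assumes "cat_functor A B F" "cat_functor B C G" shows "cat_functor A C (comp_fun G F)"
proof -
  interpret F: cat_functor A B F by fact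
  interpret G: cat_functor B C G by fact
  show ?thesis
    by (intro cat_functorI)
      (auto simp: comp_fun_def Hom_def F.A.category_axioms G.B.category_axioms F.ob_Obj G.ob_Obj
        F.ar_Idn G.ar_Idn F.ar_Cmp' G.ar_Cmp')
qed

section \<open>Powers of a category\<close>

lemma pow_cat_Obj: "Obj (pow_cat C n) = {xs. length xs = n \<and> set xs \<subseteq> Obj C}"
  by (auto simp: pow_cat_def list_cat_def list_all2_conv_all_nth in_set_conv_nth subset_iff)

lemma pow_cat_Arr: "Arr (pow_cat C n) = {xs. length xs = n \<and> set xs \<subseteq> Arr C}"
  by (auto simp: pow_cat_def list_cat_def list_all2_conv_all_nth in_set_conv_nth subset_iff)

lemma pow_cat_Dom: "length fs = n \<Longrightarrow> Dom (pow_cat C n) fs = map (Dom C) fs"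
  and pow_cat_Cod: "length fs = n \<Longrightarrow> Cod (pow_cat C n) fs = map (Cod C) fs"
  and pow_cat_Idn: "length xs = n \<Longrightarrow> Idn (pow_cat C n) xs = map (Idn C) xs"
  and pow_cat_Cmp: "length fs = n \<Longrightarrow> length gs = n \<Longrightarrow> Cmp (pow_cat C n) gs fs = map2 (Cmp C) gs fs"
  by (auto simp: pow_cat_def list_cat_def intro!: nth_equalityI)

lemma category_pow_cat: "category C \<Longrightarrow> category (pow_cat C n)"
  unfolding pow_cat_def by (rule category_list_cat) simp

text \<open>
  The associativity axioms of algebras quantify over arities and over blocks of these lengths;
  the arities can be read off from the blocks.
\<close>

lemma pow_cat_Obj_blocks:
  "list_all2 (\<lambda>k as. as \<in> Obj (pow_cat C k)) ks ass \<longleftrightarrow>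
     ks = map length ass \<and> (\<forall>as \<in> set ass. set as \<subseteq> Obj C)"
  by (induction ks arbitrary: ass; rename_tac ass; case_tac ass) (auto simp: pow_cat_Obj list_all2_Cons1)

lemma pow_cat_Arr_blocks:
  "list_all2 (\<lambda>k as. as \<in> Arr (pow_cat C k)) ks ass \<longleftrightarrow>
     ks = map length ass \<and> (\<forall>as \<in> set ass. set as \<subseteq> Arr C)"
  by (induction ks arbitrary: ass; rename_tac ass; case_tac ass) (auto simp: pow_cat_Arr list_all2_Cons1)

lemma prod_cat_simps:
  "Obj (prod_cat C D) = Obj C \<times> Obj D" "Arr (prod_cat C D) = Arr C \<times> Arr D"
  "Dom (prod_cat C D) (f, f') = (Dom C f, Dom D f')" "Cod (prod_cat C D) (f, f') = (Cod C f, Cod D f')"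
  "Idn (prod_cat C D) (x, x') = (Idn C x, Idn D x')"
  "Cmp (prod_cat C D) (g, g') (f, f') = (Cmp C g f, Cmp D g' f')"
  by (auto simp: prod_cat_def)

lemmas prod_pow_simps = prod_cat_simps pow_cat_Obj pow_cat_Arr pow_cat_Dom pow_cat_Cod pow_cat_Idn pow_cat_Cmp

lemma map2_Cmp_lists:
  assumes "category C" "set fs \<subseteq> Arr C" "set gs \<subseteq> Arr C" "map (Dom C) gs = map (Cod C) fs"
  shows "set (map2 (Cmp C) gs fs) \<subseteq> Arr C" "map (Dom C) (map2 (Cmp C) gs fs) = map (Dom C) fs"
    "map (Cod C) (map2 (Cmp C) gs fs) = map (Cod C) gs"
proof -
  have l: "length gs = length fs" using arg_cong[OF assms(4), of length] by simp
  have d: "Dom C (gs ! i) = Cod C (fs ! i)" if "i < length fs" for i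
    using arg_cong[OF assms(4), of "\<lambda>l. l ! i"] that l by simp
  have a: "fs ! i \<in> Arr C" "gs ! i \<in> Arr C" if "i < length fs" for i
    using assms(2,3) l that by (auto simp: subset_iff)
  show "set (map2 (Cmp C) gs fs) \<subseteq> Arr C" "map (Dom C) (map2 (Cmp C) gs fs) = map (Dom C) fs"
    "map (Cod C) (map2 (Cmp C) gs fs) = map (Cod C) gs"
    using l a d category.Cmp_Arr[OF assms(1)] category.Dom_Cmp[OF assms(1)] category.Cod_Cmp[OF assms(1)]
    by (auto intro!: nth_equalityI simp: set_zip)
qed

lemma cat_functor_id_times_pow:
  assumes "category D" "cat_functor A B F"
  shows "cat_functor (prod_cat D (pow_cat A n)) (prod_cat D (pow_cat B n)) (id_times_pow F)"
proof -
  interpret D: category D by fact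
  interpret F: cat_functor A B F by fact
  have [simp]: "map (ar F \<circ> (\<lambda>(g, f). Cmp A g f)) (zip gs fs) = map2 (Cmp B) (map (ar F) gs) (map (ar F) fs)"
    if "set fs \<subseteq> Arr A" "set gs \<subseteq> Arr A" "map (Dom A) gs = map (Cod A) fs" for fs gs
    using that by (induction gs fs rule: list_induct2') (auto simp: F.ar_Cmp')
  show ?thesis
    by (intro cat_functorI)
      (auto simp: id_times_pow_def prod_pow_simps Hom_def F.ob_Obj F.ar_Idn subset_iff
        intro!: category_prod_cat category_pow_cat D.category_axioms F.A.category_axioms F.B.category_axioms)
qed

section \<open>Algebras and weak morphisms\<close>

context cat_algebra begin

lemma category_all_cells [simp]: "category (cells Q n)"
  by (rule category_cells)

lemma act_Obj: "q \<in> Obj (cells Q n) \<Longrightarrow> length as = n \<Longrightarrow> set as \<subseteq> Obj (base X) \<Longrightarrow>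
    ob (act X) (q, as) \<in> Obj (base X)"
  using cat_functor.ob_Obj[OF functor_act[of n], of "(q, as)"] by (simp add: prod_pow_simps)

lemma
  assumes "\<alpha> \<in> Arr (cells Q n)" "length fs = n" "set fs \<subseteq> Arr (base X)"
  shows act_Arr: "ar (act X) (\<alpha>, fs) \<in> Arr (base X)"
    and act_Dom: "Dom (base X) (ar (act X) (\<alpha>, fs)) = ob (act X) (Dom (cells Q n) \<alpha>, map (Dom (base X)) fs)"
    and act_Cod: "Cod (base X) (ar (act X) (\<alpha>, fs)) = ob (act X) (Cod (cells Q n) \<alpha>, map (Cod (base X)) fs)"
  using cat_functor.ar_Arr[OF functor_act[of n], of "(\<alpha>, fs)"]
    cat_functor.Dom_ar[OF functor_act[of n], of "(\<alpha>, fs)"]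
    cat_functor.Cod_ar[OF functor_act[of n], of "(\<alpha>, fs)"] assms
  by (simp_all add: prod_pow_simps)

lemma act_Idn: "q \<in> Obj (cells Q n) \<Longrightarrow> length as = n \<Longrightarrow> set as \<subseteq> Obj (base X) \<Longrightarrow>
    ar (act X) (Idn (cells Q n) q, map (Idn (base X)) as) = Idn (base X) (ob (act X) (q, as))"
  using cat_functor.ar_Idn[OF functor_act[of n], of "(q, as)"] by (simp add: prod_pow_simps)

lemma act_Cmp:
  assumes "\<alpha> \<in> Arr (cells Q n)" "\<beta> \<in> Arr (cells Q n)" "Dom (cells Q n) \<beta> = Cod (cells Q n) \<alpha>"
    "length fs = n" "set fs \<subseteq> Arr (base X)" "set gs \<subseteq> Arr (base X)"
    "map (Dom (base X)) gs = map (Cod (base X)) fs"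
  shows "ar (act X) (Cmp (cells Q n) \<beta> \<alpha>, map2 (Cmp (base X)) gs fs) =
    Cmp (base X) (ar (act X) (\<beta>, gs)) (ar (act X) (\<alpha>, fs))"
proof -
  have "length gs = n" using arg_cong[OF assms(7), of length] assms(4) by simp
  then show ?thesis
    using cat_functor.ar_Cmp'[OF functor_act[of n], of "(\<alpha>, fs)" "(\<beta>, gs)"] assms
    by (simp add: prod_pow_simps)
qed

text \<open>
  The next three rules are functoriality of the action for composites \<open>(\<beta>, g) \<cdot> (\<alpha>, f)\<close> in which one of
  the 2-cells, or both, is an identity.
\<close>

lemma act_Idn_Cmp:
  assumes "q \<in> Obj (cells Q n)" "length fs = n" "set fs \<subseteq> Arr (base X)" "set gs \<subseteq> Arr (base X)"
    "map (Dom (base X)) gs = map (Cod (base X)) fs"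
  shows "ar (act X) (Idn (cells Q n) q, map2 (Cmp (base X)) gs fs) =
    Cmp (base X) (ar (act X) (Idn (cells Q n) q, gs)) (ar (act X) (Idn (cells Q n) q, fs))"
  using act_Cmp[of "Idn (cells Q n) q" n "Idn (cells Q n) q" fs gs] assms
  by (simp add: category.Idn_Arr category.Dom_Idn category.Cod_Idn category.Cmp_Idn_Dom)

lemma act_Cmp_Idn_left:
  assumes "\<alpha> \<in> Arr (cells Q n)" "length fs = n" "set fs \<subseteq> Arr (base X)" "set gs \<subseteq> Arr (base X)"
    "map (Dom (base X)) gs = map (Cod (base X)) fs"
  shows "Cmp (base X) (ar (act X) (Idn (cells Q n) (Cod (cells Q n) \<alpha>), gs)) (ar (act X) (\<alpha>, fs)) =
    ar (act X) (\<alpha>, map2 (Cmp (base X)) gs fs)"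
  using act_Cmp[of \<alpha> n "Idn (cells Q n) (Cod (cells Q n) \<alpha>)" fs gs] assms
  by (simp add: category.Idn_Arr category.Dom_Idn category.Cod_Idn category.Cmp_Idn_Cod category.Cod_Obj)

lemma act_Cmp_Idn_right:
  assumes "\<alpha> \<in> Arr (cells Q n)" "length fs = n" "set fs \<subseteq> Arr (base X)" "set gs \<subseteq> Arr (base X)"
    "map (Dom (base X)) gs = map (Cod (base X)) fs"
  shows "Cmp (base X) (ar (act X) (\<alpha>, gs)) (ar (act X) (Idn (cells Q n) (Dom (cells Q n) \<alpha>), fs)) =
    ar (act X) (\<alpha>, map2 (Cmp (base X)) gs fs)"
  using act_Cmp[of "Idn (cells Q n) (Dom (cells Q n) \<alpha>)" n \<alpha> fs gs] assms
  by (simp add: category.Idn_Arr category.Dom_Idn category.Cod_Idn category.Cmp_Idn_Dom category.Dom_Obj)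

lemma gam_Obj:
  assumes "q \<in> Obj (cells Q (length ks))" "list_all2 (\<lambda>k r. r \<in> Obj (cells Q k)) ks rs"
  shows "ob (gam Q ks) (q, rs) \<in> Obj (cells Q (sum_list ks))"
  using plain_operad.opc_ops[OF operad_1_cells, of q ks rs] assms by (simp add: operad_of_1_cells_def)

lemma unt_Obj: "unt Q \<in> Obj (cells Q 1)"
  using plain_operad.opu_ops[OF operad_1_cells] by (simp add: operad_of_1_cells_def)

lemma gam_Idn:
  assumes "q \<in> Obj (cells Q (length ks))" "list_all2 (\<lambda>k r. r \<in> Obj (cells Q k)) ks rs"
  shows "ar (gam Q ks) (Idn (cells Q (length ks)) q, map2 (\<lambda>k. Idn (cells Q k)) ks rs) =
    Idn (cells Q (sum_list ks)) (ob (gam Q ks) (q, rs))"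
proof -
  have "map2 (\<lambda>k. Idn (cells Q k)) ks rs = map2 Idn (map (cells Q) ks) rs"
    by (auto simp: zip_map1 split_beta)
  moreover have "list_all2 (\<lambda>C x. x \<in> Obj C) (map (cells Q) ks) rs"
    using assms(2) by (simp add: list_all2_conv_all_nth)
  ultimately show ?thesis
    using cat_functor.ar_Idn[OF functor_gam[of ks], of "(q, rs)"] assms(1)
    by (simp add: prod_cat_simps list_cat_def)
qed

lemma act_gam_ob':
  "q \<in> Obj (cells Q (length ass)) \<Longrightarrow> list_all2 (\<lambda>as r. r \<in> Obj (cells Q (length as))) ass rs \<Longrightarrow>
    (\<And>as. as \<in> set ass \<Longrightarrow> set as \<subseteq> Obj (base X)) \<Longrightarrow>
    ob (act X) (ob (gam Q (map length ass)) (q, rs), concat ass) =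
      ob (act X) (q, map (ob (act X)) (zip rs ass))"
  by (rule act_gam_ob) (auto simp: pow_cat_Obj_blocks list_all2_map1)

lemma act_gam_ar':
  "\<alpha> \<in> Arr (cells Q (length fss)) \<Longrightarrow> list_all2 (\<lambda>fs \<beta>. \<beta> \<in> Arr (cells Q (length fs))) fss \<beta>s \<Longrightarrow>
    (\<And>fs. fs \<in> set fss \<Longrightarrow> set fs \<subseteq> Arr (base X)) \<Longrightarrow>
    ar (act X) (ar (gam Q (map length fss)) (\<alpha>, \<beta>s), concat fss) =
      ar (act X) (\<alpha>, map (ar (act X)) (zip \<beta>s fss))"
  by (rule act_gam_ar) (auto simp: pow_cat_Arr_blocks list_all2_map1)

text \<open>
  The composition functors send tuples of identity 2-cells to identity 2-cells, so the associativity
  axiom for 2-cells restricts to whiskering.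
\<close>

lemma act_gam_Idn:
  assumes "q \<in> Obj (cells Q (length fss))" "list_all2 (\<lambda>fs r. r \<in> Obj (cells Q (length fs))) fss rs"
    "\<And>fs. fs \<in> set fss \<Longrightarrow> set fs \<subseteq> Arr (base X)"
  shows "ar (act X) (Idn (cells Q (sum_list (map length fss))) (ob (gam Q (map length fss)) (q, rs)), concat fss) =
      ar (act X) (Idn (cells Q (length fss)) q,
        map2 (\<lambda>r fs. ar (act X) (Idn (cells Q (length fs)) r, fs)) rs fss)"
proof -
  have l: "length rs = length fss" using assms(2) by (simp add: list_all2_lengthD)
  have 1: "map2 (\<lambda>r fs. ar (act X) (Idn (cells Q (length fs)) r, fs)) rs fss =
      map (ar (act X)) (zip (map2 (\<lambda>k. Idn (cells Q k)) (map length fss) rs) fss)"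
    using l by (auto intro!: nth_equalityI)
  show ?thesis
    unfolding 1
    using assms gam_Idn[of q "map length fss" rs, symmetric] l
    by (subst act_gam_ar'[symmetric])
      (auto simp: category.Idn_Arr list_all2_conv_all_nth)
qed

end

text \<open>
  The functors between product categories in the definition of a weak morphism are composites of
  functors, so only a statement about single constraints is left to prove.
\<close>

lemma weak_morphismI:
  assumes "cat_algebra Q X" "cat_algebra Q Y" "cat_functor (base X) (base Y) (und G)"
    and constr_Hom: "\<And>n q as. q \<in> Obj (cells Q n) \<Longrightarrow> length as = n \<Longrightarrow> set as \<subseteq> Obj (base X) \<Longrightarrow>
      constr G q as \<in> Hom (base Y) (ob (act Y) (q, map (ob (und G)) as)) (ob (und G) (ob (act X) (q, as)))"
    and constr_is_iso: "\<And>n q as. q \<in> Obj (cells Q n) \<Longrightarrow> length as = n \<Longrightarrow> set as \<subseteq> Obj (base X) \<Longrightarrow>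
      is_iso (base Y) (constr G q as)"
    and constr_natural: "\<And>n \<alpha> fs. \<alpha> \<in> Arr (cells Q n) \<Longrightarrow> length fs = n \<Longrightarrow> set fs \<subseteq> Arr (base X) \<Longrightarrow>
      Cmp (base Y) (constr G (Cod (cells Q n) \<alpha>) (map (Cod (base X)) fs)) (ar (act Y) (\<alpha>, map (ar (und G)) fs)) =
      Cmp (base Y) (ar (und G) (ar (act X) (\<alpha>, fs))) (constr G (Dom (cells Q n) \<alpha>) (map (Dom (base X)) fs))"
    and constr_unt: "\<And>a. a \<in> Obj (base X) \<Longrightarrow> constr G (unt Q) [a] = Idn (base Y) (ob (und G) a)"
    and constr_gam: "\<And>q rs ass. q \<in> Obj (cells Q (length ass)) \<Longrightarrow>
      list_all2 (\<lambda>as r. r \<in> Obj (cells Q (length as))) ass rs \<Longrightarrow>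
      (\<And>as. as \<in> set ass \<Longrightarrow> set as \<subseteq> Obj (base X)) \<Longrightarrow>
      constr G (ob (gam Q (map length ass)) (q, rs)) (concat ass) =
      Cmp (base Y) (constr G q (map (ob (act X)) (zip rs ass)))
        (ar (act Y) (Idn (cells Q (length ass)) q, map2 (constr G) rs ass))"
  shows "weak_morphism Q X Y G"
proof -
  interpret X: cat_algebra Q X by fact
  interpret Y: cat_algebra Q Y by fact
  interpret U: cat_functor "base X" "base Y" "und G" by fact
  show ?thesis
  proof (intro weak_morphism.intro weak_morphism_axioms.intro assms(1,2,3))
    fix n
    interpret L: cat_functor "prod_cat (cells Q n) (pow_cat (base X) n)" "base Y"
      "comp_fun (act Y) (id_times_pow (und G))"
      by (rule cat_functor_comp[OF cat_functor_id_times_pow Y.functor_act])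
        (auto simp: U.cat_functor_axioms)
    interpret R: cat_functor "prod_cat (cells Q n) (pow_cat (base X) n)" "base Y"
      "comp_fun (und G) (act X)"
      by (rule cat_functor_comp[OF X.functor_act U.cat_functor_axioms])
    have 1: "\<exists>\<alpha> fs. f = (\<alpha>, fs) \<and> \<alpha> \<in> Arr (cells Q n) \<and> length fs = n \<and> set fs \<subseteq> Arr (base X) \<and>
       x = (Dom (cells Q n) \<alpha>, map (Dom (base X)) fs) \<and> y = (Cod (cells Q n) \<alpha>, map (Cod (base X)) fs)"
      if "f \<in> Hom (prod_cat (cells Q n) (pow_cat (base X) n)) x y" for f x y
      using that by (cases f) (auto simp: Hom_def prod_pow_simps)
    show "nat_iso (prod_cat (cells Q n) (pow_cat (base X) n)) (base Y)
      (comp_fun (act Y) (id_times_pow (und G))) (comp_fun (und G) (act X)) (\<lambda>(q, as). constr G q as)"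
      by (unfold_locales; use constr_Hom constr_is_iso in
        \<open>auto simp: prod_pow_simps comp_fun_def id_times_pow_def constr_natural dest!: 1\<close>)
  qed (auto simp: constr_unt constr_gam pow_cat_Obj_blocks list_all2_map1)
qed

context weak_morphism begin

lemma
  assumes "q \<in> Obj (cells Q n)" "length as = n" "set as \<subseteq> Obj (base X)"
  shows constr_Arr: "constr G q as \<in> Arr (base Y)"
    and constr_Dom: "Dom (base Y) (constr G q as) = ob (act Y) (q, map (ob (und G)) as)"
    and constr_Cod: "Cod (base Y) (constr G q as) = ob (und G) (ob (act X) (q, as))"
    and constr_is_iso: "is_iso (base Y) (constr G q as)"
proof -
  interpret N: nat_iso "prod_cat (cells Q n) (pow_cat (base X) n)" "base Y"
    "comp_fun (act Y) (id_times_pow (und G))" "comp_fun (und G) (act X)" "\<lambda>(q, as). constr G q as"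
    by (rule constr_iso)
  show "constr G q as \<in> Arr (base Y)"
    "Dom (base Y) (constr G q as) = ob (act Y) (q, map (ob (und G)) as)"
    "Cod (base Y) (constr G q as) = ob (und G) (ob (act X) (q, as))"
    "is_iso (base Y) (constr G q as)"
    using N.component[of "(q, as)"] N.component_iso[of "(q, as)"] assms
    by (auto simp: prod_pow_simps comp_fun_def id_times_pow_def Hom_def)
qed

lemma constr_natural:
  assumes "\<alpha> \<in> Arr (cells Q n)" "length fs = n" "set fs \<subseteq> Arr (base X)"
  shows "Cmp (base Y) (constr G (Cod (cells Q n) \<alpha>) (map (Cod (base X)) fs)) (ar (act Y) (\<alpha>, map (ar (und G)) fs)) =
      Cmp (base Y) (ar (und G) (ar (act X) (\<alpha>, fs))) (constr G (Dom (cells Q n) \<alpha>) (map (Dom (base X)) fs))"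
proof -
  interpret N: nat_iso "prod_cat (cells Q n) (pow_cat (base X) n)" "base Y"
    "comp_fun (act Y) (id_times_pow (und G))" "comp_fun (und G) (act X)" "\<lambda>(q, as). constr G q as"
    by (rule constr_iso)
  show ?thesis
    using N.natural[of "(\<alpha>, fs)" "(Dom (cells Q n) \<alpha>, map (Dom (base X)) fs)" "(Cod (cells Q n) \<alpha>, map (Cod (base X)) fs)"] assms
    by (auto simp: prod_pow_simps comp_fun_def id_times_pow_def Hom_def)
qed

lemma constr_natural_Idn:
  assumes "q \<in> Obj (cells Q n)" "length fs = n" "set fs \<subseteq> Arr (base X)"
  shows "Cmp (base Y) (constr G q (map (Cod (base X)) fs)) (ar (act Y) (Idn (cells Q n) q, map (ar (und G)) fs)) =
      Cmp (base Y) (ar (und G) (ar (act X) (Idn (cells Q n) q, fs))) (constr G q (map (Dom (base X)) fs))"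
  using constr_natural[of "Idn (cells Q n) q" n fs] assms
  by (simp add: category.Idn_Arr category.Dom_Idn category.Cod_Idn)

lemma constr_gam':
  "q \<in> Obj (cells Q (length ass)) \<Longrightarrow> list_all2 (\<lambda>as r. r \<in> Obj (cells Q (length as))) ass rs \<Longrightarrow>
    (\<And>as. as \<in> set ass \<Longrightarrow> set as \<subseteq> Obj (base X)) \<Longrightarrow>
    constr G (ob (gam Q (map length ass)) (q, rs)) (concat ass) =
      Cmp (base Y) (constr G q (map (ob (act X)) (zip rs ass)))
        (ar (act Y) (Idn (cells Q (length ass)) q, map2 (constr G) rs ass))"
  using constr_gam[of q "map length ass" rs ass] by (auto simp: pow_cat_Obj_blocks list_all2_map1)

end

section \<open>The 2-category of algebras\<close>

text \<open>Functors preserve isomorphisms, and isomorphisms in a power are componentwise.\<close>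

lemma (in cat_algebra) act_is_iso:
  assumes "q \<in> Obj (cells Q n)" "length fs = n" "\<And>f. f \<in> set fs \<Longrightarrow> is_iso (base X) f"
  shows "is_iso (base X) (ar (act X) (Idn (cells Q n) q, fs))"
proof -
  let ?gs = "map (inv_arr (base X)) fs"
  have fs: "set fs \<subseteq> Arr (base X)" "set ?gs \<subseteq> Arr (base X)"
    "map (Dom (base X)) ?gs = map (Cod (base X)) fs" "map (Cod (base X)) ?gs = map (Dom (base X)) fs"
    using assms(3) by (auto simp: base.iso_Arr)
  have i: "map2 (Cmp (base X)) ?gs fs = map (Idn (base X)) (map (Dom (base X)) fs)"
    "map2 (Cmp (base X)) fs ?gs = map (Idn (base X)) (map (Cod (base X)) fs)"
    using assms(3) by (induction fs) auto
  have o: "set (map (Dom (base X)) fs) \<subseteq> Obj (base X)" "set (map (Cod (base X)) fs) \<subseteq> Obj (base X)"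
    using fs(1) by (auto intro: base.Dom_Obj base.Cod_Obj)
  note Idn = category.Idn_Arr[OF category_cells] category.Dom_Idn[OF category_cells] category.Cod_Idn[OF category_cells]
  have "inverse_arrows (base X) (ar (act X) (Idn (cells Q n) q, fs)) (ar (act X) (Idn (cells Q n) q, ?gs))"
    unfolding inverse_arrows_def Hom_def
    using assms(1,2) fs
    by (simp add: act_Arr[of _ n] act_Dom[of _ n] act_Cod[of _ n] Idn act_Idn_Cmp[symmetric] i
        act_Idn[OF assms(1) _ o(1)] act_Idn[OF assms(1) _ o(2)] del: map_map)
  then show ?thesis by (auto simp: is_iso_def)
qed

lemma weak_morphism_id:
  assumes "cat_algebra Q X" shows "weak_morphism Q X X (id_weak X)"
proof -
  interpret X: cat_algebra Q X by fact
  show ?thesis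
  proof (rule weak_morphismI[OF assms assms])
    fix q rs ass
    assume *: "q \<in> Obj (cells Q (length ass))" "list_all2 (\<lambda>as r. r \<in> Obj (cells Q (length as))) ass rs"
      "\<And>as. as \<in> set ass \<Longrightarrow> set as \<subseteq> Obj (base X)"
    let ?as = "map (ob (act X)) (zip rs ass)"
    have l: "length rs = length ass" using *(2) by (simp add: list_all2_lengthD)
    have "rs ! i \<in> Obj (cells Q (length (ass ! i)))" "set (ass ! i) \<subseteq> Obj (base X)"
      if "i < length ass" for i
      using *(2,3) that by (auto simp: list_all2_conv_all_nth)
    note X.act_Obj[OF this(1) refl this(2)]
    then have o: "set ?as \<subseteq> Obj (base X)"
      using l by (auto simp: set_zip)
    have 1: "map2 (constr (id_weak X)) rs ass = map (Idn (base X)) ?as"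
      by (auto simp: id_weak_def)
    show "constr (id_weak X) (ob (gam Q (map length ass)) (q, rs)) (concat ass) =
      Cmp (base X) (constr (id_weak X) q ?as)
        (ar (act X) (Idn (cells Q (length ass)) q, map2 (constr (id_weak X)) rs ass))"
      unfolding 1 using * l o
      by (subst X.act_Idn) (auto simp: id_weak_def X.act_gam_ob' X.act_Obj)
  qed (auto simp: id_weak_def id_fun_def cat_functor_id[unfolded id_fun_def] X.base.category_axioms Hom_def X.act_Obj
      X.base.is_iso_Idn X.act_unt_ob X.act_Arr X.act_Dom X.act_Cod)
qed

text \<open>
  For the operadic axiom, expanding both constraints of the composite gives
  \<open>G\<phi>\<^sub>q \<cdot> G h(q, \<phi>\<^sub>r) \<cdot> \<psi>\<^sub>q \<cdot> h(q, \<psi>\<^sub>r)\<close>, and naturality of \<open>\<psi>\<close> moves \<open>\<psi>\<^sub>q\<close> past \<open>h(q, \<phi>\<^sub>r)\<close>, which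
  yields \<open>(G\<phi>\<^sub>q \<cdot> \<psi>\<^sub>q) \<cdot> h(q, G\<phi>\<^sub>r \<cdot> \<psi>\<^sub>r)\<close>.
\<close>

lemma weak_morphism_comp:
  assumes "weak_morphism Q X Y F" "weak_morphism Q Y Z G"
  shows "weak_morphism Q X Z (comp_weak Z G F)"
proof -
  interpret F: weak_morphism Q X Y F by fact
  interpret G: weak_morphism Q Y Z G by fact
  have cells [simp]: "category (cells Q n)" for n by (rule F.X.category_cells)
  have Fob: "set (map (ob (und F)) as) \<subseteq> Obj (base Y)" if "set as \<subseteq> Obj (base X)" for as
    using that by (auto simp: F.und.ob_Obj)
  have Far: "set (map (ar (und F)) fs) \<subseteq> Arr (base Y)" if "set fs \<subseteq> Arr (base X)" for fs
    using that by auto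
  have Gar: "set (map (ar (und G)) fs) \<subseteq> Arr (base Z)" if "set fs \<subseteq> Arr (base Y)" for fs
    using that by auto
  have und: "und (comp_weak Z G F) = comp_fun (und G) (und F)"
    "ob (comp_fun (und G) (und F)) x = ob (und G) (ob (und F) x)"
    "ar (comp_fun (und G) (und F)) f = ar (und G) (ar (und F) f)"
    "map (ob (comp_fun (und G) (und F))) xs = map (ob (und G)) (map (ob (und F)) xs)"
    "map (ar (comp_fun (und G) (und F))) fs = map (ar (und G)) (map (ar (und F)) fs)" for x f xs fs
    by (auto simp: comp_weak_def comp_fun_def)
  have con: "constr (comp_weak Z G F) q as =
      Cmp (base Z) (ar (und G) (constr F q as)) (constr G q (map (ob (und F)) as))" for q as
    by (simp add: comp_weak_def)
  show ?thesis
  proof (rule weak_morphismI, goal_cases)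
    case 1 show ?case by (rule F.X.cat_algebra_axioms)
  next
    case 2 show ?case by (rule G.Y.cat_algebra_axioms)
  next
    case 3 show ?case unfolding und by (rule cat_functor_comp[OF F.und.cat_functor_axioms G.und.cat_functor_axioms])
  next
    case (4 n q as)
    \<comment> \<open>The domain and codomain of each arrow that occurs below are made rewrite rules, so that the
      simplifier can check composability. Lists of domains are kept as nested maps, the form in
      which these rules produce them; this is why \<open>map_map\<close> is removed.\<close>
    note [simp] = F.constr_Arr[OF 4] F.constr_Dom[OF 4] F.constr_Cod[OF 4]
      G.constr_Arr[OF 4(1) _ Fob[OF 4(3)]] G.constr_Dom[OF 4(1) _ Fob[OF 4(3)]] G.constr_Cod[OF 4(1) _ Fob[OF 4(3)]]
    show ?case using 4 unfolding con und by (simp add: Hom_def del: map_map)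
  next
    case (5 n q as)
    note [simp] = F.constr_Arr[OF 5] F.constr_Dom[OF 5] F.constr_Cod[OF 5] F.constr_is_iso[OF 5]
      G.constr_Arr[OF 5(1) _ Fob[OF 5(3)]] G.constr_Dom[OF 5(1) _ Fob[OF 5(3)]] G.constr_Cod[OF 5(1) _ Fob[OF 5(3)]]
      G.constr_is_iso[OF 5(1) _ Fob[OF 5(3)]]
    show ?case using 5 unfolding con und by (intro G.Y.base.is_iso_Cmp G.und.is_iso_ar) (simp_all del: map_map)
  next
    case (6 n \<alpha> fs)
    let ?D = "map (Dom (base X)) fs" and ?C = "map (Cod (base X)) fs"
    let ?q = "Dom (cells Q n) \<alpha>" and ?q' = "Cod (cells Q n) \<alpha>"
    let ?as = "map (ob (und F)) ?D" and ?bs = "map (ob (und F)) ?C"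
    have D: "set ?D \<subseteq> Obj (base X)" "set ?C \<subseteq> Obj (base X)" "length ?D = n" "length ?C = n"
      "?q \<in> Obj (cells Q n)" "?q' \<in> Obj (cells Q n)"
      using 6 by (auto simp: F.X.base.Dom_Obj F.X.base.Cod_Obj category.Dom_Obj category.Cod_Obj)
    have F: "map (Dom (base Y)) (map (ar (und F)) fs) = ?as" "map (Cod (base Y)) (map (ar (und F)) fs) = ?bs"
      using 6 by auto
    have G: "map (Dom (base Z)) (map (ar (und G)) (map (ar (und F)) fs)) = map (ob (und G)) ?as"
      "map (Cod (base Z)) (map (ar (und G)) (map (ar (und F)) fs)) = map (ob (und G)) ?bs"
      using 6 by auto
    have L: "length ?as = n" "length ?bs = n" using 6 by simp_all
    note [simp] = F.constr_Arr[OF D(5,3,1)] F.constr_Dom[OF D(5,3,1)] F.constr_Cod[OF D(5,3,1)]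
      F.constr_Arr[OF D(6,4,2)] F.constr_Dom[OF D(6,4,2)] F.constr_Cod[OF D(6,4,2)]
      G.constr_Arr[OF D(5) L(1) Fob[OF D(1)]] G.constr_Dom[OF D(5) L(1) Fob[OF D(1)]] G.constr_Cod[OF D(5) L(1) Fob[OF D(1)]]
      G.constr_Arr[OF D(6) L(2) Fob[OF D(2)]] G.constr_Dom[OF D(6) L(2) Fob[OF D(2)]] G.constr_Cod[OF D(6) L(2) Fob[OF D(2)]]
      F.X.act_Arr[OF 6] F.X.act_Dom[OF 6] F.X.act_Cod[OF 6]
    have Fl: "length (map (ar (und F)) fs) = n" "length (map (ar (und G)) (map (ar (und F)) fs)) = n" using 6 by auto
    note [simp] = F.Y.act_Arr[OF 6(1) Fl(1) Far[OF 6(3)]] F.Y.act_Dom[OF 6(1) Fl(1) Far[OF 6(3)]] F.Y.act_Cod[OF 6(1) Fl(1) Far[OF 6(3)]]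
      G.Y.act_Arr[OF 6(1) Fl(2) Gar[OF Far[OF 6(3)]]] G.Y.act_Dom[OF 6(1) Fl(2) Gar[OF Far[OF 6(3)]]] G.Y.act_Cod[OF 6(1) Fl(2) Gar[OF Far[OF 6(3)]]]
    \<comment> \<open>The two naturality squares that are pasted along \<open>G h(\<alpha>, F fs)\<close>.\<close>
    note NF = F.constr_natural[OF 6]
    note NG = G.constr_natural[OF 6(1) Fl(1) Far[OF 6(3)], unfolded F]
    have "Cmp (base Z) (constr (comp_weak Z G F) ?q' ?C)
        (ar (act Z) (\<alpha>, map (ar (und G)) (map (ar (und F)) fs))) =
      Cmp (base Z) (ar (und G) (constr F ?q' ?C)) (Cmp (base Z) (constr G ?q' ?bs)
        (ar (act Z) (\<alpha>, map (ar (und G)) (map (ar (und F)) fs))))"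
      unfolding con by (rule G.Y.base.Cmp_Cmp) (simp_all add: F G del: map_map)
    also have "\<dots> = Cmp (base Z) (ar (und G) (constr F ?q' ?C))
       (Cmp (base Z) (ar (und G) (ar (act Y) (\<alpha>, map (ar (und F)) fs))) (constr G ?q ?as))"
      unfolding NG by (rule refl)
    also have "\<dots> = Cmp (base Z) (ar (und G) (Cmp (base Y) (constr F ?q' ?C) (ar (act Y) (\<alpha>, map (ar (und F)) fs))))
       (constr G ?q ?as)"
      by (subst G.und.ar_Cmp') (simp_all add: F G del: map_map)
    also have "\<dots> = Cmp (base Z) (ar (und G) (ar (und F) (ar (act X) (\<alpha>, fs)))) (constr (comp_weak Z G F) ?q ?D)"
      unfolding NF con by (subst G.und.ar_Cmp') (simp_all add: F G del: map_map)
    finally show ?case unfolding und .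
  next
    case (7 a)
    then show ?case
      by (simp add: con und F.constr_unt G.constr_unt F.und.ob_Obj G.und.ob_Obj G.und.ar_Idn)
  next
    case (8 q rs ass)
    let ?n = "length ass"
    let ?hX = "map (ob (act X)) (zip rs ass)"
    let ?Fass = "map (map (ob (und F))) ass"
    let ?hY = "map (ob (act Y)) (zip rs ?Fass)"
    let ?\<phi> = "map2 (constr F) rs ass" and ?\<psi> = "map2 (constr G) rs ?Fass"
    have l: "length rs = ?n" using 8(2) by (simp add: list_all2_lengthD)
    have r: "rs ! i \<in> Obj (cells Q (length (ass ! i)))" "set (ass ! i) \<subseteq> Obj (base X)"
      "set (map (ob (und F)) (ass ! i)) \<subseteq> Obj (base Y)" if "i < ?n" for i
      using 8(2,3) that Fob[of "ass ! i"] by (auto simp: list_all2_conv_all_nth)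
    have hX: "set ?hX \<subseteq> Obj (base X)" "length ?hX = ?n"
      using l F.X.act_Obj[OF r(1) refl r(2)] by (auto simp: set_zip)
    have hY: "set ?hY \<subseteq> Obj (base Y)" "length ?hY = ?n"
      using l F.Y.act_Obj[OF r(1) _ r(3)] by (auto simp: set_zip)
    have phi: "set ?\<phi> \<subseteq> Arr (base Y)" "map (Dom (base Y)) ?\<phi> = ?hY"
       "map (Cod (base Y)) ?\<phi> = map (ob (und F)) ?hX" "length ?\<phi> = ?n"
      using l F.constr_Arr[OF r(1) refl r(2)] F.constr_Dom[OF r(1) refl r(2)] F.constr_Cod[OF r(1) refl r(2)] by (auto simp: set_zip intro!: nth_equalityI)
    have psi: "set ?\<psi> \<subseteq> Arr (base Z)" 
       "map (Cod (base Z)) ?\<psi> = map (ob (und G)) ?hY" "length ?\<psi> = ?n"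
      using l G.constr_Arr[OF r(1) _ r(3)] G.constr_Cod[OF r(1) _ r(3)] by (auto simp: set_zip intro!: nth_equalityI)
    have Gphi: "set (map (ar (und G)) ?\<phi>) \<subseteq> Arr (base Z)"
      "map (Dom (base Z)) (map (ar (und G)) ?\<phi>) = map (ob (und G)) ?hY" 
      "map (Cod (base Z)) (map (ar (und G)) ?\<phi>) = map (ob (und G)) (map (ob (und F)) ?hX)"
      using G.und.map_ar[OF phi(1)] unfolding phi by simp_all
    have lG: "length (map (ar (und G)) ?\<phi>) = ?n" using l by simp
    note q = 8(1)
    have FF: "list_all2 (\<lambda>as r. r \<in> Obj (cells Q (length as))) ?Fass rs"
      using 8(2) by (auto simp: list_all2_map1 list_all2_conv_all_nth)
    have FO: "set as \<subseteq> Obj (base Y)" if "as \<in> set ?Fass" for as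
      using that Fob[OF 8(3)] by clarsimp blast
    have FF': "map length ?Fass = map length ass" "length ?Fass = ?n" by auto
    note hY' = F.Y.act_gam_ob'[OF _ FF FO, of q, unfolded FF', OF q]
    have iq: "Idn (cells Q ?n) q \<in> Arr (cells Q ?n)" "Dom (cells Q ?n) (Idn (cells Q ?n) q) = q"
      "Cod (cells Q ?n) (Idn (cells Q ?n) q) = q"
      using q by (auto simp: category.Idn_Arr category.Dom_Idn category.Cod_Idn)
    note [simp] = F.constr_Arr[OF q hX(2,1)] F.constr_Dom[OF q hX(2,1)] F.constr_Cod[OF q hX(2,1)]
      G.constr_Arr[OF q _ Fob[OF hX(1)]] G.constr_Dom[OF q _ Fob[OF hX(1)]] G.constr_Cod[OF q _ Fob[OF hX(1)]]
      G.constr_Arr[OF q hY(2,1)] G.constr_Dom[OF q hY(2,1)] G.constr_Cod[OF q hY(2,1)]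
      F.Y.act_Arr[OF iq(1) phi(4,1)] F.Y.act_Dom[OF iq(1) phi(4,1)] F.Y.act_Cod[OF iq(1) phi(4,1)]
      G.Y.act_Arr[OF iq(1) psi(3,1)] G.Y.act_Dom[OF iq(1) psi(3,1)] G.Y.act_Cod[OF iq(1) psi(3,1)]
      G.Y.act_Arr[OF iq(1) lG Gphi(1)] G.Y.act_Dom[OF iq(1) lG Gphi(1)] G.Y.act_Cod[OF iq(1) lG Gphi(1)]
      iq
    have NG: "Cmp (base Z) (ar (und G) (ar (act Y) (Idn (cells Q ?n) q, ?\<phi>))) (constr G q ?hY) =
       Cmp (base Z) (constr G q (map (ob (und F)) ?hX)) (ar (act Z) (Idn (cells Q ?n) q, map (ar (und G)) ?\<phi>))"
      using G.constr_natural_Idn[OF q phi(4,1)] phi by metis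
    have m2: "map2 (constr (comp_weak Z G F)) rs ass = map2 (Cmp (base Z)) (map (ar (und G)) ?\<phi>) ?\<psi>"
      using l by (auto intro!: nth_equalityI simp: con)
    have lhX: "length (map (ob (und F)) ?hX) = ?n" using l by simp
    have "constr (comp_weak Z G F) (ob (gam Q (map length ass)) (q, rs)) (concat ass) =
      Cmp (base Z) (ar (und G) (Cmp (base Y) (constr F q ?hX) (ar (act Y) (Idn (cells Q ?n) q, ?\<phi>))))
       (Cmp (base Z) (constr G q ?hY) (ar (act Z) (Idn (cells Q ?n) q, ?\<psi>)))"
      using F.constr_gam'[OF 8] G.constr_gam'[OF _ FF FO, of q, unfolded FF', OF q]
      by (simp add: con map_concat del: map_map)
    also have "\<dots> = Cmp (base Z) (ar (und G) (constr F q ?hX))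
        (Cmp (base Z) (Cmp (base Z) (ar (und G) (ar (act Y) (Idn (cells Q ?n) q, ?\<phi>))) (constr G q ?hY))
          (ar (act Z) (Idn (cells Q ?n) q, ?\<psi>)))"
      using lhX by (subst G.und.ar_Cmp') (simp_all add: phi psi Gphi del: map_map)
    also have "\<dots> = Cmp (base Z) (constr (comp_weak Z G F) q ?hX)
        (Cmp (base Z) (ar (act Z) (Idn (cells Q ?n) q, map (ar (und G)) ?\<phi>))
          (ar (act Z) (Idn (cells Q ?n) q, ?\<psi>)))"
      unfolding NG con using lhX by (simp add: phi psi Gphi del: map_map)
    also have "\<dots> = Cmp (base Z) (constr (comp_weak Z G F) q ?hX)
        (ar (act Z) (Idn (cells Q ?n) q, map2 (constr (comp_weak Z G F)) rs ass))"
      unfolding m2 using psi Gphi by (subst G.Y.act_Idn_Cmp[OF q]) (simp_all del: map_map)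
    finally show ?case .
  qed
qed

lemma alg_transformationI:
  assumes "weak_morphism Q X Y F" "weak_morphism Q X Y G"
    and "\<And>a. a \<in> Obj (base X) \<Longrightarrow> \<sigma> a \<in> Hom (base Y) (ob (und F) a) (ob (und G) a)"
    and "\<And>f. f \<in> Arr (base X) \<Longrightarrow> Cmp (base Y) (\<sigma> (Cod (base X) f)) (ar (und F) f) =
      Cmp (base Y) (ar (und G) f) (\<sigma> (Dom (base X) f))"
    and "\<And>n q as. q \<in> Obj (cells Q n) \<Longrightarrow> length as = n \<Longrightarrow> set as \<subseteq> Obj (base X) \<Longrightarrow>
      Cmp (base Y) (\<sigma> (ob (act X) (q, as))) (constr F q as) =
      Cmp (base Y) (constr G q as) (ar (act Y) (Idn (cells Q n) q, map \<sigma> as))"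
  shows "alg_transformation Q X Y F G \<sigma>"
proof -
  interpret F: weak_morphism Q X Y F by fact
  interpret G: weak_morphism Q X Y G by fact
  show ?thesis
    by (unfold_locales; use assms(3-5) in \<open>auto simp: Hom_def pow_cat_Obj\<close>)
qed

text \<open>
  Conjugating the naturality and coherence equations of a transformation by the inverses of its
  components gives those of the inverse family, so invertibility may be checked componentwise.
\<close>

lemma isomorphic_weakI:
  assumes "alg_transformation Q X Y F G \<sigma>" and iso: "\<And>a. a \<in> Obj (base X) \<Longrightarrow> is_iso (base Y) (\<sigma> a)"
  shows "isomorphic_weak Q X Y F G" "isomorphic_weak Q X Y G F"
proof -
  interpret \<sigma>: alg_transformation Q X Y F G \<sigma> by fact
  let ?\<sigma>' = "\<lambda>a. inv_arr (base Y) (\<sigma> a)"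
  have s: "\<sigma> a \<in> Arr (base Y)" "Dom (base Y) (\<sigma> a) = ob (und F) a" "Cod (base Y) (\<sigma> a) = ob (und G) a"
    if "a \<in> Obj (base X)" for a
    using \<sigma>.component[OF that] by (auto simp: Hom_def)
  \<comment> \<open>Both equations of the inverse family come from a commuting square with two invertible sides.\<close>
  have conj: "Cmp (base Y) i' k = Cmp (base Y) k' i"
    if "is_iso (base Y) f" "is_iso (base Y) f'" "i = inv_arr (base Y) f" "i' = inv_arr (base Y) f'"
      "k \<in> Arr (base Y)" "k' \<in> Arr (base Y)" "Cmp (base Y) f' k' = Cmp (base Y) k f"
      "Dom (base Y) k = Cod (base Y) f" "Cod (base Y) k = Cod (base Y) f'"
      "Dom (base Y) k' = Dom (base Y) f" "Cod (base Y) k' = Dom (base Y) f'" for f f' i i' k k'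
  proof (rule \<sigma>.F.Y.base.iso_cancel_right[OF that(1)])
    note [simp] = \<sigma>.F.Y.base.iso_Arr[OF that(1)] \<sigma>.F.Y.base.iso_Arr[OF that(2)]
    have "Cmp (base Y) i' (Cmp (base Y) k f) = Cmp (base Y) (Cmp (base Y) i' f') k'"
      unfolding that(7)[symmetric] using that by (subst \<sigma>.F.Y.base.Cmp_Cmp) auto
    then show "Cmp (base Y) (Cmp (base Y) i' k) f = Cmp (base Y) (Cmp (base Y) k' i) f"
      using that by simp
  qed (use that in \<open>auto simp: \<sigma>.F.Y.base.iso_Arr\<close>)
  have inv: "alg_transformation Q X Y G F ?\<sigma>'"
  proof (rule alg_transformationI[OF \<sigma>.G.weak_morphism_axioms \<sigma>.F.weak_morphism_axioms], goal_cases)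
    case (1 a)
    then show ?case using iso[OF 1] s[OF 1] by (auto simp: Hom_def)
  next
    case (2 f)
    have o: "Dom (base X) f \<in> Obj (base X)" "Cod (base X) f \<in> Obj (base X)"
      using 2 by (auto intro: \<sigma>.F.X.base.Dom_Obj \<sigma>.F.X.base.Cod_Obj)
    show ?case
      by (rule conj[of "\<sigma> (Dom (base X) f)" "\<sigma> (Cod (base X) f)"])
        (use 2 o s iso \<sigma>.natural[of f "Dom (base X) f" "Cod (base X) f"] in \<open>auto simp: Hom_def\<close>)
  next
    case (3 n q as)
    note a = \<sigma>.F.X.act_Obj[OF 3]
    have i: "is_iso (base Y) (ar (act Y) (Idn (cells Q n) q, map \<sigma> as))"
      using 3 iso by (intro \<sigma>.F.Y.act_is_iso) auto
    have "map2 (Cmp (base Y)) (map \<sigma> as) (map ?\<sigma>' as) = map (Idn (base Y)) (map (ob (und G)) as)"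
      "map2 (Cmp (base Y)) (map ?\<sigma>' as) (map \<sigma> as) = map (Idn (base Y)) (map (ob (und F)) as)"
      using 3 iso s by (auto intro!: nth_equalityI simp: subset_iff)
    moreover have as: "set (map \<sigma> as) \<subseteq> Arr (base Y)" "set (map ?\<sigma>' as) \<subseteq> Arr (base Y)"
      "map (Dom (base Y)) (map \<sigma> as) = map (ob (und F)) as" "map (Cod (base Y)) (map \<sigma> as) = map (ob (und G)) as"
      "map (Dom (base Y)) (map ?\<sigma>' as) = map (ob (und G)) as" "map (Cod (base Y)) (map ?\<sigma>' as) = map (ob (und F)) as"
      "set (map (ob (und F)) as) \<subseteq> Obj (base Y)" "set (map (ob (und G)) as) \<subseteq> Obj (base Y)"
      using 3 iso s by (auto simp: subset_iff \<sigma>.F.und.ob_Obj \<sigma>.G.und.ob_Obj)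
    moreover note \<sigma>.F.Y.act_Idn_Cmp[OF 3(1), of "map \<sigma> as" "map ?\<sigma>' as"] \<sigma>.F.Y.act_Idn_Cmp[OF 3(1), of "map ?\<sigma>' as" "map \<sigma> as"]
      \<sigma>.F.Y.act_Idn[OF 3(1), of "map (ob (und F)) as"] \<sigma>.F.Y.act_Idn[OF 3(1), of "map (ob (und G)) as"]
    ultimately have inv: "inv_arr (base Y) (ar (act Y) (Idn (cells Q n) q, map \<sigma> as)) =
        ar (act Y) (Idn (cells Q n) q, map ?\<sigma>' as)"
      using 3
      by (intro \<sigma>.F.Y.base.inv_arr_eqI)
        (simp add: inverse_arrows_def Hom_def \<sigma>.F.Y.act_Arr[of _ n] \<sigma>.F.Y.act_Dom[of _ n] \<sigma>.F.Y.act_Cod[of _ n]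
          category.Idn_Arr category.Dom_Idn category.Cod_Idn del: map_map)
    show ?case
      by (rule conj[OF i iso[OF a] inv[symmetric] refl])
       (use 3 as s[OF a] \<sigma>.coherent[OF 3(1)] in \<open>simp_all add: pow_cat_Obj \<sigma>.F.constr_Arr[OF 3] \<sigma>.F.constr_Dom[OF 3] \<sigma>.F.constr_Cod[OF 3]
         \<sigma>.G.constr_Arr[OF 3] \<sigma>.G.constr_Dom[OF 3] \<sigma>.G.constr_Cod[OF 3] \<sigma>.F.Y.act_Arr[of _ n] \<sigma>.F.Y.act_Dom[of _ n] \<sigma>.F.Y.act_Cod[of _ n]
          category.Idn_Arr category.Dom_Idn category.Cod_Idn del: map_map\<close>)
  qed
  show "isomorphic_weak Q X Y F G" "isomorphic_weak Q X Y G F"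
    unfolding isomorphic_weak_def using assms(1) inv iso s by fastforce+
qed

section \<open>Fully faithful, essentially surjective weak morphisms are equivalences\<close>

text \<open>
  The data \<open>R\<close> and \<open>e\<close> are a choice of preimages up to isomorphism. They are parameters because the
  strictification has a canonical choice, with \<open>R a = (1, a)\<close>.
\<close>

locale weak_equivalence = weak_morphism Q X Y F
  for Q :: "('q, 'c) cat_operad_data"
    and X :: "('q, 'c, 'o, 'm) alg_data" and Y :: "('q, 'c, 'o2, 'm2) alg_data"
    and F :: "('q, 'o, 'm, 'o2, 'm2) weak_data" +
  fixes R :: "'o2 \<Rightarrow> 'o" and e :: "'o2 \<Rightarrow> 'm2"
  assumes faithful: "f \<in> Arr (base X) \<Longrightarrow> f' \<in> Arr (base X) \<Longrightarrow> Dom (base X) f = Dom (base X) f' \<Longrightarrow>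
      Cod (base X) f = Cod (base X) f' \<Longrightarrow> ar (und F) f = ar (und F) f' \<Longrightarrow> f = f'"
    and full: "x \<in> Obj (base X) \<Longrightarrow> x' \<in> Obj (base X) \<Longrightarrow>
      g \<in> Hom (base Y) (ob (und F) x) (ob (und F) x') \<Longrightarrow> \<exists>f \<in> Hom (base X) x x'. ar (und F) f = g"
    and R_Obj: "y \<in> Obj (base Y) \<Longrightarrow> R y \<in> Obj (base X)"
    and e_Hom: "y \<in> Obj (base Y) \<Longrightarrow> e y \<in> Hom (base Y) (ob (und F) (R y)) y"
    and e_iso: "y \<in> Obj (base Y) \<Longrightarrow> is_iso (base Y) (e y)"
begin

abbreviation "A \<equiv> base X"
abbreviation "B \<equiv> base Y"
abbreviation "U \<equiv> und F"
abbreviation "hX n q fs \<equiv> ar (act X) (Idn (cells Q n) q, fs)"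
abbreviation "hY n q fs \<equiv> ar (act Y) (Idn (cells Q n) q, fs)"

lemma e_simps: "y \<in> Obj B \<Longrightarrow> e y \<in> Arr B" "y \<in> Obj B \<Longrightarrow> Dom B (e y) = ob U (R y)"
    "y \<in> Obj B \<Longrightarrow> Cod B (e y) = y"
  using e_Hom[of y] by (auto simp: Hom_def)

lemma e_lists:
  assumes "set ys \<subseteq> Obj B"
  shows "set (map e ys) \<subseteq> Arr B" "map (Dom B) (map e ys) = map (ob U) (map R ys)" "map (Cod B) (map e ys) = ys"
    "set (map R ys) \<subseteq> Obj A"
  using assms e_simps R_Obj by (auto simp: subset_iff map_idI)

definition lift :: "'o \<Rightarrow> 'o \<Rightarrow> 'm2 \<Rightarrow> 'm" where
  "lift x x' g = (SOME f. f \<in> Hom A x x' \<and> ar U f = g)"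

lemma lift_props:
  assumes "x \<in> Obj A" "x' \<in> Obj A" "g \<in> Arr B" "Dom B g = ob U x" "Cod B g = ob U x'"
  shows "lift x x' g \<in> Arr A" "Dom A (lift x x' g) = x" "Cod A (lift x x' g) = x'"
    "ar U (lift x x' g) = g"
proof -
  have "\<exists>f. f \<in> Hom A x x' \<and> ar U f = g" using full[OF assms(1,2), of g] assms by (auto simp: Hom_def)
  from someI_ex[OF this] show "lift x x' g \<in> Arr A" "Dom A (lift x x' g) = x" "Cod A (lift x x' g) = x'"
    "ar U (lift x x' g) = g"
    by (auto simp: lift_def Hom_def)
qed

text \<open>Fullness supplies a candidate for the inverse, and faithfulness shows that it is one.\<close>

lemma is_iso_reflect:
  assumes f: "f \<in> Arr A" and i: "is_iso B (ar U f)" shows "is_iso A f"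
proof -
  let ?g = "lift (Cod A f) (Dom A f) (inv_arr B (ar U f))"
  have o: "Dom A f \<in> Obj A" "Cod A f \<in> Obj A" using f by (auto intro: X.base.Dom_Obj X.base.Cod_Obj)
  have g: "?g \<in> Arr A" "Dom A ?g = Cod A f" "Cod A ?g = Dom A f" "ar U ?g = inv_arr B (ar U f)"
    using f o i by (auto intro!: lift_props)
  have "inverse_arrows A f ?g"
    unfolding inverse_arrows_def
  proof (intro conjI)
    show "Cmp A ?g f = Idn A (Dom A f)"
      by (rule faithful) (use f g i o in \<open>simp_all add: und.ar_Cmp' und.ar_Idn\<close>)
    show "Cmp A f ?g = Idn A (Cod A f)"
      by (rule faithful) (use f g i o in \<open>simp_all add: und.ar_Cmp' und.ar_Idn\<close>)
  qed (use f g in \<open>auto simp: Hom_def\<close>)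
  then show ?thesis by (auto simp: is_iso_def)
qed

text \<open>This is the preimage of the conjugate of \<open>g\<close> by \<open>e\<close>, the only choice that makes \<open>e\<close> natural.\<close>

definition R_ar :: "'m2 \<Rightarrow> 'm" where
  "R_ar g = lift (R (Dom B g)) (R (Cod B g))
     (Cmp B (inv_arr B (e (Cod B g))) (Cmp B g (e (Dom B g))))"

lemma R_ar:
  assumes "g \<in> Arr B"
  shows "R_ar g \<in> Arr A" "Dom A (R_ar g) = R (Dom B g)" "Cod A (R_ar g) = R (Cod B g)"
    and e_natural: "Cmp B (e (Cod B g)) (ar U (R_ar g)) = Cmp B g (e (Dom B g))"
proof -
  have o: "Dom B g \<in> Obj B" "Cod B g \<in> Obj B" using assms by (auto intro: Y.base.Dom_Obj Y.base.Cod_Obj)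
  note [simp] = e_simps[OF o(1)] e_simps[OF o(2)] e_iso[OF o(1)] e_iso[OF o(2)]
  let ?g = "Cmp B (inv_arr B (e (Cod B g))) (Cmp B g (e (Dom B g)))"
  have g: "?g \<in> Arr B" "Dom B ?g = ob U (R (Dom B g))" "Cod B ?g = ob U (R (Cod B g))"
    using assms by auto
  note l = lift_props[OF R_Obj[OF o(1)] R_Obj[OF o(2)] g, folded R_ar_def]
  show "R_ar g \<in> Arr A" "Dom A (R_ar g) = R (Dom B g)" "Cod A (R_ar g) = R (Cod B g)" by (rule l)+
  have "Cmp B (e (Cod B g)) ?g = Cmp B (Cmp B (e (Cod B g)) (inv_arr B (e (Cod B g)))) (Cmp B g (e (Dom B g)))"
    using assms by (intro Y.base.Cmp_Cmp[symmetric]) auto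
  then show "Cmp B (e (Cod B g)) (ar U (R_ar g)) = Cmp B g (e (Dom B g))"
    unfolding l using assms by simp
qed

text \<open>
  The constraint of the inverse is the only family for which \<open>e\<close> is compatible with the constraints: it is determined by
  \<open>e \<cdot> U \<psi>\<^sub>q \<cdot> \<phi>\<^sub>q = h(q, e)\<close>, which is used below in place of the definition.
\<close>

definition \<psi> :: "'q \<Rightarrow> 'o2 list \<Rightarrow> 'm" where
  "\<psi> q ys = lift (ob (act X) (q, map R ys)) (R (ob (act Y) (q, ys)))
     (Cmp B (inv_arr B (e (ob (act Y) (q, ys))))
       (Cmp B (hY (length ys) q (map e ys)) (inv_arr B (constr F q (map R ys)))))"

lemma
  assumes q: "q \<in> Obj (cells Q n)" and ys: "length ys = n" "set ys \<subseteq> Obj B"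
  shows \<psi>_Arr: "\<psi> q ys \<in> Arr A" and \<psi>_Dom: "Dom A (\<psi> q ys) = ob (act X) (q, map R ys)"
    and \<psi>_Cod: "Cod A (\<psi> q ys) = R (ob (act Y) (q, ys))"
    and \<psi>_iso: "is_iso A (\<psi> q ys)"
    and \<psi>_eq: "Cmp B (e (ob (act Y) (q, ys))) (Cmp B (ar U (\<psi> q ys)) (constr F q (map R ys))) =
      hY n q (map e ys)"
proof -
  let ?y = "ob (act Y) (q, ys)" and ?h = "hY (length ys) q (map e ys)" and ?c = "constr F q (map R ys)"
  note o = Y.act_Obj[OF q ys] and l = e_lists[OF ys(2)]
  have iq: "Idn (cells Q n) q \<in> Arr (cells Q n)" "Dom (cells Q n) (Idn (cells Q n) q) = q"
    "Cod (cells Q n) (Idn (cells Q n) q) = q"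
    using q by (auto simp: category.Idn_Arr category.Dom_Idn category.Cod_Idn)
  have hi: "is_iso B ?h" using ys q e_iso by (auto intro!: Y.act_is_iso simp: subset_iff)
  have l1: "length (map R ys) = n" "length (map e ys) = n" using ys by simp_all
  note [simp] = e_simps[OF o] e_iso[OF o] ys(1) constr_Arr[OF q l1(1) l(4)] constr_Dom[OF q l1(1) l(4)]
    constr_Cod[OF q l1(1) l(4)] constr_is_iso[OF q l1(1) l(4)] iq
    Y.act_Arr[OF iq(1) l1(2) l(1)] Y.act_Dom[OF iq(1) l1(2) l(1)] Y.act_Cod[OF iq(1) l1(2) l(1)]
  let ?g = "Cmp B (inv_arr B (e ?y)) (Cmp B ?h (inv_arr B ?c))"
  have g: "?g \<in> Arr B" "Dom B ?g = ob U (ob (act X) (q, map R ys))" "Cod B ?g = ob U (R ?y)"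
    using l by (simp_all del: map_map)
  note p = lift_props[OF X.act_Obj[OF q l1(1) l(4)] R_Obj[OF o] g, folded \<psi>_def]
  show "\<psi> q ys \<in> Arr A" "Dom A (\<psi> q ys) = ob (act X) (q, map R ys)" "Cod A (\<psi> q ys) = R ?y" by (rule p)+
  show "is_iso A (\<psi> q ys)"
    using hi l by (intro is_iso_reflect p(1)) (simp add: p Y.base.is_iso_Cmp Y.base.is_iso_inv_arr del: map_map)
  have 1: "Cmp B (e ?y) (Cmp B (inv_arr B (e ?y)) k) = k" if "k \<in> Arr B" "Cod B k = ?y" for k
    using that by (simp flip: Y.base.Cmp_Cmp)
  show "Cmp B (e ?y) (Cmp B (ar U (\<psi> q ys)) ?c) = hY n q (map e ys)"
    using l by (simp add: p 1 del: map_map)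
qed

text \<open>
  This reduces every equation that \<open>\<psi>\<close> has to satisfy to one in \<open>Y\<close> without inverses.
  Since \<open>U\<close> is faithful and \<open>\<phi>\<close> and \<open>e\<close> are invertible, arrows \<open>h(q, xs) \<rightarrow> R y\<close> are determined by
  the corresponding arrows \<open>h(q, U xs) \<rightarrow> y\<close>.
\<close>

lemma cancel:
  assumes q: "q \<in> Obj (cells Q n)" and xs: "length xs = n" "set xs \<subseteq> Obj A" and y: "y \<in> Obj B"
    and f: "f \<in> Arr A" "Dom A f = ob (act X) (q, xs)" "Cod A f = R y"
    and f': "f' \<in> Arr A" "Dom A f' = ob (act X) (q, xs)" "Cod A f' = R y"
    and eq: "Cmp B (e y) (Cmp B (ar U f) (constr F q xs)) = Cmp B (e y) (Cmp B (ar U f') (constr F q xs))"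
  shows "f = f'"
proof (rule faithful)
  note [simp] = constr_Arr[OF q xs] constr_Dom[OF q xs] constr_Cod[OF q xs] e_simps[OF y] e_iso[OF y]
  have *: "Cmp B (inv_arr B (e y)) (Cmp B (e y) k) = k" if "k \<in> Arr B" "Cod B k = ob U (R y)" for k
    using that by (simp flip: Y.base.Cmp_Cmp)
  have "Cmp B (ar U f) (constr F q xs) = Cmp B (ar U f') (constr F q xs)"
    using arg_cong[OF eq, of "Cmp B (inv_arr B (e y))"] f f' by (simp add: *)
  then show "ar U f = ar U f'"
    by (rule Y.base.iso_cancel_right[OF constr_is_iso[OF q xs], rotated 4]) (use f f' in auto)
qed (use f f' in auto)

definition G :: "('q, 'o2, 'm2, 'o, 'm) weak_data" where
  "G = \<lparr>und = \<lparr>ob = R, ar = R_ar\<rparr>, constr = \<psi>\<rparr>"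

lemma cat_functor_G: "cat_functor B A (und G)"
proof -
  have 1: "Cmp B (inv_arr B (e y)) (Cmp B (e y) k) = k" if "y \<in> Obj B" "k \<in> Arr B" "Cod B k = ob U (R y)" for y k
    using that e_simps[OF that(1)] e_iso[OF that(1)] by (simp flip: Y.base.Cmp_Cmp)
  have eqI: "k = k'" if "y \<in> Obj B" "k \<in> Arr A" "k' \<in> Arr A" "Dom A k = Dom A k'" "Cod A k = R y" "Cod A k' = R y"
    "Cmp B (e y) (ar U k) = Cmp B (e y) (ar U k')" for y k k'
    using that(1-6) arg_cong[OF that(7), of "Cmp B (inv_arr B (e y))"]
    by (intro faithful) (simp_all add: 1)
  show ?thesis
  proof (rule cat_functorI)
    fix y assume y: "y \<in> Obj B"
    show "ar (und G) (Idn B y) = Idn A (ob (und G) y)"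
      by (rule eqI[OF y]) (use y R_ar[of "Idn B y"] R_Obj[of y] e_simps[of y] in
        \<open>simp_all add: G_def und.ar_Idn e_natural[of "Idn B y"]\<close>)
  next
    fix f g assume a: "f \<in> Arr B" "g \<in> Arr B" "Dom B g = Cod B f"
    have o: "Dom B f \<in> Obj B" "Cod B f \<in> Obj B" "Cod B g \<in> Obj B"
      using a by (auto intro: Y.base.Dom_Obj Y.base.Cod_Obj)
    note [simp] = R_ar(1-3)[OF a(1)] R_ar(1-3)[OF a(2)] a o e_simps
    have "Cmp B (e (Cod B g)) (ar U (R_ar (Cmp B g f))) = Cmp B g (Cmp B f (e (Dom B f)))"
      using e_natural[of "Cmp B g f"] by simp
    also have "\<dots> = Cmp B g (Cmp B (e (Cod B f)) (ar U (R_ar f)))"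
      using e_natural[OF a(1)] by simp
    also have "\<dots> = Cmp B (Cmp B g (e (Dom B g))) (ar U (R_ar f))"
      by simp
    also have "\<dots> = Cmp B (e (Cod B g)) (ar U (Cmp A (R_ar g) (R_ar f)))"
      unfolding e_natural[OF a(2), symmetric] by (simp add: und.ar_Cmp')
    finally have eq: "Cmp B (e (Cod B g)) (ar U (R_ar (Cmp B g f))) =
      Cmp B (e (Cod B g)) (ar U (Cmp A (R_ar g) (R_ar f)))" .
    show "ar (und G) (Cmp B g f) = Cmp A (ar (und G) g) (ar (und G) f)"
      by (rule eqI[OF o(3)]) (use eq R_ar(1-3)[of "Cmp B g f"] in \<open>simp_all add: G_def\<close>)
  qed (auto simp: G_def R_Obj R_ar Hom_def X.base.category_axioms Y.base.category_axioms)
qed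

lemma G_simps: "ob (und G) = R" "ar (und G) = R_ar" "constr G = \<psi>"
  by (simp_all add: G_def)

lemma R_ar_lists:
  assumes "set gs \<subseteq> Arr B"
  shows "set (map R_ar gs) \<subseteq> Arr A" "map (Dom A) (map R_ar gs) = map R (map (Dom B) gs)"
    "map (Cod A) (map R_ar gs) = map R (map (Cod B) gs)"
    "set (map (ar U) (map R_ar gs)) \<subseteq> Arr B"
    "map (Dom B) (map (ar U) (map R_ar gs)) = map (ob U) (map R (map (Dom B) gs))"
    "map (Cod B) (map (ar U) (map R_ar gs)) = map (ob U) (map R (map (Cod B) gs))"
  using assms R_ar by (auto simp: subset_iff)

text \<open>
  Write \<open>\<chi>\<^sub>q = U \<psi>\<^sub>q \<cdot> \<phi>\<^sub>q\<close>, so that \<open>e \<cdot> \<chi>\<^sub>q = h(q, e)\<close>. After cancellation, naturality of \<open>\<psi>\<close> says that both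
  sides equal \<open>h(\<alpha>, f \<cdot> e)\<close>, by naturality of \<open>\<phi>\<close> and \<open>e\<close>. The operadic axiom says
  \<open>h(q, e) \<cdot> h(q, \<chi>\<^sub>r) = h(q, h(r, e))\<close>, once naturality of \<open>\<phi>\<close> has moved \<open>\<phi>\<^sub>q\<close> past \<open>h(q, \<psi>\<^sub>r)\<close>.
\<close>

lemma weak_morphism_G: "weak_morphism Q Y X G"
proof (rule weak_morphismI[OF Y.cat_algebra_axioms X.cat_algebra_axioms cat_functor_G], unfold G_simps, goal_cases)
  case (1 n q as)
  then show ?case by (auto simp: Hom_def \<psi>_Arr \<psi>_Dom \<psi>_Cod)
next
  case (2 n q as)
  then show ?case by (rule \<psi>_iso)
next
  case (3 n \<alpha> fs)
  let ?q = "Dom (cells Q n) \<alpha>" and ?q' = "Cod (cells Q n) \<alpha>"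
  let ?D = "map (Dom B) fs" and ?C = "map (Cod B) fs"
  let ?y = "ob (act Y) (?q', ?C)"
  have D: "set ?D \<subseteq> Obj B" "set ?C \<subseteq> Obj B" "length ?D = n" "length ?C = n"
    "?q \<in> Obj (cells Q n)" "?q' \<in> Obj (cells Q n)"
    using 3 by (auto simp: Y.base.Dom_Obj Y.base.Cod_Obj category.Dom_Obj category.Cod_Obj)
  note eD = e_lists[OF D(1)] and eC = e_lists[OF D(2)] and Rl = R_ar_lists[OF 3(3)]
  have L: "length (map R ?D) = n" "length (map R ?C) = n" "length (map e ?D) = n" "length (map e ?C) = n"
    "length (map R_ar fs) = n" "length (map (ar U) (map R_ar fs)) = n"
    using 3 by simp_all
  note y = Y.act_Obj[OF D(5,3,1)] Y.act_Obj[OF D(6,4,2)]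
  note iq = category.Idn_Arr[OF X.category_cells D(5)] category.Dom_Idn[OF X.category_cells D(5)] category.Cod_Idn[OF X.category_cells D(5)]
  note iq' = category.Idn_Arr[OF X.category_cells D(6)] category.Dom_Idn[OF X.category_cells D(6)] category.Cod_Idn[OF X.category_cells D(6)]
  note a = Y.act_Arr[OF 3] Y.act_Dom[OF 3] Y.act_Cod[OF 3]
  note [simp] = \<psi>_Arr[OF D(5,3,1)] \<psi>_Dom[OF D(5,3,1)] \<psi>_Cod[OF D(5,3,1)]
    \<psi>_Arr[OF D(6,4,2)] \<psi>_Dom[OF D(6,4,2)] \<psi>_Cod[OF D(6,4,2)] a
    X.act_Arr[OF 3(1) L(5) Rl(1)] X.act_Dom[OF 3(1) L(5) Rl(1)] X.act_Cod[OF 3(1) L(5) Rl(1)]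
    Y.act_Arr[OF 3(1) L(6) Rl(4)] Y.act_Dom[OF 3(1) L(6) Rl(4)] Y.act_Cod[OF 3(1) L(6) Rl(4)]
    R_ar(1-3)[OF a(1)] e_simps[OF y(1)] e_simps[OF y(2)]
    constr_Arr[OF D(5) L(1) eD(4)] constr_Dom[OF D(5) L(1) eD(4)] constr_Cod[OF D(5) L(1) eD(4)]
    constr_Arr[OF D(6) L(2) eC(4)] constr_Dom[OF D(6) L(2) eC(4)] constr_Cod[OF D(6) L(2) eC(4)]
    Y.act_Arr[OF iq(1) L(3) eD(1)] Y.act_Dom[OF iq(1) L(3) eD(1)] Y.act_Cod[OF iq(1) L(3) eD(1)] iq iq'
    Y.act_Arr[OF iq'(1) L(4) eC(1)] Y.act_Dom[OF iq'(1) L(4) eC(1)] Y.act_Cod[OF iq'(1) L(4) eC(1)]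
    Rl eD eC
  have nat: "Cmp B (constr F ?q' (map R ?C)) (ar (act Y) (\<alpha>, map (ar U) (map R_ar fs))) =
     Cmp B (ar U (ar (act X) (\<alpha>, map R_ar fs))) (constr F ?q (map R ?D))"
    using constr_natural[OF 3(1) L(5) Rl(1)] by (simp only: Rl)
  have m: "map2 (Cmp B) (map e ?C) (map (ar U) (map R_ar fs)) = map2 (Cmp B) fs (map e ?D)"
    using 3(3) e_natural by (induction fs) auto
  show ?case
  proof (rule cancel[OF D(5) L(1) eD(4) y(2)])
    have "Cmp B (e ?y) (Cmp B (ar U (Cmp A (\<psi> ?q' ?C) (ar (act X) (\<alpha>, map R_ar fs)))) (constr F ?q (map R ?D))) =
        Cmp B (Cmp B (e ?y) (Cmp B (ar U (\<psi> ?q' ?C)) (constr F ?q' (map R ?C)))) (ar (act Y) (\<alpha>, map (ar U) (map R_ar fs)))"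
      by (simp add: und.ar_Cmp' nat del: map_map)
    also have "\<dots> = ar (act Y) (\<alpha>, map2 (Cmp B) fs (map e ?D))"
      unfolding \<psi>_eq[OF D(6,4,2)] m[symmetric]
      by (rule Y.act_Cmp_Idn_left[OF 3(1) L(6)]) (simp_all only: Rl eC)
    also have "\<dots> = Cmp B (ar (act Y) (\<alpha>, fs)) (hY n ?q (map e ?D))"
      by (rule Y.act_Cmp_Idn_right[OF 3(1) L(3), symmetric]) (use 3(3) in \<open>simp_all only: eD\<close>)
    also have "\<dots> = Cmp B (Cmp B (ar (act Y) (\<alpha>, fs)) (e (ob (act Y) (?q, ?D))))
        (Cmp B (ar U (\<psi> ?q ?D)) (constr F ?q (map R ?D)))"
      unfolding \<psi>_eq[OF D(5,3,1), symmetric] by (simp del: map_map)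
    also have "\<dots> = Cmp B (e ?y) (Cmp B (ar U (Cmp A (R_ar (ar (act Y) (\<alpha>, fs))) (\<psi> ?q ?D))) (constr F ?q (map R ?D)))"
      using e_natural[OF a(1)] unfolding a by (simp add: und.ar_Cmp' flip: Y.base.Cmp_Cmp del: map_map)
    finally show "Cmp B (e ?y) (Cmp B (ar U (Cmp A (\<psi> ?q' ?C) (ar (act X) (\<alpha>, map R_ar fs)))) (constr F ?q (map R ?D))) =
       Cmp B (e ?y) (Cmp B (ar U (Cmp A (R_ar (ar (act Y) (\<alpha>, fs))) (\<psi> ?q ?D))) (constr F ?q (map R ?D)))" .
  qed (simp_all del: map_map)
next
  case (4 a)
  have q: "unt Q \<in> Obj (cells Q 1)" by (rule X.unt_Obj)
  have l: "length [a] = 1" "set [a] \<subseteq> Obj B" "length [R a] = 1" "set [R a] \<subseteq> Obj A"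
    using 4 R_Obj by auto
  have h: "ob (act Y) (unt Q, [a]) = a" "ob (act X) (unt Q, [R a]) = R a" "hY 1 (unt Q) [e a] = e a"
    using 4 R_Obj Y.act_unt_ob X.act_unt_ob Y.act_unt_ar e_simps by auto
  have "Cmp B (e a) (Cmp B (ar U (\<psi> (unt Q) [a])) (constr F (unt Q) [R a])) = e a"
    using \<psi>_eq[OF q l(1,2)] by (simp add: h h[unfolded One_nat_def])
  moreover have "Cmp B (e a) (Cmp B (ar U (Idn A (R a))) (constr F (unt Q) [R a])) = e a"
    using 4 by (simp add: und.ar_Idn constr_unt R_Obj und.ob_Obj e_simps)
  ultimately have eq: "Cmp B (e a) (Cmp B (ar U (\<psi> (unt Q) [a])) (constr F (unt Q) [R a])) =
      Cmp B (e a) (Cmp B (ar U (Idn A (R a))) (constr F (unt Q) [R a]))" by simp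
  show ?case
    by (rule cancel[OF q l(3,4) 4 _ _ _ _ _ _ eq])
      (use 4 \<psi>_Arr[OF q l(1,2)] \<psi>_Dom[OF q l(1,2)] \<psi>_Cod[OF q l(1,2)] R_Obj[OF 4] h in auto)
next
  case (5 q rs ass)
  let ?n = "length ass" and ?Rass = "map (map R) ass"
  let ?h = "map (ob (act Y)) (zip rs ass)" and ?\<psi> = "map2 \<psi> rs ass"
  let ?hR = "map (ob (act X)) (zip rs ?Rass)" and ?\<phi> = "map2 (constr F) rs ?Rass"
  let ?E = "map (map e) ass"
  have l: "length rs = ?n" using 5(2) by (simp add: list_all2_lengthD)
  have r: "rs ! i \<in> Obj (cells Q (length (ass ! i)))" "set (ass ! i) \<subseteq> Obj B"
    "set (map R (ass ! i)) \<subseteq> Obj A" if "i < ?n" for i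
    using 5(2,3) that e_lists(4)[of "ass ! i"] by (auto simp: list_all2_conv_all_nth)
  have h: "set ?h \<subseteq> Obj B" "length ?h = ?n"
    using l Y.act_Obj[OF r(1) refl r(2)] by (auto simp: set_zip)
  have hR: "set ?hR \<subseteq> Obj A" "length ?hR = ?n"
    using l X.act_Obj[OF r(1) _ r(3)] by (auto simp: set_zip)
  have psi: "set ?\<psi> \<subseteq> Arr A" "map (Dom A) ?\<psi> = ?hR" "map (Cod A) ?\<psi> = map R ?h" "length ?\<psi> = ?n"
    using l \<psi>_Arr[OF r(1) refl r(2)] \<psi>_Dom[OF r(1) refl r(2)] \<psi>_Cod[OF r(1) refl r(2)]
    by (auto simp: set_zip intro!: nth_equalityI)
  note Upsi = und.map_ar[OF psi(1), unfolded psi]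
  have phi: "set ?\<phi> \<subseteq> Arr B" "map (Cod B) ?\<phi> = map (ob U) ?hR" "length ?\<phi> = ?n"
    using l constr_Arr[OF r(1) _ r(3)] constr_Cod[OF r(1) _ r(3)] by (auto simp: set_zip intro!: nth_equalityI)
  note q = 5(1)
  have iq: "Idn (cells Q ?n) q \<in> Arr (cells Q ?n)" "Dom (cells Q ?n) (Idn (cells Q ?n) q) = q"
    "Cod (cells Q ?n) (Idn (cells Q ?n) q) = q"
    using q by (auto simp: category.Idn_Arr category.Dom_Idn category.Cod_Idn)
  have FF: "list_all2 (\<lambda>as r. r \<in> Obj (cells Q (length as))) ?Rass rs" 
    using 5(2) by (auto simp: list_all2_map1 list_all2_conv_all_nth)
  have FO: "set as \<subseteq> Obj A" if "as \<in> set ?Rass" for as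
    using that e_lists(4)[OF 5(3)] by clarsimp blast
  have FF': "map length ?Rass = map length ass" "length ?Rass = ?n" by auto
  have Fgam: "constr F (ob (gam Q (map length ass)) (q, rs)) (concat ?Rass) = Cmp B (constr F q ?hR) (hY ?n q ?\<phi>)"
    using constr_gam'[OF _ FF, of q] FO q unfolding FF' by blast
  have hX': "ob (act X) (ob (gam Q (map length ass)) (q, rs), concat ?Rass) = ob (act X) (q, ?hR)"
    using X.act_gam_ob'[OF _ FF, of q] FO q unfolding FF' by blast
  have hY': "ob (act Y) (ob (gam Q (map length ass)) (q, rs), concat ass) = ob (act Y) (q, ?h)"
    using Y.act_gam_ob'[OF q 5(2)] 5(3) by blast
  let ?qr = "ob (gam Q (map length ass)) (q, rs)" and ?as = "concat ass"
  have qr: "?qr \<in> Obj (cells Q (length ?as))"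
    using X.gam_Obj[of q "map length ass" rs] q 5(2) by (simp add: length_concat list_all2_map1)
  have as: "set ?as \<subseteq> Obj B" using 5(3) by auto
  have Ras: "set (map R ?as) \<subseteq> Obj A" "length (map R ?as) = length ?as" using e_lists[OF as] by simp_all
  have cR: "concat ?Rass = map R ?as" "concat ?E = map e ?as" by (simp_all add: map_concat)
  let ?y = "ob (act Y) (?qr, ?as)"
  have y: "?y \<in> Obj B" by (rule Y.act_Obj[OF qr refl as])
  have L: "length (map R ?h) = ?n" "length (map e ?h) = ?n" "length (map (ar U) ?\<psi>) = ?n" using h l by simp_all
  note [simp] = \<psi>_Arr[OF q h(2,1)] \<psi>_Dom[OF q h(2,1)] \<psi>_Cod[OF q h(2,1)]
    \<psi>_Arr[OF qr refl as] \<psi>_Dom[OF qr refl as] \<psi>_Cod[OF qr refl as] iq Upsi psi phi 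
    X.act_Arr[OF iq(1) psi(4,1)] X.act_Dom[OF iq(1) psi(4,1)] X.act_Cod[OF iq(1) psi(4,1)]
    constr_Arr[OF q hR(2,1)] constr_Dom[OF q hR(2,1)] constr_Cod[OF q hR(2,1)]
    constr_Arr[OF q L(1) e_lists(4)[OF h(1)]] constr_Dom[OF q L(1) e_lists(4)[OF h(1)]] constr_Cod[OF q L(1) e_lists(4)[OF h(1)]]
    Y.act_Arr[OF iq(1) phi(3,1)] Y.act_Dom[OF iq(1) phi(3,1)] Y.act_Cod[OF iq(1) phi(3,1)]
    Y.act_Arr[OF iq(1) L(3) Upsi(1)] Y.act_Dom[OF iq(1) L(3) Upsi(1)] Y.act_Cod[OF iq(1) L(3) Upsi(1)]
    e_simps[OF y] e_simps[OF y, unfolded hY']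
  have nat: "Cmp B (ar U (hX ?n q ?\<psi>)) (constr F q ?hR) = Cmp B (constr F q (map R ?h)) (hY ?n q (map (ar U) ?\<psi>))"
    using constr_natural_Idn[OF q psi(4,1)] by (simp only: psi)
  have "Cmp B (e ?y) (Cmp B (ar U (Cmp A (\<psi> q ?h) (hX ?n q ?\<psi>))) (constr F ?qr (map R ?as))) =
     Cmp B (e ?y) (Cmp B (ar U (\<psi> q ?h)) (Cmp B (Cmp B (ar U (hX ?n q ?\<psi>)) (constr F q ?hR)) (hY ?n q ?\<phi>)))"
    unfolding cR[symmetric] Fgam by (simp add: und.ar_Cmp' hY' del: map_map)
  also have "\<dots> = Cmp B (Cmp B (e ?y) (Cmp B (ar U (\<psi> q ?h)) (constr F q (map R ?h))))
      (Cmp B (hY ?n q (map (ar U) ?\<psi>)) (hY ?n q ?\<phi>))"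
    unfolding nat hY' by (simp del: map_map)
  also have "\<dots> = Cmp B (hY ?n q (map e ?h)) (hY ?n q (map2 (Cmp B) (map (ar U) ?\<psi>) ?\<phi>))"
    unfolding hY' \<psi>_eq[OF q h(2,1)]
    by (subst Y.act_Idn_Cmp[OF q phi(3,1) Upsi(1)]) (simp_all del: map_map)
  also have "\<dots> = hY ?n q (map2 (Cmp B) (map e ?h) (map2 (Cmp B) (map (ar U) ?\<psi>) ?\<phi>))"
  proof (rule Y.act_Idn_Cmp[OF q, symmetric])
    have m: "map (Dom B) (map (ar U) ?\<psi>) = map (Cod B) ?\<phi>" by (simp only: Upsi phi)
    note c = map2_Cmp_lists[OF Y.base.category_axioms phi(1) Upsi(1) m]
    show "set (map2 (Cmp B) (map (ar U) ?\<psi>) ?\<phi>) \<subseteq> Arr B" by (rule c)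
    show "map (Dom B) (map e ?h) = map (Cod B) (map2 (Cmp B) (map (ar U) ?\<psi>) ?\<phi>)"
      by (simp only: c e_lists[OF h(1)] Upsi)
  qed (use l e_lists[OF h(1)] in simp_all)
  also have "map2 (Cmp B) (map e ?h) (map2 (Cmp B) (map (ar U) ?\<psi>) ?\<phi>) =
      map2 (\<lambda>r fs. ar (act Y) (Idn (cells Q (length fs)) r, fs)) rs ?E"
    using l \<psi>_eq[OF r(1) refl r(2)] by (auto intro!: nth_equalityI)
  also have "hY ?n q \<dots> = hY (length ?as) ?qr (map e ?as)"
  proof -
    have "set fs \<subseteq> Arr B" if "fs \<in> set ?E" for fs using that e_lists(1)[OF 5(3)] by clarsimp blast
    then show ?thesis
      using Y.act_gam_Idn[of q ?E rs] q 5(2)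
      by (simp add: cR list_all2_map1 length_concat comp_def)
  qed
  also have "\<dots> = Cmp B (e ?y) (Cmp B (ar U (\<psi> ?qr ?as)) (constr F ?qr (map R ?as)))"
    by (rule \<psi>_eq[OF qr refl as, symmetric])
  finally have eq: "Cmp B (e ?y) (Cmp B (ar U (Cmp A (\<psi> q ?h) (hX ?n q ?\<psi>))) (constr F ?qr (map R ?as))) =
      Cmp B (e ?y) (Cmp B (ar U (\<psi> ?qr ?as)) (constr F ?qr (map R ?as)))" .
  show ?case
    by (rule cancel[OF qr Ras(2,1) y _ _ _ _ _ _ eq[symmetric]]) (simp_all add: hX'[unfolded cR] hY' del: map_map)
qed

lemma counit_transformation: "alg_transformation Q Y Y (comp_weak Y F G) (id_weak Y) e"
proof (rule alg_transformationI[OF weak_morphism_comp[OF weak_morphism_G weak_morphism_axioms]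
        weak_morphism_id[OF Y.cat_algebra_axioms]], goal_cases)
  case (3 n q as)
  have "length (map e as) = n" using 3 by simp
  note h = category.Idn_Arr[OF X.category_cells 3(1)] this e_lists(1)[OF 3(3)]
  have "hY n q (map e as) \<in> Arr B" "Cod B (hY n q (map e as)) = ob (act Y) (q, as)"
    using Y.act_Arr[OF h] Y.act_Cod[OF h] category.Cod_Idn[OF X.category_cells 3(1)] e_lists(3)[OF 3(3)]
    by simp_all
  then show ?case
    using \<psi>_eq[OF 3] by (simp add: comp_weak_def id_weak_def G_simps)
qed (auto simp: comp_weak_def comp_fun_def id_weak_def id_fun_def G_simps e_Hom e_natural)

text \<open>
  The inverse of the unit is easier to treat than the unit: it is a transformation into the identity, like
  \<open>e\<close>, and its image under \<open>U\<close> is \<open>e\<close> itself.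
\<close>

definition unit_inv :: "'o \<Rightarrow> 'm" where
  "unit_inv x = lift (R (ob U x)) x (e (ob U x))"

lemma unit_inv:
  assumes "x \<in> Obj A"
  shows "unit_inv x \<in> Arr A" "Dom A (unit_inv x) = R (ob U x)" "Cod A (unit_inv x) = x"
    "ar U (unit_inv x) = e (ob U x)"
  using lift_props[of "R (ob U x)" x "e (ob U x)"] assms e_simps[of "ob U x"] R_Obj[of "ob U x"]
  by (simp_all add: unit_inv_def und.ob_Obj)

text \<open>
  For coherence, apply \<open>U\<close> and precompose with \<open>\<phi>\<close>: both sides become \<open>\<phi>\<^sub>q \<cdot> h(q, e)\<close>, one by naturality of
  \<open>e\<close> and the defining equation of \<open>\<psi>\<close>, the other by naturality of \<open>\<phi>\<close>.
\<close>

lemma unit_inv_transformation: "alg_transformation Q X X (comp_weak X G F) (id_weak X) unit_inv"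
proof (rule alg_transformationI[OF weak_morphism_comp[OF weak_morphism_axioms weak_morphism_G]
        weak_morphism_id[OF X.cat_algebra_axioms]], goal_cases)
  case (1 x)
  then show ?case by (simp add: comp_weak_def comp_fun_def id_weak_def id_fun_def G_simps unit_inv Hom_def)
next
  case (2 f)
  have o: "Dom A f \<in> Obj A" "Cod A f \<in> Obj A" using 2 by (auto intro: X.base.Dom_Obj X.base.Cod_Obj)
  have "Cmp A (unit_inv (Cod A f)) (R_ar (ar U f)) = Cmp A f (unit_inv (Dom A f))"
    by (rule faithful) (use 2 o R_ar[of "ar U f"] in \<open>simp_all add: unit_inv und.ar_Cmp'\<close>)
  then show ?case by (simp add: comp_weak_def comp_fun_def id_weak_def id_fun_def G_simps)
next
  case (3 n q as)
  let ?U = "map (ob U) as" and ?z = "map unit_inv as" and ?h = "ob (act X) (q, as)"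
  have U: "length ?U = n" "set ?U \<subseteq> Obj B" using 3 by (auto simp: und.ob_Obj)
  have z: "length ?z = n" "set ?z \<subseteq> Arr A" "map (Dom A) ?z = map R ?U" "map (Cod A) ?z = as"
    "map (ar U) ?z = map e ?U"
    using 3 unit_inv by (auto simp: subset_iff map_idI)
  note h = X.act_Obj[OF 3]
  note E = e_lists[OF U(2)]
  have L: "length (map R ?U) = n" "length (map e ?U) = n" using 3 by simp_all
  have iq: "Idn (cells Q n) q \<in> Arr (cells Q n)" "Dom (cells Q n) (Idn (cells Q n) q) = q"
    "Cod (cells Q n) (Idn (cells Q n) q) = q"
    using 3 by (auto simp: category.Idn_Arr category.Dom_Idn category.Cod_Idn)
  note [simp] = constr_Arr[OF 3] constr_Dom[OF 3] constr_Cod[OF 3] R_ar(1-3)[OF constr_Arr[OF 3]]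
    constr_Arr[OF 3(1) L(1) E(4)] constr_Dom[OF 3(1) L(1) E(4)] constr_Cod[OF 3(1) L(1) E(4)]
    \<psi>_Arr[OF 3(1) U] \<psi>_Dom[OF 3(1) U] \<psi>_Cod[OF 3(1) U] unit_inv[OF h] e_simps[OF und.ob_Obj[OF h]]
    X.act_Arr[OF iq(1) z(1,2)] X.act_Dom[OF iq(1) z(1,2)] X.act_Cod[OF iq(1) z(1,2)] iq z
    e_simps[OF Y.act_Obj[OF 3(1) U]]
  have "Cmp A (unit_inv ?h) (Cmp A (R_ar (constr F q as)) (\<psi> q ?U)) = hX n q ?z"
  proof (rule faithful)
    have "Cmp B (ar U (Cmp A (unit_inv ?h) (Cmp A (R_ar (constr F q as)) (\<psi> q ?U)))) (constr F q (map R ?U)) =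
       Cmp B (Cmp B (e (ob U ?h)) (ar U (R_ar (constr F q as)))) (Cmp B (ar U (\<psi> q ?U)) (constr F q (map R ?U)))"
      by (simp add: und.ar_Cmp' del: map_map)
    also have "\<dots> = Cmp B (constr F q as) (Cmp B (e (ob (act Y) (q, ?U))) (Cmp B (ar U (\<psi> q ?U)) (constr F q (map R ?U))))"
      using e_natural[OF constr_Arr[OF 3]] by (simp del: map_map)
    also have "\<dots> = Cmp B (constr F q as) (hY n q (map e ?U))" by (simp only: \<psi>_eq[OF 3(1) U])
    also have "\<dots> = Cmp B (ar U (hX n q ?z)) (constr F q (map R ?U))"
      using constr_natural_Idn[OF 3(1) z(1,2)] by (simp only: z)
    finally show "ar U (Cmp A (unit_inv ?h) (Cmp A (R_ar (constr F q as)) (\<psi> q ?U))) = ar U (hX n q ?z)"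
      by (rule Y.base.iso_cancel_right[OF constr_is_iso[OF 3(1) L(1) E(4)], rotated 4]) (simp_all del: map_map)
  qed (simp_all del: map_map)
  then show ?case using h by (simp add: comp_weak_def comp_fun_def id_weak_def id_fun_def G_simps del: map_map)
qed

theorem equivalent_algebras_target_source: "equivalent_algebras Q Y X"
proof -
  have "isomorphic_weak Q Y Y (id_weak Y) (comp_weak Y F G)"
    by (rule isomorphic_weakI(2)[OF counit_transformation e_iso])
  moreover have "isomorphic_weak Q X X (comp_weak X G F) (id_weak X)"
    by (rule isomorphic_weakI(1)[OF unit_inv_transformation is_iso_reflect])
      (simp_all add: unit_inv e_iso und.ob_Obj)
  ultimately show ?thesis
    unfolding equivalent_algebras_def
    using weak_morphism_axioms weak_morphism_G X.cat_algebra_axioms Y.cat_algebra_axioms by blast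
qed

end

section \<open>Coherence arrows in a weak \<open>P\<close>-category\<close>

text \<open>
  From here on, tuples of trees and of lists are indexed by a common list \<open>is\<close>, which avoids
  cutting concatenated lists into blocks.
\<close>

lemma graft_graft:
  assumes "arity t = length is" "\<And>i. i \<in> set is \<Longrightarrow> arity (\<tau> i) = length (us i)"
  shows "graft t (map (\<lambda>i. graft (\<tau> i) (us i)) is) = graft (graft t (map \<tau> is)) (concat (map us is))"
proof -
  have a: "map arity (map \<tau> is) = map length (map us is)" using assms(2) by simp
  have "map2 graft (map \<tau> is) (map us is) = map (\<lambda>i. graft (\<tau> i) (us i)) is"
    by (auto intro!: nth_equalityI)
  then show ?thesis
    using graft_assoc[of "map \<tau> is" t "concat (map us is)"] assms(1)
    by (simp add: a blocks_concat length_concat del: map_map)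
qed

context plain_operad begin

lemma opc_T: "opc T ks = graft"
  by (simp add: free_operad_def)

lemma opu_T: "opu T = Leaf"
  by (simp add: free_operad_def)

lemma Leaf_T: "Leaf \<in> ops T (Suc 0)"
  by (simp add: free_operad_def well_labelled.intros)

lemma graft_T:
  assumes "t \<in> ops T (length is)" "\<And>i. i \<in> set is \<Longrightarrow> \<tau> i \<in> ops T (k i)"
  shows "graft t (map \<tau> is) \<in> ops T (sum_list (map k is))"
  using plain_operad.opc_ops[OF plain_operad_free_operad, of t "ops P" "map k is" "map \<tau> is"] assms
  by (simp add: opc_T list_all2_conv_all_nth)

lemma eps_T: "t \<in> ops T n \<Longrightarrow> eps P t \<in> ops P n"
  using eps_ops by (auto simp: free_operad_def)

lemma eps_graft_T:
  assumes "t \<in> ops T (length is)" "\<And>i. i \<in> set is \<Longrightarrow> \<tau> i \<in> ops T (k i)"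
  shows "eps P (graft t (map \<tau> is)) = opc P (map k is) (eps P t) (map (\<lambda>i. eps P (\<tau> i)) is)"
proof -
  have "map arity (map \<tau> is) = map k is" using assms(2) by (auto simp: free_operad_def)
  moreover have "eps P (graft t (map \<tau> is)) = opc P (map arity (map \<tau> is)) (eps P t) (map (eps P) (map \<tau> is))"
    using assms by (intro eps_graft) (auto simp: free_operad_def)
  ultimately show ?thesis by (simp only: map_map comp_def)
qed

lemma corolla_T: "p \<in> ops P n \<Longrightarrow> corolla n p \<in> ops T n"
  by (auto simp: corolla_def free_operad_def well_labelled.intros sum_list_replicate)

lemma eps_corolla: "p \<in> ops P n \<Longrightarrow> eps P (corolla n p) = p"
  using opc_opu_right[of p n] by (simp add: corolla_def)

end

locale weak_P_cat = plain_operad P + cat_algebra "Wk P" A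
  for P :: "'p operad_data" and A :: "('p tree, 'p tree \<times> 'p tree, 'o, 'm) alg_data"
begin

abbreviation "C \<equiv> base A"
abbreviation "h t as \<equiv> ob (act A) (t, as)"
abbreviation "H c fs \<equiv> ar (act A) (c, fs)"

definition parallel :: "nat \<Rightarrow> 'p tree \<Rightarrow> 'p tree \<Rightarrow> bool" where
  "parallel n s t \<longleftrightarrow> s \<in> ops T n \<and> t \<in> ops T n \<and> eps P s = eps P t"

lemma parallel_Arr: "parallel n s t \<longleftrightarrow> (s, t) \<in> Arr (cells (Wk P) n)"
  by (auto simp: parallel_def Wk_simps)

lemma h_Obj: "t \<in> ops T (length as) \<Longrightarrow> set as \<subseteq> Obj C \<Longrightarrow> h t as \<in> Obj C"
  using act_Obj[of t "length as" as] by (simp add: Wk_simps)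

lemma
  assumes "parallel (length fs) s t" "set fs \<subseteq> Arr C"
  shows H_Arr: "H (s, t) fs \<in> Arr C"
    and H_Dom: "Dom C (H (s, t) fs) = h s (map (Dom C) fs)"
    and H_Cod: "Cod C (H (s, t) fs) = h t (map (Cod C) fs)"
  using act_Arr[of "(s, t)" "length fs" fs] act_Dom[of "(s, t)" "length fs" fs] act_Cod[of "(s, t)" "length fs" fs] assms
  unfolding parallel_Arr by (simp_all add: Wk_simps)

lemma H_Cmp:
  assumes "parallel (length fs) s t" "parallel (length fs) t u" "set fs \<subseteq> Arr C" "set gs \<subseteq> Arr C"
    "map (Dom C) gs = map (Cod C) fs"
  shows "Cmp C (H (t, u) gs) (H (s, t) fs) = H (s, u) (map2 (Cmp C) gs fs)"
  using act_Cmp[of "(s, t)" "length fs" "(t, u)" fs gs] assms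
  unfolding parallel_Arr by (simp add: Wk_simps)

lemma h_graft:
  assumes "t \<in> ops T (length is)" "\<And>i. i \<in> set is \<Longrightarrow> \<tau> i \<in> ops T (length (as i))"
    "\<And>i. i \<in> set is \<Longrightarrow> set (as i) \<subseteq> Obj C"
  shows "h (graft t (map \<tau> is)) (concat (map as is)) = h t (map (\<lambda>i. h (\<tau> i) (as i)) is)"
proof -
  have "map (\<lambda>x. h (fst x) (snd x)) (zip (map \<tau> is) (map as is)) = map (\<lambda>i. h (\<tau> i) (as i)) is"
    by (auto intro!: nth_equalityI)
  moreover have "set xs \<subseteq> Obj C" if "xs \<in> set (map as is)" for xs using that assms(3) by auto
  ultimately show ?thesis
    using act_gam_ob'[of t "map as is" "map \<tau> is"] assms
    by (simp add: Wk_simps opc_T list_all2_conv_all_nth)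
qed

lemma H_graft:
  assumes "parallel (length is) s t" "\<And>i. i \<in> set is \<Longrightarrow> parallel (length (fs i)) (\<sigma> i) (\<tau> i)"
    "\<And>i. i \<in> set is \<Longrightarrow> set (fs i) \<subseteq> Arr C"
  shows "H (graft s (map \<sigma> is), graft t (map \<tau> is)) (concat (map fs is)) =
    H (s, t) (map (\<lambda>i. H (\<sigma> i, \<tau> i) (fs i)) is)"
proof -
  let ?\<beta> = "map (\<lambda>i. (\<sigma> i, \<tau> i)) is"
  have "map (ar (act A)) (zip ?\<beta> (map fs is)) = map (\<lambda>i. H (\<sigma> i, \<tau> i) (fs i)) is"
    by (auto intro!: nth_equalityI)
  moreover have "set xs \<subseteq> Arr C" if "xs \<in> set (map fs is)" for xs using that assms(3) by auto
  ultimately show ?thesis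
    using act_gam_ar'[of "(s, t)" "map fs is" ?\<beta>] assms
    unfolding parallel_Arr by (simp add: Wk_simps opc_T list_all2_conv_all_nth comp_def)
qed

text \<open>
  All isomorphisms in the construction are of this form. They compose, and they are compatible with
  grafting, because there is at most one 2-cell between two trees.
\<close>

definition coh :: "'p tree \<Rightarrow> 'p tree \<Rightarrow> 'o list \<Rightarrow> 'm" where
  "coh s t as = H (s, t) (map (Idn C) as)"

lemma
  assumes "parallel (length as) s t" "set as \<subseteq> Obj C"
  shows coh_Arr: "coh s t as \<in> Arr C"
    and coh_Dom: "Dom C (coh s t as) = h s as"
    and coh_Cod: "Cod C (coh s t as) = h t as"
proof -
  have "set (map (Idn C) as) \<subseteq> Arr C" "map (Dom C) (map (Idn C) as) = as" "map (Cod C) (map (Idn C) as) = as"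
    using assms(2) by (auto simp: subset_iff map_idI)
  then show "coh s t as \<in> Arr C" "Dom C (coh s t as) = h s as" "Cod C (coh s t as) = h t as"
    using H_Arr[of "map (Idn C) as" s t] H_Dom[of "map (Idn C) as" s t] H_Cod[of "map (Idn C) as" s t] assms
    by (simp_all add: coh_def del: map_map set_map)
qed

lemma coh_refl: "t \<in> ops T (length as) \<Longrightarrow> set as \<subseteq> Obj C \<Longrightarrow> coh t t as = Idn C (h t as)"
  using act_Idn[of t "length as" as] by (simp add: coh_def Wk_simps)

text \<open>Interchange: a 2-cell may be applied before or after arrows in the other arguments.\<close>

lemma coh_H:
  assumes "parallel (length fs) s t" "parallel (length fs) t u" "set fs \<subseteq> Arr C"
  shows "Cmp C (coh t u (map (Cod C) fs)) (H (s, t) fs) = H (s, u) fs"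
    and "Cmp C (H (t, u) fs) (coh s t (map (Dom C) fs)) = H (s, u) fs"
proof -
  let ?D = "map (Idn C) (map (Dom C) fs)" and ?C = "map (Idn C) (map (Cod C) fs)"
  have o: "Dom C f \<in> Obj C" "Cod C f \<in> Obj C" if "f \<in> set fs" for f
    using that assms(3) by (auto intro: base.Dom_Obj base.Cod_Obj)
  have 1: "set ?D \<subseteq> Arr C" "set ?C \<subseteq> Arr C" "map (Cod C) ?D = map (Dom C) fs" "map (Dom C) ?C = map (Cod C) fs"
    using o by auto
  have 2: "map2 (Cmp C) ?C fs = fs" "map2 (Cmp C) fs ?D = fs"
    using assms(3) by (auto intro!: nth_equalityI simp: subset_iff)
  show "Cmp C (coh t u (map (Cod C) fs)) (H (s, t) fs) = H (s, u) fs"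
    unfolding coh_def by (subst H_Cmp[OF assms(1,2,3) 1(2,4)]) (simp only: 2)
  show "Cmp C (H (t, u) fs) (coh s t (map (Dom C) fs)) = H (s, u) fs"
    unfolding coh_def using assms(1,2) by (subst H_Cmp[OF _ _ 1(1) assms(3) 1(3)[symmetric]]) (simp_all only: 2 length_map)
qed

lemma coh_trans:
  assumes "parallel (length as) s t" "parallel (length as) t u" "set as \<subseteq> Obj C"
  shows "Cmp C (coh t u as) (coh s t as) = coh s u as"
proof -
  have 1: "set (map (Idn C) as) \<subseteq> Arr C" "map (Cod C) (map (Idn C) as) = as"
    using assms(3) by (auto simp: subset_iff map_idI)
  show ?thesis using coh_H(1)[of "map (Idn C) as" s t u] assms(1,2) 1
    by (simp add: coh_def del: map_map set_map)
qed

lemma parallel_sym: "parallel n s t \<Longrightarrow> parallel n t s"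
  by (simp add: parallel_def)

lemma coh_iso:
  assumes "parallel (length as) s t" "set as \<subseteq> Obj C" shows "is_iso C (coh s t as)"
proof -
  note p = parallel_sym[OF assms(1)]
  have "inverse_arrows C (coh s t as) (coh t s as)"
    using assms p
    by (simp add: inverse_arrows_def Hom_def coh_Arr coh_Dom coh_Cod coh_trans coh_refl parallel_def[of _ s t])
  then show ?thesis by (auto simp: is_iso_def)
qed

lemma coh_graft:
  assumes "parallel (length is) s t" "\<And>i. i \<in> set is \<Longrightarrow> parallel (length (as i)) (\<sigma> i) (\<tau> i)"
    "\<And>i. i \<in> set is \<Longrightarrow> set (as i) \<subseteq> Obj C"
  shows "H (s, t) (map (\<lambda>i. coh (\<sigma> i) (\<tau> i) (as i)) is) =
    coh (graft s (map \<sigma> is)) (graft t (map \<tau> is)) (concat (map as is))"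
proof -
  have "set (map (Idn C) (as i)) \<subseteq> Arr C" if "i \<in> set is" for i using assms(3)[OF that] by auto
  then show ?thesis
    using H_graft[OF assms(1), of "\<lambda>i. map (Idn C) (as i)" \<sigma> \<tau>] assms(2)
    by (simp add: coh_def map_concat comp_def del: set_map)
qed

section \<open>The comparison isomorphisms of the strictification\<close>

abbreviation "stO \<equiv> Obj (st_cat P A)"
abbreviation "tr x \<equiv> corolla (length (snd x)) (fst x)"
abbreviation "val f \<equiv> snd (snd f)"
abbreviation "tgt f \<equiv> fst (snd f)"

lemma st_cat_simps:
  "Obj (st_cat P A) = {x. fst x \<in> ops P (length (snd x)) \<and> set (snd x) \<subseteq> Obj C}"
  "Arr (st_cat P A) = {f. fst f \<in> stO \<and> tgt f \<in> stO \<and> val f \<in> Hom C (st_val A (fst f)) (st_val A (tgt f))}"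
  "Dom (st_cat P A) = fst" "Cod (st_cat P A) = (\<lambda>f. tgt f)"
  "Idn (st_cat P A) x = (x, x, Idn C (st_val A x))"
  "Cmp (st_cat P A) g f = (fst f, tgt g, Cmp C (val g) (val f))"
  by (auto simp: st_cat_def Let_def split_beta)

lemma st_val: "st_val A x = h (tr x) (snd x)"
  by (simp add: st_val_def)

lemma st_act_ob: "st_act_ob P q xs = (opc P (map (\<lambda>x. length (snd x)) xs) q (map fst xs), concat (map snd xs))"
  by (simp add: st_act_ob_def case_prod_unfold)

lemma tr_T: "x \<in> stO \<Longrightarrow> tr x \<in> ops T (length (snd x))"
  and eps_tr: "x \<in> stO \<Longrightarrow> eps P (tr x) = fst x"
  by (simp_all add: st_cat_simps(1) corolla_T eps_corolla)

lemma st_val_Obj: "x \<in> stO \<Longrightarrow> st_val A x \<in> Obj C"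
  using h_Obj[OF tr_T] by (simp add: st_val st_cat_simps(1))

lemma category_st_cat: "category (st_cat P A)"
proof -
  have H: "f \<in> Hom (st_cat P A) x y \<longleftrightarrow> x \<in> stO \<and> y \<in> stO \<and> fst f = x \<and> tgt f = y \<and>
     val f \<in> Hom C (st_val A x) (st_val A y)" for f x y
    by (auto simp: Hom_def st_cat_simps(2-4))
  show ?thesis
  proof (unfold_locales, unfold H)
    fix f w x g y k z
    assume "w \<in> stO \<and> x \<in> stO \<and> fst f = w \<and> tgt f = x \<and> val f \<in> Hom C (st_val A w) (st_val A x)"
     "x \<in> stO \<and> y \<in> stO \<and> fst g = x \<and> tgt g = y \<and> val g \<in> Hom C (st_val A x) (st_val A y)"
     "y \<in> stO \<and> z \<in> stO \<and> fst k = y \<and> tgt k = z \<and> val k \<in> Hom C (st_val A y) (st_val A z)"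
    then show "Cmp (st_cat P A) k (Cmp (st_cat P A) g f) = Cmp (st_cat P A) (Cmp (st_cat P A) k g) f"
      using base.Cmp_assoc[of "val f" "st_val A w" "st_val A x" "val g" "st_val A y" "val k" "st_val A z"]
      by (simp add: st_cat_simps(3-))
  qed (auto simp: st_cat_simps(2-) base.Idn_Hom st_val_Obj base.Cmp_Hom prod_eq_iff base.Cmp_Idn_left base.Cmp_Idn_right)
qed

lemma st_act_ob_Obj:
  assumes "q \<in> ops P (length xs)" "set xs \<subseteq> stO" shows "st_act_ob P q xs \<in> stO"
proof -
  have "list_all2 (\<lambda>k p. p \<in> ops P k) (map (\<lambda>x. length (snd x)) xs) (map fst xs)"
    using assms(2) by (auto simp: list_all2_conv_all_nth st_cat_simps(1) subset_iff)
  from opc_ops[OF _ this, of q] assms show ?thesis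
    by (auto simp: st_act_ob st_cat_simps(1) length_concat comp_def)
qed

lemma st_act_ob_assoc:
  assumes "q \<in> ops P (length is)" "\<And>i. i \<in> set is \<Longrightarrow> p i \<in> ops P (length (X i))"
    "\<And>i. i \<in> set is \<Longrightarrow> set (X i) \<subseteq> stO"
  shows "st_act_ob P (opc P (map (\<lambda>i. length (X i)) is) q (map p is)) (concat (map X is)) =
    st_act_ob P q (map (\<lambda>i. st_act_ob P (p i) (X i)) is)"
proof -
  let ?kss = "map (\<lambda>i. map (\<lambda>x. length (snd x)) (X i)) is"
  have X: "fst x \<in> ops P (length (snd x))" if "i \<in> set is" "x \<in> set (X i)" for i x
    using that assms(3) by (auto simp: st_cat_simps(1))
  have "opc P (map sum_list ?kss) q
      (map2 (\<lambda>ks (p, rs). opc P ks p rs) ?kss (zip (map p is) (map (\<lambda>i. map fst (X i)) is))) =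
    opc P (concat ?kss) (opc P (map length ?kss) q (map p is)) (concat (map (\<lambda>i. map fst (X i)) is))"
    using assms(1,2) by (intro opc_assoc) (simp_all add: list_all2_conv_all_nth X[OF nth_mem nth_mem])
  moreover have "map2 (\<lambda>ks (p, rs). opc P ks p rs) ?kss (zip (map p is) (map (\<lambda>i. map fst (X i)) is)) =
    map (\<lambda>i. fst (st_act_ob P (p i) (X i))) is"
    by (auto intro!: nth_equalityI simp: st_act_ob)
  moreover have "concat (map snd (concat (map X is))) = concat (map (\<lambda>i. concat (map snd (X i))) is)"
    by (induction "is") auto
  ultimately show ?thesis
    by (simp add: st_act_ob map_concat length_concat comp_def)
qed

text \<open>
  The isomorphism \<open>h(t, v x\<^sub>1, \<dots>, v x\<^sub>n) \<rightarrow> v(\<epsilon>(t) \<cdot> (x\<^sub>1, \<dots>, x\<^sub>n))\<close>. Allowing every tree \<open>t\<close>, and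
  not only the corollas that occur in the definition of the strictification, makes it stable under grafting.
\<close>

definition st_coh :: "'p tree \<Rightarrow> ('p \<times> 'o list) list \<Rightarrow> 'm" where
  "st_coh t xs = coh (graft t (map tr xs)) (tr (st_act_ob P (eps P t) xs)) (concat (map snd xs))"

lemma st_objects:
  assumes "t \<in> ops T (length xs)" "set xs \<subseteq> stO"
  shows "parallel (length (concat (map snd xs))) (graft t (map tr xs)) (tr (st_act_ob P (eps P t) xs))"
    and "set (concat (map snd xs)) \<subseteq> Obj C"
    and "h (graft t (map tr xs)) (concat (map snd xs)) = h t (map (st_val A) xs)"
proof -
  have x: "tr x \<in> ops T (length (snd x))" "eps P (tr x) = fst x" "set (snd x) \<subseteq> Obj C" if "x \<in> set xs" for x
    using that assms(2) tr_T eps_tr by (auto simp: st_cat_simps(1))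
  have l: "length (concat (map snd xs)) = sum_list (map (\<lambda>x. length (snd x)) xs)"
    by (simp add: length_concat comp_def)
  note o = st_act_ob_Obj[OF eps_T[OF assms(1)] assms(2)]
  have e: "map (\<lambda>x. eps P (tr x)) xs = map fst xs" using x(2) by simp
  have "snd (st_act_ob P (eps P t) xs) = concat (map snd xs)" by (simp add: st_act_ob)
  then show "parallel (length (concat (map snd xs))) (graft t (map tr xs)) (tr (st_act_ob P (eps P t) xs))"
    unfolding parallel_def eps_tr[OF o]
    using graft_T[OF assms(1) x(1)] tr_T[OF o] eps_graft_T[OF assms(1) x(1)]
    by (simp add: l e) (simp add: st_act_ob)
  show "set (concat (map snd xs)) \<subseteq> Obj C" using x(3) by auto
  show "h (graft t (map tr xs)) (concat (map snd xs)) = h t (map (st_val A) xs)"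
    using h_graft[OF assms(1) x(1) x(3)] by (simp add: st_val[abs_def])
qed

lemma
  assumes "t \<in> ops T (length xs)" "set xs \<subseteq> stO"
  shows st_coh_Arr: "st_coh t xs \<in> Arr C"
    and st_coh_Dom: "Dom C (st_coh t xs) = h t (map (st_val A) xs)"
    and st_coh_Cod: "Cod C (st_coh t xs) = st_val A (st_act_ob P (eps P t) xs)"
    and st_coh_iso: "is_iso C (st_coh t xs)"
  using st_objects[OF assms] coh_Arr coh_Dom coh_Cod coh_iso
  by (simp_all add: st_coh_def st_val) (simp_all add: st_act_ob)

text \<open>
  Write \<open>v x\<^sub>i\<close> as \<open>h(p\<^sub>i, as\<^sub>i)\<close>. Then the 2-cell from \<open>s\<close> to \<open>t\<close>, applied to the \<open>v x\<^sub>i\<close>, is the coherence arrow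
  between the grafted trees, and the claim is a composite of two coherence arrows.
\<close>

lemma st_coh_coh:
  assumes "parallel (length xs) s t" "set xs \<subseteq> stO"
  shows "Cmp C (st_coh t xs) (coh s t (map (st_val A) xs)) = st_coh s xs"
proof -
  have st: "s \<in> ops T (length xs)" "t \<in> ops T (length xs)" "eps P s = eps P t" using assms(1) by (auto simp: parallel_def)
  have x: "tr x \<in> ops T (length (snd x))" "set (snd x) \<subseteq> Obj C" if "x \<in> set xs" for x
    using that assms(2) tr_T by (auto simp: st_cat_simps(1))
  have p: "parallel (length (snd x)) (tr x) (tr x)" if "x \<in> set xs" for x using x(1)[OF that] by (simp add: parallel_def)
  note s = st_objects[OF st(1) assms(2)] and t = st_objects[OF st(2) assms(2)]
  have 1: "map (Idn C) (map (st_val A) xs) = map (\<lambda>x. coh (tr x) (tr x) (snd x)) xs"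
    using x by (simp add: coh_refl st_val)
  have "coh s t (map (st_val A) xs) = coh (graft s (map tr xs)) (graft t (map tr xs)) (concat (map snd xs))"
    unfolding coh_def[of s t] 1 by (rule coh_graft[OF assms(1) p x(2)])
  then show ?thesis
    unfolding st_coh_def st(3) using s t by (simp add: coh_trans parallel_def st(3))
qed

text \<open>
  The right-hand side first evaluates the subtrees \<open>\<tau>\<^sub>i\<close> and then the outer tree. Both factors are coherence
  arrows at the same list, and associativity of grafting and of \<open>P\<close> identifies the ends of their composite with
  those of the left-hand side.
\<close>

lemma st_coh_graft:
  assumes t: "t \<in> ops T (length is)" and \<tau>: "\<And>i. i \<in> set is \<Longrightarrow> \<tau> i \<in> ops T (length (X i))"
    and X: "\<And>i. i \<in> set is \<Longrightarrow> set (X i) \<subseteq> stO"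
  shows "st_coh (graft t (map \<tau> is)) (concat (map X is)) =
    Cmp C (st_coh t (map (\<lambda>i. st_act_ob P (eps P (\<tau> i)) (X i)) is)) (H (t, t) (map (\<lambda>i. st_coh (\<tau> i) (X i)) is))"
proof -
  let ?z = "\<lambda>i. st_act_ob P (eps P (\<tau> i)) (X i)"
  let ?zs = "map ?z is" and ?as = "\<lambda>i. concat (map snd (X i))"
  let ?g = "\<lambda>i. graft (\<tau> i) (map tr (X i))"
  have o: "parallel (length (?as i)) (?g i) (tr (?z i))" "set (?as i) \<subseteq> Obj C" if "i \<in> set is" for i
    by (rule st_objects[OF \<tau>[OF that] X[OF that]])+
  have z: "?z i \<in> stO" if "i \<in> set is" for i using st_act_ob_Obj[OF eps_T[OF \<tau>[OF that]] X[OF that]] .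
  have zs: "set ?zs \<subseteq> stO" using z by auto
  have sz: "snd (?z i) = ?as i" for i by (simp add: st_act_ob)
  have tz: "t \<in> ops T (length ?zs)" using t by simp
  note oz = st_objects[OF tz zs]
  have ptt: "parallel (length is) t t" using t by (simp add: parallel_def)
  have c: "concat (map snd ?zs) = concat (map ?as is)" by (simp add: comp_def sz)
  have c': "concat (map ?as is) = concat (map snd (concat (map X is)))" by (induction "is") auto
  have "H (t, t) (map (\<lambda>i. st_coh (\<tau> i) (X i)) is) =
      coh (graft t (map ?g is)) (graft t (map (\<lambda>i. tr (?z i)) is)) (concat (map ?as is))"
    unfolding st_coh_def by (rule coh_graft[OF ptt o(1,2)])
  moreover have "st_coh t ?zs = coh (graft t (map (\<lambda>i. tr (?z i)) is)) (tr (st_act_ob P (eps P t) ?zs)) (concat (map ?as is))"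
    unfolding st_coh_def c by (simp add: comp_def)
  moreover have "parallel (length (concat (map ?as is))) (graft t (map ?g is)) (graft t (map (\<lambda>i. tr (?z i)) is))"
  proof -
    have l: "length (concat (map ?as is)) = sum_list (map (\<lambda>i. length (?as i)) is)"
      by (simp add: length_concat comp_def)
    have g: "?g i \<in> ops T (length (?as i))" "tr (?z i) \<in> ops T (length (?as i))" "eps P (?g i) = eps P (tr (?z i))"
      if "i \<in> set is" for i
      using o(1)[OF that] by (auto simp: parallel_def)
    have m: "map (\<lambda>i. eps P (?g i)) is = map (\<lambda>i. eps P (tr (?z i))) is" using g(3) by simp
    show ?thesis
      unfolding parallel_def l
      using graft_T[OF t, of ?g, OF g(1)] graft_T[OF t, of "\<lambda>i. tr (?z i)", OF g(2)]
        eps_graft_T[OF t, of ?g, OF g(1)] eps_graft_T[OF t, of "\<lambda>i. tr (?z i)", OF g(2)] m by simp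
  qed
  moreover have "parallel (length (concat (map ?as is))) (graft t (map (\<lambda>i. tr (?z i)) is)) (tr (st_act_ob P (eps P t) ?zs))"
    using oz(1) unfolding c by (simp add: comp_def)
  moreover have "set (concat (map ?as is)) \<subseteq> Obj C" using oz(2) unfolding c .
  ultimately have 1: "Cmp C (st_coh t ?zs) (H (t, t) (map (\<lambda>i. st_coh (\<tau> i) (X i)) is)) =
      coh (graft t (map ?g is)) (tr (st_act_ob P (eps P t) ?zs)) (concat (map ?as is))"
    by (simp only: coh_trans)
  have 2: "graft t (map ?g is) = graft (graft t (map \<tau> is)) (map tr (concat (map X is)))"
    using graft_graft[of t "is" \<tau> "\<lambda>i. map tr (X i)"] t \<tau> by (simp add: free_operad_def map_concat comp_def)
  have 3: "st_act_ob P (eps P t) ?zs = st_act_ob P (eps P (graft t (map \<tau> is))) (concat (map X is))"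
    using st_act_ob_assoc[OF eps_T[OF t], of "\<lambda>i. eps P (\<tau> i)" X] eps_T[OF \<tau>] X
      eps_graft_T[OF t, of \<tau> "\<lambda>i. length (X i)"] \<tau> by simp
  show ?thesis unfolding 1 unfolding st_coh_def 2 3 c' ..
qed

lemma st_delta_eq: "q \<in> ops P (length xs) \<Longrightarrow> st_delta P A q xs = st_coh (corolla (length xs) q) xs"
  by (simp add: st_delta_def st_coh_def coh_def Let_def Wk_simps opc_T eps_corolla case_prod_unfold st_act_ob length_concat comp_def)

definition st_ar :: "'p \<Rightarrow> (('p \<times> 'o list) \<times> ('p \<times> 'o list) \<times> 'm) list \<Rightarrow> 'm" where
  "st_ar q fs = val (st_act_ar P A q fs)"

lemma st_act_ar: "st_act_ar P A q fs =
    (st_act_ob P q (map fst fs), st_act_ob P q (map (\<lambda>f. tgt f) fs), st_ar q fs)"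
  by (simp add: st_ar_def st_act_ar_def Let_def case_prod_unfold)

lemma st_lists:
  assumes "set fs \<subseteq> Arr (st_cat P A)"
  shows "set (map fst fs) \<subseteq> stO" "set (map (\<lambda>f. tgt f) fs) \<subseteq> stO" "set (map (\<lambda>f. val f) fs) \<subseteq> Arr C"
    "map (Dom C) (map (\<lambda>f. val f) fs) = map (st_val A) (map fst fs)"
    "map (Cod C) (map (\<lambda>f. val f) fs) = map (st_val A) (map (\<lambda>f. tgt f) fs)"
  using assms by (auto simp: st_cat_simps(2) Hom_def subset_iff)

lemma
  assumes q: "q \<in> ops P (length fs)" and fs: "set fs \<subseteq> Arr (st_cat P A)"
  shows st_ar_Arr: "st_ar q fs \<in> Arr C"
    and st_ar_Dom: "Dom C (st_ar q fs) = st_val A (st_act_ob P q (map fst fs))"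
    and st_ar_Cod: "Cod C (st_ar q fs) = st_val A (st_act_ob P q (map (\<lambda>f. tgt f) fs))"
    and st_ar_corolla: "Cmp C (st_ar q fs) (st_coh (corolla (length fs) q) (map fst fs)) =
      Cmp C (st_coh (corolla (length fs) q) (map (\<lambda>f. tgt f) fs))
        (H (corolla (length fs) q, corolla (length fs) q) (map (\<lambda>f. val f) fs))"
proof -
  let ?c = "corolla (length fs) q"
  note l = st_lists[OF fs]
  have q': "q \<in> ops P (length (map fst fs))" "q \<in> ops P (length (map (\<lambda>f. tgt f) fs))" using q by simp_all
  have c: "?c \<in> ops T (length (map fst fs))" "?c \<in> ops T (length (map (\<lambda>f. tgt f) fs))" using corolla_T[OF q] by simp_all
  have cc: "parallel (length (map (\<lambda>f. val f) fs)) ?c ?c" using corolla_T[OF q] by (simp add: parallel_def)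
  note [simp] = st_coh_Arr[OF c(1) l(1)] st_coh_Dom[OF c(1) l(1)] st_coh_Cod[OF c(1) l(1)] st_coh_iso[OF c(1) l(1)]
    st_coh_Arr[OF c(2) l(2)] st_coh_Dom[OF c(2) l(2)] st_coh_Cod[OF c(2) l(2)]
    H_Arr[OF cc l(3)] H_Dom[OF cc l(3)] H_Cod[OF cc l(3)] l eps_corolla[OF q]
  have "st_ar q fs = Cmp C (st_coh ?c (map (\<lambda>f. tgt f) fs))
     (Cmp C (H (?c, ?c) (map (\<lambda>f. val f) fs)) (inv_arr C (st_coh ?c (map fst fs))))"
    using st_delta_eq[OF q'(1)] st_delta_eq[OF q'(2)]
    by (simp add: st_ar_def st_act_ar_def Let_def case_prod_unfold Wk_simps)
  then show "st_ar q fs \<in> Arr C" "Dom C (st_ar q fs) = st_val A (st_act_ob P q (map fst fs))"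
    "Cod C (st_ar q fs) = st_val A (st_act_ob P q (map (\<lambda>f. tgt f) fs))"
    "Cmp C (st_ar q fs) (st_coh ?c (map fst fs)) = Cmp C (st_coh ?c (map (\<lambda>f. tgt f) fs)) (H (?c, ?c) (map (\<lambda>f. val f) fs))"
    by (simp_all del: map_map)
qed

text \<open>
  The action was defined with the corolla of \<open>\<epsilon>(s)\<close>. Passing from \<open>s\<close> to this corolla and from there to \<open>t\<close>
  changes both comparison isomorphisms only by the 2-cells between these trees.
\<close>

lemma st_ar_natural:
  assumes st: "parallel (length fs) s t" and fs: "set fs \<subseteq> Arr (st_cat P A)"
  shows "Cmp C (st_ar (eps P s) fs) (st_coh s (map fst fs)) =
      Cmp C (st_coh t (map (\<lambda>f. tgt f) fs)) (H (s, t) (map (\<lambda>f. val f) fs))"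
proof -
  let ?q = "eps P s" and ?c = "corolla (length fs) (eps P s)"
  let ?v = "map (\<lambda>f. val f) fs" and ?xs = "map fst fs" and ?ys = "map (\<lambda>f. tgt f) fs"
  note l = st_lists[OF fs]
  have q: "?q \<in> ops P (length fs)" using st by (auto simp: parallel_def eps_T)
  have c: "?c \<in> ops T (length fs)" "eps P ?c = ?q" using q by (simp_all add: corolla_T eps_corolla)
  have p: "parallel (length ?xs) s ?c" "parallel (length ?ys) t ?c" "parallel (length ?ys) s t"
    "parallel (length ?v) ?c ?c" "parallel (length ?v) s ?c" "parallel (length ?v) s t" "parallel (length ?v) t ?c"
    using st c by (auto simp: parallel_def)
  have cx: "?c \<in> ops T (length ?xs)" "?c \<in> ops T (length ?ys)" using c by simp_all
  have v: "parallel (length (map (st_val A) ?xs)) s ?c" "parallel (length (map (st_val A) ?ys)) t ?c"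
    "set (map (st_val A) ?xs) \<subseteq> Obj C" "set (map (st_val A) ?ys) \<subseteq> Obj C"
    using p l(1,2) st_val_Obj by auto
  note [simp] = st_coh_Arr[OF cx(1) l(1)] st_coh_Dom[OF cx(1) l(1)] st_coh_Cod[OF cx(1) l(1)]
    st_coh_Arr[OF cx(2) l(2)] st_coh_Dom[OF cx(2) l(2)] st_coh_Cod[OF cx(2) l(2)]
    H_Arr[OF p(4) l(3)] H_Dom[OF p(4) l(3)] H_Cod[OF p(4) l(3)]
    H_Arr[OF p(6) l(3)] H_Dom[OF p(6) l(3)] H_Cod[OF p(6) l(3)] l c
    st_ar_Arr[OF q fs] st_ar_Dom[OF q fs] st_ar_Cod[OF q fs]
    coh_Arr[OF v(1,3)] coh_Dom[OF v(1,3)] coh_Cod[OF v(1,3)]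
    coh_Arr[OF v(2,4)] coh_Dom[OF v(2,4)] coh_Cod[OF v(2,4)]
  have "Cmp C (st_ar ?q fs) (st_coh s ?xs) =
      Cmp C (Cmp C (st_ar ?q fs) (st_coh ?c ?xs)) (coh s ?c (map (st_val A) ?xs))"
    unfolding st_coh_coh[OF p(1) l(1), symmetric] by (simp del: map_map)
  also have "\<dots> = Cmp C (st_coh ?c ?ys) (Cmp C (H (?c, ?c) ?v) (coh s ?c (map (Dom C) ?v)))"
    unfolding st_ar_corolla[OF q fs] l by (simp del: map_map)
  also have "\<dots> = Cmp C (st_coh ?c ?ys) (Cmp C (coh t ?c (map (Cod C) ?v)) (H (s, t) ?v))"
    unfolding coh_H(2)[OF p(5,4) l(3)] coh_H(1)[OF p(6,7) l(3)] ..
  also have "\<dots> = Cmp C (st_coh t ?ys) (H (s, t) ?v)"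
    unfolding st_coh_coh[OF p(2) l(2), symmetric] l by (simp del: map_map)
  finally show ?thesis .
qed

text \<open>Every axiom for the action on arrows is proved by exhibiting a solution of this equation.\<close>

lemma st_ar_unique:
  assumes t: "t \<in> ops T (length fs)" and fs: "set fs \<subseteq> Arr (st_cat P A)"
    and g: "g \<in> Arr C" "Dom C g = st_val A (st_act_ob P (eps P t) (map fst fs))"
    and eq: "Cmp C g (st_coh t (map fst fs)) =
      Cmp C (st_coh t (map (\<lambda>f. tgt f) fs)) (H (t, t) (map (\<lambda>f. val f) fs))"
  shows "st_ar (eps P t) fs = g"
proof -
  have x: "t \<in> ops T (length (map fst fs))" and tt: "parallel (length fs) t t" using t by (simp_all add: parallel_def)
  show ?thesis
    by (rule base.iso_cancel_right[OF st_coh_iso[OF x st_lists(1)[OF fs]]])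
      (use eq g st_ar_natural[OF tt fs] st_ar_Arr[OF eps_T[OF t] fs] st_ar_Dom[OF eps_T[OF t] fs]
          st_coh_Cod[OF x st_lists(1)[OF fs]] in simp_all)
qed

end

section \<open>The strictification is a strict \<open>P\<close>-category\<close>

lemma D_star_simps:
  "Obj (cells (D_star P) n) = ops P n" "Arr (cells (D_star P) n) = ops P n"
  "Dom (cells (D_star P) n) p = p" "Cod (cells (D_star P) n) p = p" "Idn (cells (D_star P) n) p = p"
  "Cmp (cells (D_star P) n) p' p = p"
  "ob (gam (D_star P) ks) (p, ps) = opc P ks p ps" "ar (gam (D_star P) ks) (p, ps) = opc P ks p ps"
  "unt (D_star P) = opu P"
  by (simp_all add: D_star_def discrete_cat_def)

lemma category_D_star_cells: "category (cells (D_star P) n)"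
  by (simp add: D_star_def category_discrete_cat)

lemma list_all2_zip_index:
  assumes "list_all2 R as bs"
  shows "map fst (zip as bs) = as" "map snd (zip as bs) = bs" "length (zip as bs) = length as"
    "i \<in> set (zip as bs) \<Longrightarrow> R (fst i) (snd i)"
  using assms by (auto simp: list_all2_iff)

context weak_P_cat begin

lemma st_act_ar_Arr:
  assumes q: "q \<in> ops P (length fs)" and fs: "set fs \<subseteq> Arr (st_cat P A)"
  shows "st_act_ar P A q fs \<in> Arr (st_cat P A)"
  using st_act_ob_Obj[of q "map fst fs"] st_act_ob_Obj[of q "map (\<lambda>f. tgt f) fs"] st_lists[OF fs] q
    st_ar_Arr[OF q fs] st_ar_Dom[OF q fs] st_ar_Cod[OF q fs]
  by (simp add: st_act_ar st_cat_simps(2) Hom_def)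

lemma st_ar_Idn:
  assumes q: "q \<in> ops P (length xs)" and xs: "set xs \<subseteq> stO"
  shows "st_ar q (map (Idn (st_cat P A)) xs) = Idn C (st_val A (st_act_ob P q xs))"
proof -
  let ?t = "corolla (length xs) q" and ?fs = "map (Idn (st_cat P A)) xs"
  have t: "?t \<in> ops T (length xs)" "?t \<in> ops T (length ?fs)" using corolla_T[OF q] by simp_all
  have m: "map fst ?fs = xs" "map (\<lambda>f. tgt f) ?fs = xs" "map (\<lambda>f. val f) ?fs = map (Idn C) (map (st_val A) xs)"
    by (auto simp: st_cat_simps(5) map_idI)
  have v: "set (map (st_val A) xs) \<subseteq> Obj C" using xs st_val_Obj by auto
  have H: "H (?t, ?t) (map (Idn C) (map (st_val A) xs)) = Idn C (h ?t (map (st_val A) xs))"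
    using coh_refl[of ?t "map (st_val A) xs"] t v by (simp add: coh_def)
  have fs: "set ?fs \<subseteq> Arr (st_cat P A)" using xs by (auto simp: category.Idn_Arr[OF category_st_cat])
  note o = st_val_Obj[OF st_act_ob_Obj[OF q xs]]
  note [simp] = st_coh_Arr[OF t(1) xs] st_coh_Dom[OF t(1) xs] st_coh_Cod[OF t(1) xs] o eps_corolla[OF q]
  have "st_ar (eps P ?t) ?fs = Idn C (st_val A (st_act_ob P q xs))"
    by (rule st_ar_unique[OF t(2) fs]) (simp_all add: m H del: map_map)
  then show ?thesis by simp
qed

lemma st_ar_Cmp:
  assumes q: "q \<in> ops P (length fs)" and fs: "set fs \<subseteq> Arr (st_cat P A)" and gs: "set gs \<subseteq> Arr (st_cat P A)"
    and gf: "map fst gs = map (\<lambda>f. tgt f) fs"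
  shows "st_ar q (map2 (Cmp (st_cat P A)) gs fs) = Cmp C (st_ar q gs) (st_ar q fs)"
proof -
  let ?t = "corolla (length fs) q" and ?ks = "map2 (Cmp (st_cat P A)) gs fs"
  have l: "length gs = length fs" using arg_cong[OF gf, of length] by simp
  have qg: "q \<in> ops P (length gs)" using q l by simp
  have m: "map fst ?ks = map fst fs" "map (\<lambda>f. tgt f) ?ks = map (\<lambda>f. tgt f) gs"
    "map (\<lambda>f. val f) ?ks = map2 (Cmp C) (map (\<lambda>f. val f) gs) (map (\<lambda>f. val f) fs)"
    using l by (auto intro!: nth_equalityI simp: st_cat_simps(6))
  have ks: "set ?ks \<subseteq> Arr (st_cat P A)"
    using map2_Cmp_lists(1)[OF category_st_cat fs gs] gf by (simp add: st_cat_simps(3,4))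
  note lf = st_lists[OF fs] and lg = st_lists[OF gs]
  have t: "?t \<in> ops T (length (map fst fs))" "?t \<in> ops T (length (map (\<lambda>f. tgt f) fs))"
    "?t \<in> ops T (length (map (\<lambda>f. tgt f) gs))" "?t \<in> ops T (length ?ks)"
    using corolla_T[OF q] l by simp_all
  have p: "parallel (length (map (\<lambda>f. val f) fs)) ?t ?t" "parallel (length (map (\<lambda>f. val f) gs)) ?t ?t"
    using corolla_T[OF q] l by (simp_all add: parallel_def)
  note [simp] = st_coh_Arr[OF t(1) lf(1)] st_coh_Dom[OF t(1) lf(1)] st_coh_Cod[OF t(1) lf(1)]
    st_coh_Arr[OF t(2) lf(2)] st_coh_Dom[OF t(2) lf(2)] st_coh_Cod[OF t(2) lf(2)]
    st_coh_Arr[OF t(3) lg(2)] st_coh_Dom[OF t(3) lg(2)] st_coh_Cod[OF t(3) lg(2)]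
    H_Arr[OF p(1) lf(3)] H_Dom[OF p(1) lf(3)] H_Cod[OF p(1) lf(3)]
    H_Arr[OF p(2) lg(3)] H_Dom[OF p(2) lg(3)] H_Cod[OF p(2) lg(3)] lf lg gf
    st_ar_Arr[OF q fs] st_ar_Dom[OF q fs] st_ar_Cod[OF q fs]
    st_ar_Arr[OF qg gs] st_ar_Dom[OF qg gs] st_ar_Cod[OF qg gs] eps_corolla[OF q]
  have "st_ar (eps P ?t) ?ks = Cmp C (st_ar q gs) (st_ar q fs)"
  proof (rule st_ar_unique[OF t(4) ks], unfold m)
    have "Cmp C (Cmp C (st_ar q gs) (st_ar q fs)) (st_coh ?t (map fst fs)) =
      Cmp C (st_ar q gs) (Cmp C (st_ar q fs) (st_coh ?t (map fst fs)))" by (simp del: map_map)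
    also have "\<dots> = Cmp C (Cmp C (st_ar q gs) (st_coh ?t (map fst gs))) (H (?t, ?t) (map (\<lambda>f. val f) fs))"
      unfolding st_ar_corolla[OF q fs] gf by (simp del: map_map)
    also have "\<dots> = Cmp C (st_coh ?t (map (\<lambda>f. tgt f) gs)) (Cmp C (H (?t, ?t) (map (\<lambda>f. val f) gs)) (H (?t, ?t) (map (\<lambda>f. val f) fs)))"
      using st_ar_corolla[OF qg gs] l by (simp del: map_map)
    also have "Cmp C (H (?t, ?t) (map (\<lambda>f. val f) gs)) (H (?t, ?t) (map (\<lambda>f. val f) fs)) =
        H (?t, ?t) (map2 (Cmp C) (map (\<lambda>f. val f) gs) (map (\<lambda>f. val f) fs))"
      by (rule H_Cmp[OF p(1,1) lf(3) lg(3)]) (simp del: map_map)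
    finally show "Cmp C (Cmp C (st_ar q gs) (st_ar q fs)) (st_coh ?t (map fst fs)) =
      Cmp C (st_coh ?t (map (\<lambda>f. tgt f) gs)) (H (?t, ?t) (map2 (Cmp C) (map (\<lambda>f. val f) gs) (map (\<lambda>f. val f) fs)))" .
  qed (simp_all del: map_map)
  then show ?thesis by simp
qed

text \<open>
  Both sides solve the equation that characterises the action of the tree obtained by grafting the corollas of the \<open>r\<^sub>i\<close> onto
  the corolla of \<open>q\<close>. For the right-hand side, split the comparison isomorphism of that tree, and
  move the outer action past the outer factor and the inner actions past the inner factors.
\<close>

lemma st_ar_gam:
  assumes q: "q \<in> ops P (length is)" and r: "\<And>i. i \<in> set is \<Longrightarrow> r i \<in> ops P (length (F i))"
    and F: "\<And>i. i \<in> set is \<Longrightarrow> set (F i) \<subseteq> Arr (st_cat P A)"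
  shows "st_ar (opc P (map (\<lambda>i. length (F i)) is) q (map r is)) (concat (map F is)) =
    st_ar q (map (\<lambda>i. st_act_ar P A (r i) (F i)) is)"
proof -
  let ?c = "corolla (length is) q" and ?\<tau> = "\<lambda>i. corolla (length (F i)) (r i)"
  let ?t = "graft ?c (map ?\<tau> is)" and ?fs = "concat (map F is)"
  let ?gs = "map (\<lambda>i. st_act_ar P A (r i) (F i)) is"
  let ?X = "\<lambda>i. map fst (F i)" and ?Y = "\<lambda>i. map (\<lambda>f. tgt f) (F i)" and ?V = "\<lambda>i. map (\<lambda>f. val f) (F i)"
  let ?\<theta> = "map (\<lambda>i. st_coh (?\<tau> i) (?X i)) is" and ?\<theta>' = "map (\<lambda>i. st_coh (?\<tau> i) (?Y i)) is"
  let ?v = "map (\<lambda>f. val f) ?gs"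
  let ?HV = "map (\<lambda>i. H (?\<tau> i, ?\<tau> i) (?V i)) is"
  have c: "?c \<in> ops T (length is)" "eps P ?c = q" using q by (simp_all add: corolla_T eps_corolla)
  have \<tau>: "?\<tau> i \<in> ops T (length (F i))" "eps P (?\<tau> i) = r i" "?\<tau> i \<in> ops T (length (?X i))" "?\<tau> i \<in> ops T (length (?Y i))"
     "parallel (length (?V i)) (?\<tau> i) (?\<tau> i)"
    if "i \<in> set is" for i
    using r[OF that] by (simp_all add: corolla_T eps_corolla parallel_def)
  note l = st_lists[OF F]
  have t: "?t \<in> ops T (length ?fs)" using graft_T[OF c(1), of ?\<tau>, OF \<tau>(1)] by (simp add: length_concat comp_def)
  have et: "eps P ?t = opc P (map (\<lambda>i. length (F i)) is) q (map r is)"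
    using eps_graft_T[OF c(1), of ?\<tau> "\<lambda>i. length (F i)", OF \<tau>(1)] \<tau>(2) by (simp add: c cong: map_cong)
  have fs: "set ?fs \<subseteq> Arr (st_cat P A)" using F by auto
  have gs: "set ?gs \<subseteq> Arr (st_cat P A)" using st_act_ar_Arr[OF r F] by auto
  have qg: "q \<in> ops P (length ?gs)" using q by simp
  have mX: "map fst ?fs = concat (map ?X is)" "map (\<lambda>f. tgt f) ?fs = concat (map ?Y is)" "map (\<lambda>f. val f) ?fs = concat (map ?V is)"
    by (simp_all add: map_concat comp_def)
  have gX: "map fst ?gs = map (\<lambda>i. st_act_ob P (eps P (?\<tau> i)) (?X i)) is"
    "map (\<lambda>f. tgt f) ?gs = map (\<lambda>i. st_act_ob P (eps P (?\<tau> i)) (?Y i)) is"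
    using \<tau>(2) by (simp_all add: st_act_ar)
  have v: "?v = map (\<lambda>i. st_ar (r i) (F i)) is" by (simp add: st_act_ar)
  have gX': "st_coh ?t (concat (map ?X is)) = Cmp C (st_coh ?c (map fst ?gs)) (H (?c, ?c) ?\<theta>)"
    unfolding gX by (rule st_coh_graft[OF c(1)]) (use \<tau>(3) l(1) in blast)+
  have gY': "st_coh ?t (concat (map ?Y is)) = Cmp C (st_coh ?c (map (\<lambda>f. tgt f) ?gs)) (H (?c, ?c) ?\<theta>')"
    unfolding gX by (rule st_coh_graft[OF c(1)]) (use \<tau>(4) l(2) in blast)+
  note lg = st_lists[OF gs]
  have cg: "?c \<in> ops T (length (map fst ?gs))" "?c \<in> ops T (length (map (\<lambda>f. tgt f) ?gs))" using c by simp_all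
  have cc: "parallel (length is) ?c ?c" "parallel (length ?\<theta>) ?c ?c" "parallel (length ?\<theta>') ?c ?c"
     "parallel (length ?v) ?c ?c" "parallel (length ?HV) ?c ?c"
    using c by (simp_all add: parallel_def)
  have \<theta>: "set ?\<theta> \<subseteq> Arr C" "map (Cod C) ?\<theta> = map (st_val A) (map fst ?gs)"
    "set ?\<theta>' \<subseteq> Arr C" "map (Cod C) ?\<theta>' = map (st_val A) (map (\<lambda>f. tgt f) ?gs)"
    "map (Dom C) ?\<theta>' = map (\<lambda>i. h (?\<tau> i) (map (st_val A) (?Y i))) is"
    using st_coh_Arr[OF \<tau>(3) l(1)] st_coh_Arr[OF \<tau>(4) l(2)] st_coh_Cod[OF \<tau>(3) l(1)] st_coh_Cod[OF \<tau>(4) l(2)]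
      st_coh_Dom[OF \<tau>(4) l(2)]
    unfolding gX by auto
  have HC: "Cod C (H (?\<tau> i, ?\<tau> i) (?V i)) = h (?\<tau> i) (map (st_val A) (?Y i))" if "i \<in> set is" for i
    using H_Cod[OF \<tau>(5)[OF that] l(3)[OF that]] unfolding l(5)[OF that] .
  have HV: "set ?HV \<subseteq> Arr C" "map (Cod C) ?HV = map (Dom C) ?\<theta>'"
    using H_Arr[OF \<tau>(5) l(3)] HC unfolding \<theta>(5) by auto
  have HG: "H (?t, ?t) (concat (map ?V is)) = H (?c, ?c) ?HV"
    by (rule H_graft[OF cc(1)]) (use \<tau>(5) l(3) in blast)+
  \<comment> \<open>The inner actions move past the inner comparison isomorphisms.\<close>
  have step: "map2 (Cmp C) ?v ?\<theta> = map2 (Cmp C) ?\<theta>' ?HV"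
    using st_ar_corolla[OF r F] unfolding v by (auto intro!: nth_equalityI)
  note [simp] = st_coh_Arr[OF cg(1) lg(1)] st_coh_Dom[OF cg(1) lg(1)] st_coh_Cod[OF cg(1) lg(1)]
    st_coh_Arr[OF cg(2) lg(2)] st_coh_Dom[OF cg(2) lg(2)] st_coh_Cod[OF cg(2) lg(2)]
    H_Arr[OF cc(2) \<theta>(1)] H_Dom[OF cc(2) \<theta>(1)] H_Cod[OF cc(2) \<theta>(1)] 
    H_Arr[OF cc(3) \<theta>(3)] H_Dom[OF cc(3) \<theta>(3)] H_Cod[OF cc(3) \<theta>(3)] 
    H_Arr[OF cc(5) HV(1)] H_Dom[OF cc(5) HV(1)] H_Cod[OF cc(5) HV(1)] 
    H_Arr[OF cc(4) lg(3)] H_Dom[OF cc(4) lg(3)] H_Cod[OF cc(4) lg(3)] 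
    st_ar_Arr[OF qg gs] st_ar_Dom[OF qg gs] st_ar_Cod[OF qg gs] c
  have len: "length ?gs = length is" by simp
  have "st_ar (eps P ?t) ?fs = st_ar q ?gs"
  proof (rule st_ar_unique[OF t fs])
    have o: "st_act_ob P (eps P ?t) (concat (map ?X is)) = st_act_ob P q (map fst ?gs)"
      unfolding gX et using st_act_ob_assoc[OF q, of r ?X] r l(1) \<tau>(2) by (simp cong: map_cong)
    show "Dom C (st_ar q ?gs) = st_val A (st_act_ob P (eps P ?t) (map fst ?fs))"
      unfolding mX o by (simp del: map_map)
    have "Cmp C (st_ar q ?gs) (st_coh ?t (map fst ?fs)) =
        Cmp C (Cmp C (st_ar q ?gs) (st_coh ?c (map fst ?gs))) (H (?c, ?c) ?\<theta>)"
      unfolding mX gX' using \<theta> lg by (simp del: map_map)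
    also have "\<dots> = Cmp C (st_coh ?c (map (\<lambda>f. tgt f) ?gs)) (Cmp C (H (?c, ?c) ?v) (H (?c, ?c) ?\<theta>))"
      using st_ar_corolla[OF qg gs] \<theta> lg unfolding len by (simp del: map_map)
    also have "Cmp C (H (?c, ?c) ?v) (H (?c, ?c) ?\<theta>) = H (?c, ?c) (map2 (Cmp C) ?v ?\<theta>)"
      by (rule H_Cmp[OF cc(2,2) \<theta>(1) lg(3)]) (simp only: \<theta> lg)
    also have "\<dots> = Cmp C (H (?c, ?c) ?\<theta>') (H (?c, ?c) ?HV)"
      unfolding step by (rule H_Cmp[OF cc(5,5) HV(1) \<theta>(3), symmetric]) (simp only: HV)
    finally show "Cmp C (st_ar q ?gs) (st_coh ?t (map fst ?fs)) =
        Cmp C (st_coh ?t (map (\<lambda>f. tgt f) ?fs)) (H (?t, ?t) (map (\<lambda>f. val f) ?fs))"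
      unfolding mX gY' HG using \<theta> lg HV
      by (simp del: map_map)
  qed (simp del: map_map)
  then show ?thesis unfolding et .
qed

text \<open>The operadic unit is the value of the unit tree, at which the comparison isomorphisms are identities.\<close>

lemma st_ar_unt:
  assumes f: "f \<in> Arr (st_cat P A)" shows "st_ar (opu P) [f] = val f"
proof -
  have [simp]: "st_act_ob P (opu P) [x] = x" if "x \<in> stO" for x
    using that opc_opu_left by (cases x) (simp add: st_act_ob st_cat_simps(1))
  have [simp]: "st_coh Leaf [x] = Idn C (st_val A x)" if "x \<in> stO" for x
    using that coh_refl[OF tr_T[OF that]] by (simp add: st_coh_def st_val st_cat_simps(1))
  have [simp]: "H (Leaf, Leaf) [g] = g" if "g \<in> Arr C" for g
    using act_unt_ar[OF that] by (simp add: Wk_simps opu_T)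
  have "st_ar (eps P Leaf) [f] = val f"
    by (rule st_ar_unique) (use f in \<open>auto simp: Leaf_T st_cat_simps(2) Hom_def st_val_Obj\<close>)
  then show ?thesis by simp
qed

text \<open>
  On objects the axioms are those of \<open>P\<close>; on arrows, sources and targets are covered by the statement on
  objects, and the underlying arrows of \<open>A\<close> by the preceding lemmas.
\<close>

theorem strict_P_category_strictification: "strict_P_category P (strictification P A)"
proof -
  let ?S = "st_cat P A"
  interpret S: category ?S by (rule category_st_cat)
  have s: "base (strictification P A) = ?S" "ob (act (strictification P A)) (q, xs) = st_act_ob P q xs"
    "ar (act (strictification P A)) (q, fs) = st_act_ar P A q fs" for q xs fs
    by (simp_all add: strictification_def)
  show ?thesis
  proof (rule cat_algebra.intro[OF plain_cat_operad_D_star], unfold s)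
    show "category ?S" by (rule category_st_cat)
    show "cat_algebra_axioms (D_star P) (strictification P A)"
    proof (rule cat_algebra_axioms.intro, unfold s D_star_simps pow_cat_Obj_blocks pow_cat_Arr_blocks, goal_cases)
      case (1 n)
      show ?case
      proof (rule cat_functorI, goal_cases)
        case (3 x)
        then show ?case using st_act_ob_Obj by (cases x) (auto simp: prod_pow_simps D_star_simps s)
      next
        case (4 f)
        obtain q fs where f: "f = (q, fs)" by (cases f)
        have l: "length fs = n" "q \<in> ops P (length fs)" "set fs \<subseteq> Arr ?S"
          using 4 by (simp_all add: f prod_pow_simps D_star_simps)
        have d: "Dom ?S (st_act_ar P A q fs) = st_act_ob P q (map (Dom ?S) fs)"
          "Cod ?S (st_act_ar P A q fs) = st_act_ob P q (map (Cod ?S) fs)"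
          unfolding st_act_ar st_cat_simps(3,4) by simp_all
        show ?case using st_act_ar_Arr[OF l(2,3)] d l(1)
          by (simp add: f prod_pow_simps D_star_simps s Hom_def)
      next
        case (5 x)
        obtain q xs where x: "x = (q, xs)" by (cases x)
        have l: "length xs = n" "q \<in> ops P (length xs)" "set xs \<subseteq> stO"
          using 5 by (simp_all add: x prod_pow_simps D_star_simps)
        have m: "map fst (map (Idn ?S) xs) = xs" "map (\<lambda>f. tgt f) (map (Idn ?S) xs) = xs"
          by (simp_all add: st_cat_simps(5) map_idI)
        have "st_act_ar P A q (map (Idn ?S) xs) = Idn ?S (st_act_ob P q xs)"
          unfolding st_act_ar m st_ar_Idn[OF l(2,3)] st_cat_simps(5) ..
        then show ?case using l(1) by (simp add: x prod_pow_simps D_star_simps s)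
      next
        case (6 f g)
        obtain q fs q' gs where f: "f = (q, fs)" "g = (q', gs)" by (cases f, cases g)
        have l: "length fs = n" "length gs = n" "q' = q" "q \<in> ops P (length fs)" "set fs \<subseteq> Arr ?S" "set gs \<subseteq> Arr ?S"
          "map (Dom ?S) gs = map (Cod ?S) fs"
          using 6 by (simp_all add: f prod_pow_simps D_star_simps)
        have d: "map fst gs = map (\<lambda>f. tgt f) fs"
          using l(7) unfolding st_cat_simps(3,4) .
        have m: "map fst (map2 (Cmp ?S) gs fs) = map fst fs" "map (\<lambda>f. tgt f) (map2 (Cmp ?S) gs fs) = map (\<lambda>f. tgt f) gs"
          using l(1,2) by (auto intro!: nth_equalityI simp: st_cat_simps(6))
        have "st_act_ar P A q (map2 (Cmp ?S) gs fs) = Cmp ?S (st_act_ar P A q gs) (st_act_ar P A q fs)"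
          unfolding st_cat_simps(6)[of "st_act_ar P A q gs"]
          unfolding st_act_ar m st_ar_Cmp[OF l(4-6) d] by simp
        then show ?case using l(1-3) by (simp add: f prod_pow_simps D_star_simps s)
      qed (auto intro!: category_prod_cat category_pow_cat category_D_star_cells category_st_cat)
    next
      case (2 q ks rs xss)
      then have z: "list_all2 (\<lambda>r xs. r \<in> ops P (length xs)) rs xss"
        by (auto simp: list_all2_conv_all_nth)
      let ?is = "zip rs xss"
      note i = list_all2_zip_index[OF z]
      have m: "map (ob (act (strictification P A))) ?is = map (\<lambda>i. st_act_ob P (fst i) (snd i)) ?is"
        by (auto simp: s)
      have "set (snd i) \<subseteq> stO" if "i \<in> set ?is" for i
        using 2(3) that by (cases i) (auto dest: set_zip_rightD)
      moreover have "map (\<lambda>i. length (snd i)) ?is = ks"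
        using 2(3) arg_cong[OF i(2), of "map length"] by (simp add: comp_def)
      ultimately show ?case using st_act_ob_assoc[of q ?is fst snd] 2 i unfolding m by (simp add: list_all2_lengthD[OF z])
    next
      case (3 q ks rs fss)
      then have z: "list_all2 (\<lambda>r xs. r \<in> ops P (length xs)) rs fss"
        by (auto simp: list_all2_conv_all_nth)
      let ?is = "zip rs fss"
      note i = list_all2_zip_index[OF z]
      have m: "map (ar (act (strictification P A))) ?is = map (\<lambda>i. st_act_ar P A (fst i) (snd i)) ?is"
        by (auto simp: s)
      have F: "set (snd i) \<subseteq> Arr ?S" if "i \<in> set ?is" for i
        using 3(3) that by (cases i) (auto dest: set_zip_rightD)
      note l = st_lists[OF F]
      have k: "map (\<lambda>i. length (snd i)) ?is = ks"
        using 3(3) arg_cong[OF i(2), of "map length"] by (simp add: comp_def)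
      have q: "q \<in> ops P (length ?is)" using 3 i by (simp add: list_all2_lengthD[OF z])
      have n: "map (\<lambda>i. map k (snd i)) ?is = map (map k) fss" for k :: "_ \<Rightarrow> 'p \<times> 'o list"
        using arg_cong[OF i(2), of "map (map k)"] by (simp add: comp_def)
      show ?case
        using st_ar_gam[OF q, of fst snd] st_act_ob_assoc[OF q, of fst "\<lambda>i. map fst (snd i)"]
          st_act_ob_assoc[OF q, of fst "\<lambda>i. map (\<lambda>f. tgt f) (snd i)"] i F l(1,2) k
        unfolding m by (simp add: st_act_ar map_concat comp_def n)
    next
      case (4 x)
      then show ?case using opc_opu_left by (cases x) (simp add: st_act_ob st_cat_simps(1))
    next
      case (5 f)
      have "st_act_ob P (opu P) [x] = x" if "x \<in> stO" for x
        using that opc_opu_left by (cases x) (simp add: st_act_ob st_cat_simps(1))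
      then show ?case using st_ar_unt[OF 5] 5 by (simp add: st_act_ar st_cat_simps(2))
    qed
  qed
qed

end

section \<open>The equivalence\<close>

text \<open>
  Restriction of the action along a map of Cat-operads; that \<open>\<epsilon>\<close> is such a map is its
  compatibility with grafting.
\<close>

lemma (in plain_operad) weak_P_category_strict_as_weak:
  assumes "strict_P_category P X" shows "weak_P_category P (strict_as_weak P X)"
proof -
  interpret X: cat_algebra "D_star P" X by fact
  have s: "base (strict_as_weak P X) = base X" "ob (act (strict_as_weak P X)) (t, as) = ob (act X) (eps P t, as)"
    "ar (act (strict_as_weak P X)) (c, fs) = ar (act X) (eps P (fst c), fs)" for t as c fs
    by (simp_all add: strict_as_weak_def Wk_to_D_star_def split_beta)
  have e: "eps P (graft t ts) = opc P ks (eps P t) (map (eps P) ts)"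
      "list_all2 (\<lambda>k r. r \<in> ops P k) ks (map (eps P) ts)" "eps P t \<in> ops P (length ks)"
    if "t \<in> ops T (length ks)" "list_all2 (\<lambda>k t. t \<in> ops T k) ks ts" for t ks ts
  proof -
    have i: "map snd (zip ks ts) = ts" "map fst (zip ks ts) = ks" "length (zip ks ts) = length ks"
      "\<And>i. i \<in> set (zip ks ts) \<Longrightarrow> snd i \<in> ops T (fst i)"
      using list_all2_zip_index[OF that(2)] by auto
    have "map (eps P) ts = map (\<lambda>i. eps P (snd i)) (zip ks ts)"
      using arg_cong[OF i(1), of "map (eps P)"] by (simp add: comp_def)
    then show "eps P (graft t ts) = opc P ks (eps P t) (map (eps P) ts)"
      using eps_graft_T[of t "zip ks ts" snd fst] i that(1) by simp
    show "list_all2 (\<lambda>k r. r \<in> ops P k) ks (map (eps P) ts)" "eps P t \<in> ops P (length ks)"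
      using that eps_T by (auto simp: list_all2_conv_all_nth)
  qed
  show ?thesis
  proof (rule cat_algebra.intro[OF plain_cat_operad_Wk], unfold s)
    show "category (base X)" by (rule X.base.category_axioms)
    show "cat_algebra_axioms (Wk P) (strict_as_weak P X)"
    proof (rule cat_algebra_axioms.intro, unfold s, goal_cases)
      case (1 n)
      interpret a: cat_functor "prod_cat (cells (D_star P) n) (pow_cat (base X) n)" "base X" "act X"
        by (rule X.functor_act)
      show ?case
      proof (rule cat_functorI, goal_cases)
        case (3 x)
        then show ?case
          using eps_T[of "fst x" n] X.act_Obj[of "eps P (fst x)" n "snd x"]
          by (cases x) (simp add: prod_pow_simps s Wk_simps D_star_simps)
      next
        case (4 f)
        then obtain t u fs where f: "f = ((t, u), fs)" "t \<in> ops T n" "u \<in> ops T n" "eps P t = eps P u"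
          "length fs = n" "set fs \<subseteq> Arr (base X)"
          by (cases f) (auto simp: prod_pow_simps Wk_simps)
        then show ?case
          using a.ar_Arr[of "(eps P t, fs)"] a.Dom_ar[of "(eps P t, fs)"] a.Cod_ar[of "(eps P t, fs)"] eps_T[OF f(2)]
          by (simp add: prod_pow_simps s Wk_simps D_star_simps Hom_def)
      next
        case (5 x)
        then obtain t xs where x: "x = (t, xs)" "t \<in> ops T n" "length xs = n" "set xs \<subseteq> Obj (base X)"
          by (cases x) (auto simp: prod_pow_simps Wk_simps)
        then show ?case
          using a.ar_Idn[of "(eps P t, xs)"] eps_T[OF x(2)] by (simp add: prod_pow_simps s Wk_simps D_star_simps)
      next
        case (6 f g)
        then obtain t u v fs gs where f: "f = ((t, u), fs)" "g = ((u, v), gs)" "t \<in> ops T n" "eps P u = eps P t"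
          "length fs = n" "length gs = n" "set fs \<subseteq> Arr (base X)" "set gs \<subseteq> Arr (base X)"
          "map (Dom (base X)) gs = map (Cod (base X)) fs"
          by (cases f; cases g) (auto simp: prod_pow_simps Wk_simps)
        then show ?case
          using a.ar_Cmp'[of "(eps P t, fs)" "(eps P t, gs)"] eps_T[OF f(3)]
          by (simp add: prod_pow_simps s Wk_simps D_star_simps)
      qed (auto intro!: category_prod_cat category_pow_cat category_Wk X.base.category_axioms)
    next
      case (2 q ks rs ass)
      have "map (ob (act X)) (zip (map (eps P) rs) ass) = map (ob (act (strict_as_weak P X))) (zip rs ass)"
        by (auto simp: zip_map1 s)
      then show ?case
        using e[of q ks rs] X.act_gam_ob[of "eps P q" ks "map (eps P) rs" ass] 2
        by (simp add: Wk_simps D_star_simps opc_T)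
    next
      case (3 \<alpha> ks \<beta>s fss)
      let ?\<beta> = "map fst \<beta>s"
      have "list_all2 (\<lambda>k t. t \<in> ops T k) ks ?\<beta>" "fst \<alpha> \<in> ops T (length ks)"
        using 3 by (auto simp: Wk_simps list_all2_conv_all_nth split_beta)
      note e = e[OF this(2,1)]
      have "map (ar (act X)) (zip (map (eps P) ?\<beta>) fss) = map (ar (act (strict_as_weak P X))) (zip \<beta>s fss)"
        by (auto simp: zip_map1 s)
      then show ?case
        using e X.act_gam_ar[of "eps P (fst \<alpha>)" ks "map (eps P) ?\<beta>" fss] 3
        by (simp add: Wk_simps D_star_simps opc_T)
    next
      case (4 a)
      then show ?case using X.act_unt_ob by (simp add: Wk_simps D_star_simps opu_T)
    next
      case (5 f)
      then show ?case using X.act_unt_ar by (simp add: Wk_simps D_star_simps opu_T)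
    qed
  qed
qed

context weak_P_cat begin

definition st_eval :: "('p tree, 'p \<times> 'o list, ('p \<times> 'o list) \<times> ('p \<times> 'o list) \<times> 'm, 'o, 'm) weak_data" where
  "st_eval = \<lparr>und = \<lparr>ob = st_val A, ar = (\<lambda>f. val f)\<rparr>, constr = st_coh\<rparr>"

lemma st_eval_simps: "ob (und st_eval) = st_val A" "ar (und st_eval) = (\<lambda>f. val f)" "constr st_eval = st_coh"
  by (simp_all add: st_eval_def)

abbreviation "S \<equiv> strict_as_weak P (strictification P A)"

lemma S_simps: "base S = st_cat P A" "ob (act S) (t, xs) = st_act_ob P (eps P t) xs"
  "ar (act S) (c, fs) = st_act_ar P A (eps P (fst c)) fs"
  by (simp_all add: strict_as_weak_def strictification_def Wk_to_D_star_def split_beta)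

text \<open>
  Each condition is one of the identities for the comparison isomorphisms: naturality is
  \<open>st_ar_natural\<close>, and the operadic axiom is \<open>st_coh_graft\<close>.
\<close>

lemma weak_morphism_st_eval: "weak_morphism (Wk P) S A st_eval"
proof (rule weak_morphismI, unfold S_simps(1) st_eval_simps, goal_cases)
  case 1
  show ?case by (rule weak_P_category_strict_as_weak[OF strict_P_category_strictification])
next
  case 2
  show ?case by (rule cat_algebra_axioms)
next
  case 3
  show ?case
    by (rule cat_functorI)
      (auto simp: category_st_cat base.category_axioms st_eval_simps st_val_Obj st_cat_simps(2-))
next
  case (4 n q as)
  then show ?case by (simp add: Wk_simps S_simps Hom_def st_coh_Arr st_coh_Dom st_coh_Cod)
next
  case (5 n q as)
  then show ?case by (simp add: Wk_simps st_coh_iso)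
next
  case (6 n \<alpha> fs)
  then show ?case using st_ar_natural[of fs "fst \<alpha>" "snd \<alpha>"]
    by (simp add: Wk_simps(3,4) S_simps parallel_Arr st_cat_simps(3,4) st_ar_def)
next
  case (7 x)
  then show ?case using coh_refl[OF tr_T] opc_opu_left
    by (simp add: Wk_simps opu_T st_coh_def st_act_ob st_val st_cat_simps(1))
next
  case (8 q rs ass)
  have z: "list_all2 (\<lambda>r as. r \<in> ops T (length as)) rs ass"
    using 8(2) by (auto simp: list_all2_conv_all_nth Wk_simps)
  let ?is = "zip rs ass"
  note i = list_all2_zip_index[OF z]
  have m: "map (ob (act S)) ?is = map (\<lambda>i. st_act_ob P (eps P (fst i)) (snd i)) ?is"
    "map2 st_coh rs ass = map (\<lambda>i. st_coh (fst i) (snd i)) ?is"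
    by (auto simp: S_simps)
  have "set (snd i) \<subseteq> stO" if "i \<in> set ?is" for i
    using 8(3) that by (cases i) (auto dest: set_zip_rightD)
  then show ?case
    using st_coh_graft[of q ?is fst snd] 8(1) i unfolding m
    by (simp add: Wk_simps opc_T list_all2_lengthD[OF z])
qed

text \<open>
  Full faithfulness is the definition of the arrows of the strictification. The isomorphism from \<open>v(1, a)\<close> to \<open>a\<close>
  is the coherence arrow from the corolla of the unit of \<open>P\<close> to the unit tree.
\<close>

lemma weak_equivalence_st_eval:
  "weak_equivalence (Wk P) S A st_eval (\<lambda>a. (opu P, [a])) (\<lambda>a. coh (corolla 1 (opu P)) Leaf [a])"
proof (intro weak_equivalence.intro weak_equivalence_axioms.intro weak_morphism_st_eval,
    unfold S_simps(1) st_eval_simps, goal_cases)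
  case (1 f f')
  then show ?case by (simp add: st_cat_simps(3,4) prod_eq_iff)
next
  case (2 x x' g)
  then show ?case by (intro bexI[of _ "(x, x', g)"]) (auto simp: Hom_def st_cat_simps(2-4))
next
  case (3 a)
  then show ?case using opu_ops by (simp add: st_cat_simps(1))
next
  case (4 a)
  have "parallel 1 (corolla 1 (opu P)) Leaf" using corolla_T[OF opu_ops] eps_corolla[OF opu_ops] Leaf_T by (simp add: parallel_def)
  then show ?case using coh_Arr[of "[a]"] coh_Dom[of "[a]"] coh_Cod[of "[a]"] 4 act_unt_ob[OF 4]
    by (simp add: Hom_def st_val Wk_simps opu_T)
next
  case (5 a)
  have "parallel 1 (corolla 1 (opu P)) Leaf" using corolla_T[OF opu_ops] eps_corolla[OF opu_ops] Leaf_T by (simp add: parallel_def)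
  then show ?case using coh_iso[of "[a]"] 5 by simp
qed

end

theorem theorem5p1p4:
  fixes P :: "'p operad_data"
    and A :: "('p tree, 'p tree \<times> 'p tree, 'o, 'm) alg_data"
  assumes "plain_operad P"
    and "weak_P_category P A"
  shows "strict_P_category P (strictification P A) \<and>
    equivalent_in_Wk_P_Cat P A (strict_as_weak P (strictification P A))"
proof -
  interpret weak_P_cat P A by (rule weak_P_cat.intro[OF assms])
  show ?thesis
    using strict_P_category_strictification weak_equivalence.equivalent_algebras_target_source[OF weak_equivalence_st_eval] ..
qed

end
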